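(* Let a cyclic (anti-clockwise) order of five positive masses be given. Consider planar configurations of five bodies with these masses, lying in the given anti-clockwise cyclic order along the boundary of their convex hull, such that four of the five masses form (are located at the vertices of) a trapezoid and the fifth is located on one of the parallel sides of the trapezoid, not coinciding with the two vertices that are the endpoints of that side. Then there is at most one central configuration (up to equivalence) of this type of geometric shape.
   Context: A planar configuration of five bodies with masses $m_1,\dots,m_5>0$ is $x=(x_1,\dots,x_5)\in(\mathbb{R}^2)^5$ with $x_i\neq x_j$ for $i\neq j$, where $x_i$ is the position of the body of mass $m_i$; $r_{ij}=|x_i-x_j|$. Put $m=\sum_i m_i$ and $c=\frac1m\sum_i m_i x_i$. The configuration $x$ is a central configuration if there is a constant $\lambda$ such that for all $j$, $$-\lambda m_j(x_j-c)=\sum_{i\neq j}\frac{m_im_j(x_i-x_j)}{r_{ij}^3}.$$ Two central configurations are equivalent if one can be transformed into the other by a combination of translations, dilations and rotations of the plane. *)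

theory Defs
  imports "HOL-Analysis.Analysis"
begin

type_synonym config = "5 \<Rightarrow> real ^ 2"

definition mass_center :: "(5 \<Rightarrow> real) \<Rightarrow> config \<Rightarrow> real ^ 2" where
  "mass_center m x = (1 / (\<Sum>i\<in>UNIV. m i)) *\<^sub>R (\<Sum>i\<in>UNIV. m i *\<^sub>R x i)"

definition central_configuration :: "(5 \<Rightarrow> real) \<Rightarrow> config \<Rightarrow> bool" where
  "central_configuration m x \<longleftrightarrow>
     inj x \<and>
     (\<exists>l::real. \<forall>j. (- l * m j) *\<^sub>R (x j - mass_center m x) =
        (\<Sum>i\<in>UNIV - {j}. (m i * m j / dist (x i) (x j) ^ 3) *\<^sub>R (x i - x j)))"

definition equivalent_configs :: "config \<Rightarrow> config \<Rightarrow> bool" where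
  "equivalent_configs x y \<longleftrightarrow>
     (\<exists>s Q b. s > 0 \<and> rotation_matrix Q \<and> (\<forall>i. y i = s *\<^sub>R (Q *v x i) + b))"

(* The cyclic order is \<sigma> 0, \<sigma> 1, ..., \<sigma> 4, and back to \<sigma> 0.  The bodies lie on the boundary
   of their convex hull, and their polar angles about an interior point c of the hull increase
   in this order, within one full turn.  The angles need not lie in a fixed interval, so the
   condition depends on \<sigma> only up to a cyclic shift. *)
definition anticlockwise_on_hull :: "(5 \<Rightarrow> 5) \<Rightarrow> config \<Rightarrow> bool" where
  "anticlockwise_on_hull \<sigma> x \<longleftrightarrow>
     range x \<subseteq> frontier (convex hull range x) \<and>
     (\<exists>c \<in> interior (convex hull range x). \<exists>\<rho> \<theta> :: 5 \<Rightarrow> real.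
        (\<forall>k. \<rho> k > 0 \<and> x (\<sigma> k) = c + \<rho> k *\<^sub>R vector [cos (\<theta> k), sin (\<theta> k)]) \<and>
        strict_mono \<theta> \<and> (\<forall>i j. \<theta> j < \<theta> i + 2 * pi))"

(* Vertices in consecutive order, with parallel sides P Q and S R.  Since t > 0, these two
   sides have the same direction, so P Q R S does not cross itself.  Parallelograms (t = 1)
   are included. *)
definition trapezoid :: "real ^ 2 \<Rightarrow> real ^ 2 \<Rightarrow> real ^ 2 \<Rightarrow> real ^ 2 \<Rightarrow> bool" where
  "trapezoid P Q R S \<longleftrightarrow> \<not> collinear {P, Q, R} \<and> (\<exists>t>0. R - S = t *\<^sub>R (Q - P))"

(* Requiring the fifth body f on the side P Q, rather than on either parallel side, loses
   nothing: trapezoid P Q R S and trapezoid R S P Q are the same condition. *)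
definition trapezoidal :: "config \<Rightarrow> bool" where
  "trapezoidal x \<longleftrightarrow>
     (\<exists>p q r s f. distinct [p, q, r, s, f] \<and> trapezoid (x p) (x q) (x r) (x s) \<and>
        x f \<in> open_segment (x p) (x q))"

end

theory Submission
  imports Defs
begin

text \<open>
  Scale a configuration so that the attraction of two bodies at distance \<open>1\<close> cancels the homothetic term, and
  put the three collinear bodies at \<open>x1 < x2 < x3\<close> on the axis and the other two at \<open>(\<plusminus> d / 2, h)\<close>.

  Let \<open>p f q r s\<close> be the bodies in anti-clockwise order, \<open>f\<close> on the side \<open>p q\<close>.  If \<open>x3 - x1 \<le> 1\<close>, the
  configuration is the strict minimum of the sum of \<open>m i * m j * (r\<^sup>2 + 2 / r)\<close> over all such trapezoids with the
  same bodies in the same places: compare with tangents in \<open>r\<^sup>2\<close> for the pairs of a base and a top body, and in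
  \<open>ln r\<close> for the other pairs.  Hence it is determined by the assignment of the bodies to the five places.

  The bound \<open>x3 - x1 \<le> 1\<close>, and the inequalities \<open>m p < m r\<close>, \<open>m q < m s\<close>, \<open>m f < max (m r) (m s)\<close>, come from
  the fact that the ratio of the excess attractions by the two top bodies takes the values \<open>k\<close> and \<open>1 / k\<close>
  at the two ends of the base, where \<open>k = m s / m r\<close>.  A second assignment compatible with the cyclic
  order is a rotation of the first one; the mass inequalities for both are contradictory unless it is trivial.
\<close>

section \<open>The inverse cube law as a function of the squared distance\<close>


text \<open>The two kinds of tangents are matched to each other. By the vertical balance of a base
  body, its two tangents to the top bodies add up to a term containing the competitor only through
  the product of base coordinate and top side. For a base pair, the logarithm of the length is that
  of length times top side minus that of the top side, and a linear bound on the first yields the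
  same products; the horizontal equations then cancel everything. The linear bound points the right
  way only if base distances are at most 1, so uniqueness hinges on the width.

  The obstacle to the width bound is the defect \<open>e = 1 - d^2 / 4 - h^2\<close>: the loss at
  \<open>x\<close> is positive only if \<open>e < x^2 + x * d\<close>, so a large defect would ruin
  any estimate of the ratio. Only the middle body controls it. On the axis it forces
  \<open>e = 0\<close>; off the axis it repeats the ratio of one end, and the critical point in
  between forces \<open>e\<close> to be tiny. What remains is an explicit function on an interval,
  bounded by polynomials.\<close>

definition phi :: "real \<Rightarrow> real" where "phi t = 1 / sqrt t ^ 3"

lemma phi_pos: "0 < t \<Longrightarrow> 0 < phi t"
  by (simp add: phi_def)

lemma phi_one [simp]: "phi 1 = 1"
  by (simp add: phi_def)

lemma phi_square: 
  assumes "0 < t" shows "(phi t)\<^sup>2 * t ^ 3 = 1"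
proof -
  have "(sqrt t ^ 3)\<^sup>2 = (sqrt t ^ 2) ^ 3" by (simp add: power_mult[symmetric])
  also have "\<dots> = t ^ 3" using assms by simp
  finally show ?thesis using assms by (simp add: phi_def power_divide)
qed

lemma phi_le:
  assumes "0 < t" "0 \<le> c" "1 \<le> c\<^sup>2 * t ^ 3" shows "phi t \<le> c"
proof -
  have "(phi t)\<^sup>2 * t ^ 3 \<le> c\<^sup>2 * t ^ 3" using phi_square[OF assms(1)] assms(3) by simp
  hence "(phi t)\<^sup>2 \<le> c\<^sup>2" using assms(1) by simp
  thus ?thesis using assms(2) by (rule power2_le_imp_le)
qed

lemma phi_ge:
  assumes "0 < t" "c\<^sup>2 * t ^ 3 \<le> 1" shows "c \<le> phi t"
proof -
  have "c\<^sup>2 * t ^ 3 \<le> (phi t)\<^sup>2 * t ^ 3" using phi_square[OF assms(1)] assms(2) by simp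
  hence "c\<^sup>2 \<le> (phi t)\<^sup>2" using assms(1) by simp
  thus ?thesis using phi_pos[OF assms(1)] by (meson less_imp_le power2_le_imp_le)
qed

lemma phi_strict_antimono: "0 < s \<Longrightarrow> s < t \<Longrightarrow> phi t < phi s"
  unfolding phi_def by (intro divide_strict_left_mono mult_pos_pos zero_less_power power_strict_mono) auto

lemma phi_antimono: "0 < s \<Longrightarrow> s \<le> t \<Longrightarrow> phi t \<le> phi s"
  using phi_strict_antimono[of s t] by (cases "s = t") auto

lemma phi_less_iff: "0 < s \<Longrightarrow> 0 < t \<Longrightarrow> phi t < phi s \<longleftrightarrow> s < t"
  by (metis linorder_neqE_linordered_idom order.asym phi_strict_antimono)

text \<open>Convexity without calculus: in \<open>v = sqrt s / sqrt t\<close> the gap to the tangent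
  has the factor \<open>(v - 1)^2\<close>, and the cofactor has positive coefficients.\<close>

lemma phi_tangent:
  assumes "0 < s" "0 < t"
  shows "phi t - 3 / 2 * (phi t / t) * (s - t) \<le> phi s"
proof -
  define a where "a = sqrt t"
  define v where "v = sqrt s / sqrt t"
  have a: "a > 0" and v: "v > 0" using assms by (auto simp: a_def v_def)
  have t: "t = a\<^sup>2" using assms by (simp add: a_def)
  have "sqrt s = v * a" using a by (simp add: v_def a_def)
  hence s: "s = (v * a)\<^sup>2" "sqrt s = v * a" using assms by (metis less_imp_le real_sqrt_pow2, simp)
  have "phi s - (phi t - 3 / 2 * (phi t / t) * (s - t))
      = (v - 1)\<^sup>2 * (3 * v ^ 3 + 6 * v\<^sup>2 + 4 * v + 2) / (2 * v ^ 3 * a ^ 3)"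
    unfolding phi_def s(2) unfolding a_def[symmetric] s(1) t using a v
    by (simp add: field_simps) algebra
  also have "\<dots> \<ge> 0" using a v by (intro divide_nonneg_nonneg mult_nonneg_nonneg add_nonneg_nonneg) auto
  finally show ?thesis by simp
qed

lemma phi_convex:
  assumes "0 < s" "0 < t" "0 \<le> u" "u \<le> 1"
  shows "phi ((1 - u) * s + u * t) \<le> (1 - u) * phi s + u * phi t"
proof -
  define c where "c = (1 - u) * s + u * t"
  have c: "0 < c"
  proof (cases "u = 0")
    case False
    then show ?thesis unfolding c_def using assms by (intro add_nonneg_pos) auto
  qed (use assms in \<open>auto simp: c_def\<close>)
  define k where "k = 3 / 2 * (phi c / c)"
  have "(1 - u) * (phi c - k * (s - c)) \<le> (1 - u) * phi s"
    using phi_tangent[OF assms(1) c] assms by (intro mult_left_mono) (auto simp: k_def)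
  moreover have "u * (phi c - k * (t - c)) \<le> u * phi t"
    using phi_tangent[OF assms(2) c] assms by (intro mult_left_mono) (auto simp: k_def)
  moreover have "(1 - u) * (phi c - k * (s - c)) + u * (phi c - k * (t - c))
      = phi c - k * ((1 - u) * s + u * t - c)"
    by algebra
  ultimately show ?thesis unfolding c_def by simp
qed

text \<open>The denominator is the cubic Taylor polynomial of \<open>(1 + w)^(3/2)\<close>.
  Approximating the reciprocal of \<open>phi\<close> keeps the bound valid as far as
  \<open>w = 3\<close>.\<close>

lemma phi_one_plus_le:
  assumes "0 \<le> w" "w \<le> 3"
  shows "phi (1 + w) \<le> 1 / (1 + 3 / 2 * w + 3 / 8 * w\<^sup>2 - w ^ 3 / 16)"
proof -
  define D where "D = 1 + 3 / 2 * w + 3 / 8 * w\<^sup>2 - w ^ 3 / 16"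
  have "w ^ 3 \<le> w\<^sup>2 * 3" using assms by (simp add: power2_eq_square power3_eq_cube mult_left_mono)
  hence D: "D > 0" unfolding D_def using assms zero_le_power2[of w] by linarith
  have "(1 + w) ^ 3 - D\<^sup>2 = w ^ 4 * (12 * (1 + w) - w\<^sup>2) / 256"
    unfolding D_def by (simp add: field_simps power2_eq_square power3_eq_cube eval_nat_numeral)
  moreover have "w\<^sup>2 \<le> 3 * w" using assms by (simp add: power2_eq_square mult_right_mono)
  hence "0 \<le> w ^ 4 * (12 * (1 + w) - w\<^sup>2) / 256"
    using assms by (intro divide_nonneg_nonneg mult_nonneg_nonneg) auto
  ultimately have "D\<^sup>2 \<le> (1 + w) ^ 3" by linarith
  hence "1 \<le> (1 / D)\<^sup>2 * (1 + w) ^ 3" using D by (simp add: field_simps)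
  thus ?thesis using phi_le[of "1 + w" "1 / D"] assms D unfolding D_def by simp
qed

text \<open>The Taylor polynomial of \<open>(1 - z)^(-3/2)\<close> with its fourth coefficient
  \<open>315 / 128\<close> raised to \<open>7 / 2\<close> to absorb the tail. For
  \<open>d \<le> 1\<close> and \<open>e \<le> 1 / 200\<close> the value
  \<open>z = e + x * d - x^2\<close> is at most \<open>51 / 200\<close>, just below
  \<open>32 / 125\<close>.\<close>

lemma phi_one_minus_le:
  assumes "0 \<le> z" "z \<le> 32 / 125"
  shows "phi (1 - z) \<le> 1 + 3 / 2 * z + 15 / 8 * z\<^sup>2 + 35 / 16 * z ^ 3 + 7 / 2 * z ^ 4"
proof (rule phi_le)
  show "1 \<le> (1 + 3 / 2 * z + 15 / 8 * z\<^sup>2 + 35 / 16 * z ^ 3 + 7 / 2 * z ^ 4)\<^sup>2 * (1 - z) ^ 3"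
  proof -
    \<comment> \<open>The factor \<open>z ^ 4\<close> reflects agreement up to third order; the
      cofactor is written in powers of \<open>z\<close> and \<open>32 / 125 - z\<close> so that all
      coefficients are positive.\<close>
    have "(1 + 3 / 2 * z + 15 / 8 * z\<^sup>2 + 35 / 16 * z ^ 3 + 7 / 2 * z ^ 4)\<^sup>2 * (1 - z) ^ 3 - 1
        = z ^ 4 * ((63419342041015625 / 2199023255552) * (32 / 125 - z) ^ 7 + (377285003662109375 / 2199023255552) * z ^ 1 * (32 / 125 - z) ^ 6 + (937974151611328125 / 2199023255552) * z ^ 2 * (32 / 125 - z) ^ 5 + (1250586674560546875 / 2199023255552) * z ^ 3 * (32 / 125 - z) ^ 4 + (948803899935546875 / 2199023255552) * z ^ 4 * (32 / 125 - z) ^ 3 + (394871612710328125 / 2199023255552) * z ^ 5 * (32 / 125 - z) ^ 2 + (75766240207925375 / 2199023255552) * z ^ 6 * (32 / 125 - z) ^ 1 + (3193404827951113 / 2199023255552) * z ^ 7)"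
      by algebra
    also have "\<dots> \<ge> 0"
      using assms by (intro mult_nonneg_nonneg add_nonneg_nonneg zero_le_power) auto
    finally show ?thesis by simp
  qed
qed (use assms in auto)


section \<open>Bounds on the ratio of the excess attractions by the two top bodies\<close>

text \<open>Here \<open>1 - z\<close> and \<open>1 + w\<close> are the squared distances to the two top bodies.  By the Taylor bounds on
  \<^const>\<open>phi\<close>, a nonnegative margin bounds the ratio by \<open>L\<close>.  For \<open>d\<close> and the defect of extreme value the margin
  is a polynomial in the position; below it is expanded, on intervals \<open>0 \<le> y \<le> c\<close>, with nonnegative
  coefficients in terms of the form \<open>y ^ i * (c - y) ^ j\<close>.\<close>

definition ratio_margin :: "real \<Rightarrow> real \<Rightarrow> real \<Rightarrow> real" where
  "ratio_margin L z w = L * (3 / 2 * w + 3 / 8 * w\<^sup>2 - w ^ 3 / 16)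
    - (3 / 2 * z + 15 / 8 * z\<^sup>2 + 35 / 16 * z ^ 3 + 7 / 2 * z ^ 4)
      * (1 + 3 / 2 * w + 3 / 8 * w\<^sup>2 - w ^ 3 / 16)"

lemma ratio_le_if_margin:
  assumes "0 \<le> z" "z \<le> 32 / 125" "0 \<le> w" "w \<le> 3" "0 \<le> L"
    and margin: "0 \<le> ratio_margin L z w"
  shows "phi (1 - z) - 1 \<le> L * (1 - phi (1 + w))"
proof -
  define D where "D = 1 + 3 / 2 * w + 3 / 8 * w\<^sup>2 - w ^ 3 / 16"
  define P where "P = 3 / 2 * z + 15 / 8 * z\<^sup>2 + 35 / 16 * z ^ 3 + 7 / 2 * z ^ 4"
  have "w ^ 3 \<le> w\<^sup>2 * 3" using assms by (simp add: power2_eq_square power3_eq_cube mult_left_mono)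
  hence D: "D > 0" unfolding D_def using assms zero_le_power2[of w] by linarith
  have "D - 1 = 3 / 2 * w + 3 / 8 * w\<^sup>2 - w ^ 3 / 16" by (simp add: D_def)
  hence "P * D \<le> L * (D - 1)" using margin unfolding P_def by (simp only: D_def ratio_margin_def)
  hence "P \<le> L * (1 - 1 / D)" using D by (simp add: field_simps)
  also have "\<dots> \<le> L * (1 - phi (1 + w))"
    using phi_one_plus_le[of w] assms by (intro mult_left_mono) (auto simp: D_def)
  finally show ?thesis using phi_one_minus_le[of z] assms by (simp add: P_def)
qed

lemma ratio_le_const_wide_margin1:
  fixes y :: real
  assumes "0 \<le> y" "y \<le> 43 / 200"
  shows "0 \<le> ratio_margin (23 / 20) (1461 / 10000 + 33 / 50 * y - y\<^sup>2) (1939 / 10000 + 67 / 50 * y + y\<^sup>2)"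
proof -
  have "ratio_margin (23 / 20) (1461 / 10000 + 33 / 50 * y - y\<^sup>2) (1939 / 10000 + 67 / 50 * y + y\<^sup>2)
    = 7 / 32 * y ^ 14 + 483 / 1600 * y ^ 13 + 646807 / 320000 * (y ^ 11 * (43 / 200 - y)) + 99804453 / 64000000 * (y ^ 10 * (43 / 200 - y)) + 2761300491 / 12800000000 * (y ^ 9 * (43 / 200 - y)) + 22281812146871 / 2560000000000 * y ^ 9 + 17638778980149 / 32000000000000 * y ^ 8 + 2970057780911931 / 400000000000000 * (y ^ 6 * (43 / 200 - y)) + 3627007795023684671 / 320000000000000000 * (y ^ 5 * (43 / 200 - y)) + 175499067677160884863 / 64000000000000000000 * y ^ 5 + 30706260949148006093643 / 3200000000000000000000 * y ^ 4 + 351876105347589287141074903 / 3180280000000000000000000000 * (43 / 200 - y) ^ 3 + 1075622428015103455817857509 / 1590140000000000000000000000 * y ^ 1 * (43 / 200 - y) ^ 2 + 850833062333090542825639101 / 12721120000000000000000000000 * y ^ 2 * (43 / 200 - y) ^ 1 + 6831531599579980829767574287 / 2544224000000000000000000000 * y ^ 3"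
    unfolding ratio_margin_def by algebra
  also have "0 \<le> \<dots>"
    using assms by (intro mult_nonneg_nonneg add_nonneg_nonneg zero_le_power) auto
  finally show ?thesis .
qed

text \<open>The arguments belong to the extreme values \<open>d = 1\<close>,
  \<open>e = 1 / 200\<close>. The constant \<open>23 / 20\<close> lies below the line
  \<open>33 / 20 - 13 / 10 * x\<close> up to \<open>x = 19 / 50\<close>, so this bound extends the
  linear one to the left.\<close>

lemma ratio_le_const_wide:
  fixes x :: real
  assumes "17 / 100 \<le> x" "x \<le> 77 / 200"
  shows "phi (1 - (1 / 200 + x - x\<^sup>2)) - 1 \<le> 23 / 20 * (1 - phi (1 + (- 1 / 200 + x + x\<^sup>2)))"
proof (rule ratio_le_if_margin)
  have "0 \<le> (x - 17 / 100) * (77 / 200 - x)" using assms by (intro mult_nonneg_nonneg) auto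
  moreover have "(x - 17 / 100) * (77 / 200 - x) = 111 / 200 * x - 1309 / 20000 - x\<^sup>2" by algebra
  ultimately have sq: "x\<^sup>2 \<le> 111 / 200 * x - 1309 / 20000" by linarith
  show "0 \<le> 1 / 200 + x - x\<^sup>2" using sq assms by linarith
  have "0 \<le> (x - 1 / 2)\<^sup>2" by simp
  thus "1 / 200 + x - x\<^sup>2 \<le> 32 / 125" using assms by (simp add: power2_eq_square algebra_simps)
  show "0 \<le> - 1 / 200 + x + x\<^sup>2" using assms zero_le_power2[of x] by linarith
  show "- 1 / 200 + x + x\<^sup>2 \<le> 3" using sq assms by linarith
  show "(0::real) \<le> 23 / 20" using assms by simp
  consider "17 / 100 \<le> x" "x \<le> 77 / 200" using assms by linarith
  thus "0 \<le> ratio_margin (23 / 20) (1 / 200 + x - x\<^sup>2) (- 1 / 200 + x + x\<^sup>2)"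
  proof cases
    case 1
    have "1 / 200 + x - x\<^sup>2 = 1461 / 10000 + 33 / 50 * (x - 17 / 100) - (x - 17 / 100)\<^sup>2" "- 1 / 200 + x + x\<^sup>2 = 1939 / 10000 + 67 / 50 * (x - 17 / 100) + (x - 17 / 100)\<^sup>2" by algebra+
    thus ?thesis using ratio_le_const_wide_margin1[of "x - 17 / 100"] 1 by simp
  qed
qed

lemma ratio_le_linear_wide_margin1:
  fixes y :: real
  assumes "0 \<le> y" "y \<le> 313 / 2000"
  shows "0 \<le> ratio_margin (289 / 250 - 13 / 10 * y) (1203 / 5000 + 6 / 25 * y - y\<^sup>2) (2597 / 5000 + 44 / 25 * y + y\<^sup>2)"
proof -
  have "ratio_margin (289 / 250 - 13 / 10 * y) (1203 / 5000 + 6 / 25 * y - y\<^sup>2) (2597 / 5000 + 44 / 25 * y + y\<^sup>2)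
    = 7 / 32 * y ^ 14 + 189 / 200 * y ^ 13 + 25543 / 80000 * (y ^ 11 * (313 / 2000 - y)) + 718823679 / 160000000 * (y ^ 10 * (313 / 2000 - y)) + 2508703686327 / 320000000000 * (y ^ 9 * (313 / 2000 - y)) + 976919682883649 / 640000000000000 * y ^ 9 + 13876668212277 / 1000000000000 * y ^ 8 + 157226596759861 / 25000000000000 * y ^ 7 + 260969589565822199 / 20000000000000000 * (y ^ 5 * (313 / 2000 - y)) + 529854493835342312447 / 40000000000000000000 * (y ^ 4 * (313 / 2000 - y)) + 304019093325840887143289 / 80000000000000000000000 * y ^ 4 + 15603529094490221000675227 / 1197824101562500000000000 * (313 / 2000 - y) ^ 3 + 1119967348705075422269410771 / 47912964062500000000000000 * y ^ 1 * (313 / 2000 - y) ^ 2 + 72874664402523067393534909607 / 7666074250000000000000000000 * y ^ 2 * (313 / 2000 - y) ^ 1 + 8321355480024856441084450821 / 1197824101562500000000000000 * y ^ 3"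
    unfolding ratio_margin_def by algebra
  also have "0 \<le> \<dots>"
    using assms by (intro mult_nonneg_nonneg add_nonneg_nonneg zero_le_power) auto
  finally show ?thesis .
qed

lemma ratio_le_linear_wide_margin2:
  fixes y :: real
  assumes "0 \<le> y" "y \<le> 313 / 2000"
  shows "0 \<le> ratio_margin (19051 / 20000 - 13 / 10 * y) (1014671 / 4000000 - 73 / 1000 * y - y\<^sup>2) (3277329 / 4000000 + 2073 / 1000 * y + y\<^sup>2)"
proof -
  have "ratio_margin (19051 / 20000 - 13 / 10 * y) (1014671 / 4000000 - 73 / 1000 * y - y\<^sup>2) (3277329 / 4000000 + 2073 / 1000 * y + y\<^sup>2)
    = 7 / 32 * y ^ 14 + 45577 / 32000 * y ^ 13 + 267630573 / 128000000 * y ^ 12 + 187633414171 / 64000000000 * (y ^ 10 * (313 / 2000 - y)) + 1494252695275881 / 102400000000000 * (y ^ 9 * (313 / 2000 - y)) + 16902713689622189463 / 1024000000000000000 * (y ^ 8 * (313 / 2000 - y)) + 185348794162718299263 / 40960000000000000000 * y ^ 8 + 11228215189133084423690291 / 512000000000000000000000 * y ^ 7 + 25821240152566486149106164701 / 8192000000000000000000000000 * y ^ 6 + 141184794977253932263010570119609 / 8192000000000000000000000000000 * (y ^ 4 * (313 / 2000 - y)) + 293321819250908220346014548082248691 / 32768000000000000000000000000000000 * (y ^ 3 * (313 / 2000 - y)) + 15166355759543505130096826783163742224657559863 / 2009615368192000000000000000000000000000000000 * (313 / 2000 - y) ^ 3 + 72380821510406058691345714480187871423293881831 / 2009615368192000000000000000000000000000000000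 * y ^ 1 * (313 / 2000 - y) ^ 2 + 77103645873940287394480628535575700929175660443 / 1004807684096000000000000000000000000000000000 * y ^ 2 * (313 / 2000 - y) ^ 1 + 110109306411617234044705577396003622131477283879 / 2009615368192000000000000000000000000000000000 * y ^ 3"
    unfolding ratio_margin_def by algebra
  also have "0 \<le> \<dots>"
    using assms by (intro mult_nonneg_nonneg add_nonneg_nonneg zero_le_power) auto
  finally show ?thesis .
qed

lemma ratio_le_linear_wide_margin3:
  fixes y :: real
  assumes "0 \<le> y" "y \<le> 313 / 1000"
  shows "0 \<le> ratio_margin (7491 / 10000 - 13 / 10 * y) (217751 / 1000000 - 193 / 500 * y - y\<^sup>2) (1168249 / 1000000 + 1193 / 500 * y + y\<^sup>2)"
proof -
  have "ratio_margin (7491 / 10000 - 13 / 10 * y) (217751 / 1000000 - 193 / 500 * y - y\<^sup>2) (1168249 / 1000000 + 1193 / 500 * y + y\<^sup>2)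
    = 7 / 32 * y ^ 14 + 30457 / 16000 * y ^ 13 + 175235613 / 32000000 * y ^ 12 + 32168130309 / 8000000000 * y ^ 11 + 451454663472993 / 32000000000000 * (y ^ 9 * (313 / 1000 - y)) + 1353334953755536107 / 32000000000000000 * (y ^ 8 * (313 / 1000 - y)) + 684650680361509633131 / 16000000000000000000 * (y ^ 7 * (313 / 1000 - y)) + 31878859002562511821319 / 16000000000000000000000 * (y ^ 6 * (313 / 1000 - y)) + 799195711908378985738355327 / 32000000000000000000000000 * y ^ 6 + 46307822390041654352400684649 / 16000000000000000000000000000 * (y ^ 4 * (313 / 1000 - y)) + 526759721535663511922195420278531 / 32000000000000000000000000000000 * (y ^ 3 * (313 / 1000 - y)) + 6723686341229136907054057913366128640248743 / 981257504000000000000000000000000000000000 * (313 / 1000 - y) ^ 3 + 41264086196930234434629515445926298019572311 / 981257504000000000000000000000000000000000 * y ^ 1 * (313 / 1000 - y) ^ 2 + 41358483141321086939362055517298162988742323 / 490628752000000000000000000000000000000000 * y ^ 2 * (313 / 1000 - y) ^ 1 + 43620540852728023234396214843113043131399879 / 981257504000000000000000000000000000000000 * y ^ 3"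
    unfolding ratio_margin_def by algebra
  also have "0 \<le> \<dots>"
    using assms by (intro mult_nonneg_nonneg add_nonneg_nonneg zero_le_power) auto
  finally show ?thesis .
qed

text \<open>The line has the value 1 at \<open>x = 1 / 2\<close>: used at both ends of the base, it
  yields a total width of at most \<open>2 * (1 / 2)\<close>. The upper limit
  \<open>503 / 500\<close> lies beyond the positive zero of
  \<open>1 / 200 + x - x^2\<close>.\<close>

lemma ratio_le_linear_wide:
  fixes x :: real
  assumes "19 / 50 \<le> x" "x \<le> 503 / 500" "0 \<le> 1 / 200 + x - x\<^sup>2"
  shows "phi (1 - (1 / 200 + x - x\<^sup>2)) - 1 \<le> (33 / 20 - 13 / 10 * x) * (1 - phi (1 + (- 1 / 200 + x + x\<^sup>2)))"
proof (rule ratio_le_if_margin)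
  have "0 \<le> (x - 19 / 50) * (503 / 500 - x)" using assms by (intro mult_nonneg_nonneg) auto
  moreover have "(x - 19 / 50) * (503 / 500 - x) = 693 / 500 * x - 9557 / 25000 - x\<^sup>2" by algebra
  ultimately have sq: "x\<^sup>2 \<le> 693 / 500 * x - 9557 / 25000" by linarith
  show "0 \<le> 1 / 200 + x - x\<^sup>2" using sq assms by linarith
  have "0 \<le> (x - 1 / 2)\<^sup>2" by simp
  thus "1 / 200 + x - x\<^sup>2 \<le> 32 / 125" using assms by (simp add: power2_eq_square algebra_simps)
  show "0 \<le> - 1 / 200 + x + x\<^sup>2" using assms zero_le_power2[of x] by linarith
  show "- 1 / 200 + x + x\<^sup>2 \<le> 3" using sq assms by linarith
  show "(0::real) \<le> 33 / 20 - 13 / 10 * x" using assms by simp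
  consider "19 / 50 \<le> x" "x \<le> 1073 / 2000" | "1073 / 2000 \<le> x" "x \<le> 693 / 1000" | "693 / 1000 \<le> x" "x \<le> 503 / 500" using assms by linarith
  thus "0 \<le> ratio_margin (33 / 20 - 13 / 10 * x) (1 / 200 + x - x\<^sup>2) (- 1 / 200 + x + x\<^sup>2)"
  proof cases
    case 1
    have "1 / 200 + x - x\<^sup>2 = 1203 / 5000 + 6 / 25 * (x - 19 / 50) - (x - 19 / 50)\<^sup>2" "- 1 / 200 + x + x\<^sup>2 = 2597 / 5000 + 44 / 25 * (x - 19 / 50) + (x - 19 / 50)\<^sup>2" "33 / 20 - 13 / 10 * x = 289 / 250 - 13 / 10 * (x - 19 / 50)" by algebra+
    thus ?thesis using ratio_le_linear_wide_margin1[of "x - 19 / 50"] 1 by simp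
  next
    case 2
    have "1 / 200 + x - x\<^sup>2 = 1014671 / 4000000 - 73 / 1000 * (x - 1073 / 2000) - (x - 1073 / 2000)\<^sup>2" "- 1 / 200 + x + x\<^sup>2 = 3277329 / 4000000 + 2073 / 1000 * (x - 1073 / 2000) + (x - 1073 / 2000)\<^sup>2" "33 / 20 - 13 / 10 * x = 19051 / 20000 - 13 / 10 * (x - 1073 / 2000)" by algebra+
    thus ?thesis using ratio_le_linear_wide_margin2[of "x - 1073 / 2000"] 2 by simp
  next
    case 3
    have "1 / 200 + x - x\<^sup>2 = 217751 / 1000000 - 193 / 500 * (x - 693 / 1000) - (x - 693 / 1000)\<^sup>2" "- 1 / 200 + x + x\<^sup>2 = 1168249 / 1000000 + 1193 / 500 * (x - 693 / 1000) + (x - 693 / 1000)\<^sup>2" "33 / 20 - 13 / 10 * x = 7491 / 10000 - 13 / 10 * (x - 693 / 1000)" by algebra+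
    thus ?thesis using ratio_le_linear_wide_margin3[of "x - 693 / 1000"] 3 by simp
  qed
qed

lemma ratio_le_linear_narrow_margin1:
  fixes y :: real
  assumes "0 \<le> y" "y \<le> 43 / 500"
  shows "0 \<le> ratio_margin (577 / 500 - 11 / 10 * y) (123 / 625 + 81 / 200 * y - y\<^sup>2) (859 / 2500 + 61 / 40 * y + y\<^sup>2)"
proof -
  have "ratio_margin (577 / 500 - 11 / 10 * y) (123 / 625 + 81 / 200 * y - y\<^sup>2) (859 / 2500 + 61 / 40 * y + y\<^sup>2)
    = 7 / 32 * y ^ 14 + 4137 / 6400 * y ^ 13 + 65317 / 51200 * (y ^ 11 * (43 / 500 - y)) + 888814241 / 256000000 * (y ^ 10 * (43 / 500 - y)) + 875794734901 / 256000000000 * (y ^ 9 * (43 / 500 - y)) + 1635997536068789 / 256000000000000 * y ^ 9 + 18049321269285729 / 2048000000000000 * y ^ 8 + 678593878109119273 / 409600000000000000 * (y ^ 6 * (43 / 500 - y)) + 2632442435330929058639 / 204800000000000000000 * (y ^ 5 * (43 / 500 - y)) + 488860432618479654192677 / 102400000000000000000000 * (y ^ 4 * (43 / 500 - y)) + 400457998295924181384370889 / 51200000000000000000000000 * y ^ 4 + 22005453842661131746609 / 388217773437500000000 * (43 / 500 - y) ^ 3 + 8639186693527080265979281 / 62114843750000000000000 * y ^ 1 * (43 / 500 - y) ^ 2 + 983403477111282215940328559 / 9938375000000000000000000 * y ^ 2 * (43 / 500 - y) ^ 1 + 34144136412610963887330707623 / 1590140000000000000000000000 * y ^ 3"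
    unfolding ratio_margin_def by algebra
  also have "0 \<le> \<dots>"
    using assms by (intro mult_nonneg_nonneg add_nonneg_nonneg zero_le_power) auto
  finally show ?thesis .
qed

lemma ratio_le_linear_narrow_margin2:
  fixes y :: real
  assumes "0 \<le> y" "y \<le> 173 / 2000"
  shows "0 \<le> ratio_margin (5297 / 5000 - 11 / 10 * y) (112117 / 500000 + 233 / 1000 * y - y\<^sup>2) (241073 / 500000 + 1697 / 1000 * y + y\<^sup>2)"
proof -
  have "ratio_margin (5297 / 5000 - 11 / 10 * y) (112117 / 500000 + 233 / 1000 * y - y\<^sup>2) (241073 / 500000 + 1697 / 1000 * y + y\<^sup>2)
    = 7 / 32 * y ^ 14 + 29113 / 32000 * y ^ 13 + 12986043 / 32000000 * (y ^ 11 * (173 / 2000 - y)) + 274580300253 / 64000000000 * (y ^ 10 * (173 / 2000 - y)) + 917429451499581 / 128000000000000 * (y ^ 9 * (173 / 2000 - y)) + 476326620136590399 / 256000000000000000 * y ^ 9 + 402072001978187073951 / 32000000000000000000 * y ^ 8 + 188265481810874314104139 / 32000000000000000000000 * y ^ 7 + 185119136304314408933105557 / 16000000000000000000000000 * (y ^ 5 * (173 / 2000 - y)) + 356163130938666336005957212917 / 32000000000000000000000000000 * (y ^ 4 * (173 / 2000 - y)) + 274053908349258592315289379505823 / 64000000000000000000000000000000 * y ^ 4 + 3521380504779266243479944261320329983299 / 161803656250000000000000000000000000000 * (173 / 2000 - y) ^ 3 + 21857661760986946421647352847288601356089 / 647214625000000000000000000000000000000 * y ^ 1 * (173 / 2000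 - y) ^ 2 + 30172550245234027286153623219743490628089 / 2588858500000000000000000000000000000000 * y ^ 2 * (173 / 2000 - y) ^ 1 + 72150626670422085065222973476280065283449 / 10355434000000000000000000000000000000000 * y ^ 3"
    unfolding ratio_margin_def by algebra
  also have "0 \<le> \<dots>"
    using assms by (intro mult_nonneg_nonneg add_nonneg_nonneg zero_le_power) auto
  finally show ?thesis .
qed

lemma ratio_le_linear_narrow_margin3:
  fixes y :: real
  assumes "0 \<le> y" "y \<le> 69 / 400"
  shows "0 \<le> ratio_margin (3857 / 4000 - 11 / 10 * y) (7581 / 32000 + 3 / 50 * y - y\<^sup>2) (101827 / 160000 + 187 / 100 * y + y\<^sup>2)"
proof -
  have "ratio_margin (3857 / 4000 - 11 / 10 * y) (7581 / 32000 + 3 / 50 * y - y\<^sup>2) (101827 / 160000 + 187 / 100 * y + y\<^sup>2)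
    = 7 / 32 * y ^ 14 + 3759 / 3200 * y ^ 13 + 784567 / 1024000 * y ^ 12 + 1048051753 / 256000000 * (y ^ 10 * (69 / 400 - y)) + 379161424533 / 32768000000 * (y ^ 9 * (69 / 400 - y)) + 2347679950421917 / 327680000000000 * (y ^ 8 * (69 / 400 - y)) + 688914190343999979 / 65536000000000000 * y ^ 8 + 9593788538330092277 / 655360000000000000 * y ^ 7 + 111776430360985605258139 / 20971520000000000000000 * (y ^ 5 * (69 / 400 - y)) + 26282034849792600057099111 / 1677721600000000000000000 * (y ^ 4 * (69 / 400 - y)) + 4955158669356183764296596307 / 1677721600000000000000000000 * (y ^ 3 * (69 / 400 - y)) + 652752037929885643833540243136301 / 705467705720832000000000000000000 * (69 / 400 - y) ^ 3 + 6409821249731980480495034213894453 / 1175779509534720000000000000000000 * y ^ 1 * (69 / 400 - y) ^ 2 + 126498241245153128676873938542781 / 5103209676800000000000000000000 * y ^ 2 * (69 / 400 - y) ^ 1 + 3085926250081555953947920245974000819 / 110229329018880000000000000000000000 * y ^ 3"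
    unfolding ratio_margin_def by algebra
  also have "0 \<le> \<dots>"
    using assms by (intro mult_nonneg_nonneg add_nonneg_nonneg zero_le_power) auto
  finally show ?thesis .
qed

lemma ratio_le_linear_narrow_margin4:
  fixes y :: real
  assumes "0 \<le> y" "y \<le> 69 / 200"
  shows "0 \<le> ratio_margin (1549 / 2000 - 11 / 10 * y) (87 / 400 - 57 / 200 * y - y\<^sup>2) (791 / 800 + 443 / 200 * y + y\<^sup>2)"
proof -
  have "ratio_margin (1549 / 2000 - 11 / 10 * y) (87 / 400 - 57 / 200 * y - y\<^sup>2) (791 / 800 + 443 / 200 * y + y\<^sup>2)
    = 7 / 32 * y ^ 14 + 10899 / 6400 * y ^ 13 + 5110721 / 1280000 * y ^ 12 + 160559147 / 256000000 * y ^ 11 + 778756880229 / 51200000000 * (y ^ 9 * (69 / 200 - y)) + 87506697875051 / 2560000000000 * (y ^ 8 * (69 / 200 - y)) + 52225796541554169 / 2048000000000000 * (y ^ 7 * (69 / 200 - y)) + 898792865709085547 / 102400000000000000 * y ^ 7 + 28877408955400004017 / 1638400000000000000 * y ^ 6 + 57530942112294725493 / 6553600000000000000 * (y ^ 4 * (69 / 200 - y)) + 19902464159217452269967 / 1310720000000000000000 * (y ^ 3 * (69 / 200 - y)) + 60303359782934938567 / 17223332659200000000 * (69 / 200 - y) ^ 3 + 1199820702055355682367 / 47842590720000000000 * y ^ 1 * (69 / 200 - y) ^ 2 + 208032647095155323432963 / 3588194304000000000000 * y ^ 2 * (69 / 200 - y) ^ 1 + 2999645221518104722296507914993 / 86116663296000000000000000000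 * y ^ 3"
    unfolding ratio_margin_def by algebra
  also have "0 \<le> \<dots>"
    using assms by (intro mult_nonneg_nonneg add_nonneg_nonneg zero_le_power) auto
  finally show ?thesis .
qed

text \<open>The shorter top side \<open>d = 193 / 200\<close> permits a line with the value 1
  already at \<open>x = 21 / 50\<close>, half of the width \<open>21 / 25\<close>.\<close>

lemma ratio_le_linear_narrow:
  fixes x :: real
  assumes "7 / 25 \<le> x" "x \<le> 97 / 100"
  shows "phi (1 - (1 / 200 + 193 / 200 * x - x\<^sup>2)) - 1 \<le> (731 / 500 - 11 / 10 * x) * (1 - phi (1 + (- 1 / 200 + 193 / 200 * x + x\<^sup>2)))"
proof (rule ratio_le_if_margin)
  have "0 \<le> (x - 7 / 25) * (97 / 100 - x)" using assms by (intro mult_nonneg_nonneg) auto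
  moreover have "(x - 7 / 25) * (97 / 100 - x) = 5 / 4 * x - 679 / 2500 - x\<^sup>2" by algebra
  ultimately have sq: "x\<^sup>2 \<le> 5 / 4 * x - 679 / 2500" by linarith
  show "0 \<le> 1 / 200 + 193 / 200 * x - x\<^sup>2" using sq assms by linarith
  have "0 \<le> (x - 1 / 2)\<^sup>2" by simp
  thus "1 / 200 + 193 / 200 * x - x\<^sup>2 \<le> 32 / 125" using assms by (simp add: power2_eq_square algebra_simps)
  show "0 \<le> - 1 / 200 + 193 / 200 * x + x\<^sup>2" using assms zero_le_power2[of x] by linarith
  show "- 1 / 200 + 193 / 200 * x + x\<^sup>2 \<le> 3" using sq assms by linarith
  show "(0::real) \<le> 731 / 500 - 11 / 10 * x" using assms by simp
  consider "7 / 25 \<le> x" "x \<le> 183 / 500" | "183 / 500 \<le> x" "x \<le> 181 / 400" | "181 / 400 \<le> x" "x \<le> 5 / 8" | "5 / 8 \<le> x" "x \<le> 97 / 100" using assms by linarith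
  thus "0 \<le> ratio_margin (731 / 500 - 11 / 10 * x) (1 / 200 + 193 / 200 * x - x\<^sup>2) (- 1 / 200 + 193 / 200 * x + x\<^sup>2)"
  proof cases
    case 1
    have "1 / 200 + 193 / 200 * x - x\<^sup>2 = 123 / 625 + 81 / 200 * (x - 7 / 25) - (x - 7 / 25)\<^sup>2" "- 1 / 200 + 193 / 200 * x + x\<^sup>2 = 859 / 2500 + 61 / 40 * (x - 7 / 25) + (x - 7 / 25)\<^sup>2" "731 / 500 - 11 / 10 * x = 577 / 500 - 11 / 10 * (x - 7 / 25)" by algebra+
    thus ?thesis using ratio_le_linear_narrow_margin1[of "x - 7 / 25"] 1 by simp
  next
    case 2
    have "1 / 200 + 193 / 200 * x - x\<^sup>2 = 112117 / 500000 + 233 / 1000 * (x - 183 / 500) - (x - 183 / 500)\<^sup>2" "- 1 / 200 + 193 / 200 * x + x\<^sup>2 = 241073 / 500000 + 1697 / 1000 * (x - 183 / 500) + (x - 183 / 500)\<^sup>2" "731 / 500 - 11 / 10 * x = 5297 / 5000 - 11 / 10 * (x - 183 / 500)" by algebra+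
    thus ?thesis using ratio_le_linear_narrow_margin2[of "x - 183 / 500"] 2 by simp
  next
    case 3
    have "1 / 200 + 193 / 200 * x - x\<^sup>2 = 7581 / 32000 + 3 / 50 * (x - 181 / 400) - (x - 181 / 400)\<^sup>2" "- 1 / 200 + 193 / 200 * x + x\<^sup>2 = 101827 / 160000 + 187 / 100 * (x - 181 / 400) + (x - 181 / 400)\<^sup>2" "731 / 500 - 11 / 10 * x = 3857 / 4000 - 11 / 10 * (x - 181 / 400)" by algebra+
    thus ?thesis using ratio_le_linear_narrow_margin3[of "x - 181 / 400"] 3 by simp
  next
    case 4
    have "1 / 200 + 193 / 200 * x - x\<^sup>2 = 87 / 400 - 57 / 200 * (x - 5 / 8) - (x - 5 / 8)\<^sup>2" "- 1 / 200 + 193 / 200 * x + x\<^sup>2 = 791 / 800 + 443 / 200 * (x - 5 / 8) + (x - 5 / 8)\<^sup>2" "731 / 500 - 11 / 10 * x = 1549 / 2000 - 11 / 10 * (x - 5 / 8)" by algebra+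
    thus ?thesis using ratio_le_linear_narrow_margin4[of "x - 5 / 8"] 4 by simp
  qed
qed

lemma ratio_le_const_small_margin1:
  fixes y :: real
  assumes "0 \<le> y" "y \<le> 171 / 1000"
  shows "0 \<le> ratio_margin (32 / 25) (0 + y - 3 / 4 * y\<^sup>2) (0 + y + 3 / 4 * y\<^sup>2)"
proof -
  have "ratio_margin (32 / 25) (0 + y - 3 / 4 * y\<^sup>2) (0 + y + 3 / 4 * y\<^sup>2)
    = 15309 / 524288 * y ^ 14 + 5103 / 131072 * (y ^ 12 * (171 / 1000 - y)) + 13772997 / 32768000 * (y ^ 11 * (171 / 1000 - y)) + 24860817513 / 32768000000 * y ^ 11 + 13203 / 65536 * (y ^ 9 * (171 / 1000 - y)) + 140410287 / 65536000 * y ^ 9 + 85173 / 16384 * (y ^ 7 * (171 / 1000 - y)) + 12420583 / 16384000 * (y ^ 6 * (171 / 1000 - y)) + 2107120307 / 16384000000 * y ^ 6 + 49161 / 6400 * y ^ 5 + 1537 / 3200 * (y ^ 3 * (171 / 1000 - y)) + 140000 / 9747 * y ^ 1 * (171 / 1000 - y) ^ 2 + 218440 / 9747 * y ^ 2 * (171 / 1000 - y) ^ 1 + 182634481231 / 31190400000 * y ^ 3"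
    unfolding ratio_margin_def by algebra
  also have "0 \<le> \<dots>"
    using assms by (intro mult_nonneg_nonneg add_nonneg_nonneg zero_le_power) auto
  finally show ?thesis .
qed

text \<open>Near \<open>x = 0\<close> a fixed defect would make \<open>w\<close> negative, so the
  defect is tied to the position as \<open>e = x^2 / 4\<close>. The constant satisfies
  \<open>32 / 25 * (779 / 1000) < 1\<close>, which is what excludes a very short half of a wide
  base.\<close>

lemma ratio_le_const_small:
  fixes x :: real
  assumes "0 \<le> x" "x \<le> 171 / 1000"
  shows "phi (1 - (x - 3 / 4 * x\<^sup>2)) - 1 \<le> (32 / 25) * (1 - phi (1 + (x + 3 / 4 * x\<^sup>2)))"
proof (rule ratio_le_if_margin)
  have "0 \<le> (x) * (171 / 1000 - x)" using assms by (intro mult_nonneg_nonneg) auto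
  moreover have "(x) * (171 / 1000 - x) = 171 / 1000 * x - x\<^sup>2" by algebra
  ultimately have sq: "x\<^sup>2 \<le> 171 / 1000 * x" by linarith
  show "0 \<le> x - 3 / 4 * x\<^sup>2" using sq assms by linarith
  have "0 \<le> (x - 1 / 2)\<^sup>2" by simp
  thus "x - 3 / 4 * x\<^sup>2 \<le> 32 / 125" using assms by (simp add: power2_eq_square algebra_simps)
  show "0 \<le> x + 3 / 4 * x\<^sup>2" using assms zero_le_power2[of x] by linarith
  show "x + 3 / 4 * x\<^sup>2 \<le> 3" using sq assms by linarith
  show "(0::real) \<le> 32 / 25" using assms by simp
  consider "0 \<le> x" "x \<le> 171 / 1000" using assms by linarith
  thus "0 \<le> ratio_margin (32 / 25) (x - 3 / 4 * x\<^sup>2) (x + 3 / 4 * x\<^sup>2)"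
  proof cases
    case 1
    thus ?thesis using ratio_le_const_small_margin1[of x] by simp
  qed
qed


text \<open>Both sides are convex in \<open>d\<close> after moving the second term of the right one, so the end points
  \<open>0\<close> and \<open>D\<close> suffice, and \<open>0\<close> is trivial.\<close>

lemma ratio_le_mono:
  fixes x d D e e' L :: real
  assumes "0 \<le> d" "d \<le> D" "0 < D" "0 \<le> L" "e \<le> e'" "e' \<le> x\<^sup>2"
    and pos: "0 < 1 - (e' + x * D - x\<^sup>2)" and "0 \<le> x"
    and le: "phi (1 - (e' + x * D - x\<^sup>2)) - 1 \<le> L * (1 - phi (1 + (x\<^sup>2 + x * D - e')))"
  shows "phi (1 - (e + x * d - x\<^sup>2)) - 1 \<le> L * (1 - phi (1 + (x\<^sup>2 + x * d - e)))"
proof -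
  define u where "u = d / D"
  have u: "0 \<le> u" "u \<le> 1" and d: "d = u * D" using assms by (auto simp: u_def)
  have xd: "x * d \<le> x * D" using assms by (intro mult_left_mono) auto
  have xd0: "0 \<le> x * d" "0 \<le> x * D" using assms by auto
  have "phi (1 - (e + x * d - x\<^sup>2)) \<le> phi (1 - (e' + x * d - x\<^sup>2))"
    using assms xd by (intro phi_antimono) linarith+
  also have "1 - (e' + x * d - x\<^sup>2) = (1 - u) * (1 - (e' - x\<^sup>2)) + u * (1 - (e' + x * D - x\<^sup>2))"
    unfolding d by algebra
  also have "phi \<dots> \<le> (1 - u) * phi (1 - (e' - x\<^sup>2)) + u * phi (1 - (e' + x * D - x\<^sup>2))"
    using assms u by (intro phi_convex) linarith+
  finally have A: "phi (1 - (e + x * d - x\<^sup>2)) \<le>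
    (1 - u) * phi (1 + (x\<^sup>2 - e')) + u * phi (1 - (e' + x * D - x\<^sup>2))" by (simp add: algebra_simps)
  have "phi (1 + (x\<^sup>2 + x * d - e)) \<le> phi (1 + (x\<^sup>2 + x * d - e'))"
    using assms xd0 by (intro phi_antimono) linarith+
  also have "1 + (x\<^sup>2 + x * d - e') = (1 - u) * (1 + (x\<^sup>2 - e')) + u * (1 + (x\<^sup>2 + x * D - e'))"
    unfolding d by algebra
  also have "phi \<dots> \<le> (1 - u) * phi (1 + (x\<^sup>2 - e')) + u * phi (1 + (x\<^sup>2 + x * D - e'))"
    using assms u xd0 by (intro phi_convex) linarith+
  finally have B: "L * phi (1 + (x\<^sup>2 + x * d - e)) \<le>
    L * ((1 - u) * phi (1 + (x\<^sup>2 - e')) + u * phi (1 + (x\<^sup>2 + x * D - e')))"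
    using \<open>0 \<le> L\<close> by (intro mult_left_mono)
  have "phi (1 + (x\<^sup>2 - e')) \<le> phi 1" using assms by (intro phi_antimono) auto
  hence "(1 - u) * (1 + L) * phi (1 + (x\<^sup>2 - e')) \<le> (1 - u) * (1 + L) * 1"
    using u assms by (intro mult_left_mono mult_nonneg_nonneg) auto
  moreover have "u * (phi (1 - (e' + x * D - x\<^sup>2)) - 1) \<le> u * (L * (1 - phi (1 + (x\<^sup>2 + x * D - e'))))"
    using u le by (intro mult_left_mono) auto
  ultimately show ?thesis using A B by (simp add: algebra_simps)
qed

section \<open>Critical points of the ratio\<close>

lemma five_halves_upper:
  fixes w :: real
  assumes "0 \<le> w"
  shows "(1 + w)\<^sup>2 * sqrt (1 + w) \<le> 1 + 5 / 2 * w + 15 / 8 * w\<^sup>2 + 5 / 16 * w ^ 3"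
proof (rule power2_le_imp_le)
  have "(1 + 5 / 2 * w + 15 / 8 * w\<^sup>2 + 5 / 16 * w ^ 3)\<^sup>2 - (1 + w) ^ 5 
    = w ^ 4 * (5 / 64 + 11 / 64 * w + 25 / 256 * w\<^sup>2)" by algebra
  also have "0 \<le> \<dots>" using assms by simp
  moreover have "((1 + w)\<^sup>2 * sqrt (1 + w))\<^sup>2 = (1 + w) ^ 5"
    using assms by (simp add: power_mult_distrib eval_nat_numeral)
  ultimately show "((1 + w)\<^sup>2 * sqrt (1 + w))\<^sup>2 \<le> (1 + 5 / 2 * w + 15 / 8 * w\<^sup>2 + 5 / 16 * w ^ 3)\<^sup>2"
    by linarith
qed (use assms in simp)

text \<open>An upper bound for \<open>(1 - z)^(5/2)\<close>, hence a lower bound for the difference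
  \<open>(1 - z) - (1 - z)^(5/2)\<close> in the equation of a critical point. Both cubics are Taylor
  polynomials.\<close>

lemma five_halves_lower:
  fixes z :: real
  assumes "0 \<le> z" "z \<le> 1"
  shows "(1 - z)\<^sup>2 * sqrt (1 - z) \<le> 1 - 5 / 2 * z + 15 / 8 * z\<^sup>2 - 5 / 16 * z ^ 3"
proof (rule power2_le_imp_le)
  have "(1 - 5 / 2 * z + 15 / 8 * z\<^sup>2 - 5 / 16 * z ^ 3)\<^sup>2 - (1 - z) ^ 5 
    = z ^ 4 * (1 / 400 + 25 / 256 * (z - 22 / 25)\<^sup>2)" by algebra
  also have "0 \<le> \<dots>" using assms by simp
  moreover have "((1 - z)\<^sup>2 * sqrt (1 - z))\<^sup>2 = (1 - z) ^ 5"
    using assms by (simp add: power_mult_distrib eval_nat_numeral)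
  ultimately show "((1 - z)\<^sup>2 * sqrt (1 - z))\<^sup>2 \<le> (1 - 5 / 2 * z + 15 / 8 * z\<^sup>2 - 5 / 16 * z ^ 3)\<^sup>2"
    by linarith
  show "0 \<le> 1 - 5 / 2 * z + 15 / 8 * z\<^sup>2 - 5 / 16 * z ^ 3"
  proof -
    have "1 - 5 / 2 * z + 15 / 8 * z\<^sup>2 - 5 / 16 * z ^ 3
      = 7 / 192 + 15 / 16 * (5 / 6 - z)\<^sup>2 + 5 / 16 * (1 - z) ^ 3" by algebra
    also have "0 \<le> \<dots>" using assms by simp
    finally show ?thesis .
  qed
qed

text \<open>The hypothesis is the vanishing of the derivative of the ratio at \<open>x\<close>, multiplied out.\<close>

lemma critical_point_bounds:
  fixes x d e z w :: real
  assumes x: "0 < x" and d: "0 < d" "d \<le> 1" and e: "0 < e"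
    and z_def: "z = e + x * d - x\<^sup>2" and w_def: "w = x\<^sup>2 + x * d - e"
    and z: "0 < z" "z < 1" and w: "0 < w"
    and crit: "(d / 2 - x) * ((1 + w)\<^sup>2 * sqrt (1 + w) - (1 + w))
      = (d / 2 + x) * ((1 - z) - (1 - z)\<^sup>2 * sqrt (1 - z))"
  shows "e \<le> 1 / 200" "e \<le> x\<^sup>2 / 4" "x\<^sup>2 \<le> 353 / 5000" "77 / 100 \<le> d\<^sup>2"
proof -
  define u y \<delta> k g where "u = d / 2" and "y = x\<^sup>2" and "\<delta> = y - e"
    and "k = (\<lambda>w::real. 3 / 2 * w + 15 / 8 * w\<^sup>2 + 5 / 16 * w ^ 3)" 
    and "g = (\<lambda>z::real. 3 / 2 * z - 15 / 8 * z\<^sup>2 + 5 / 16 * z ^ 3)"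
  define B A where "B = (1 + w)\<^sup>2 * sqrt (1 + w) - (1 + w)" and "A = (1 - z) - (1 - z)\<^sup>2 * sqrt (1 - z)"
  have A: "A = (1 - z) * (1 - (1 - z) * sqrt (1 - z))" by (simp add: A_def algebra_simps power2_eq_square)
  have "sqrt (1 - z) \<le> 1" using z by simp
  hence "(1 - z) * sqrt (1 - z) \<le> (1 - z) * 1" using z by (intro mult_left_mono) auto
  hence "z \<le> 1 - (1 - z) * sqrt (1 - z)" by (simp add: algebra_simps)
  hence Az: "(1 - z) * z \<le> A" unfolding A using z by (intro mult_left_mono) auto
  hence A0: "0 < A" using z by (meson less_le_trans mult_pos_pos diff_gt_0_iff_gt)
  have "1 * 1 < (1 + w) * sqrt (1 + w)" using w by (intro mult_strict_mono) auto
  hence "0 < (1 + w) * ((1 + w) * sqrt (1 + w) - 1)" using w by simp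
  hence B0: "0 < B" unfolding B_def by (simp add: algebra_simps power2_eq_square)
  have u: "0 < u" "u \<le> 1 / 2" using d by (auto simp: u_def)
  have eq: "(u - x) * B = (u + x) * A" using crit by (simp add: A_def B_def u_def)
  have "0 < (u + x) * A" using u x A0 by simp
  hence ux: "x < u" using eq B0 by (metis zero_less_mult_pos2 diff_gt_0_iff_gt)
  have Bk: "B \<le> k w" using five_halves_upper[of w] w by (simp add: B_def k_def)
  have Ag: "g z \<le> A" using five_halves_lower[of z] z by (simp add: A_def g_def)
  have zw: "z = 2 * u * x - \<delta>" "w = 2 * u * x + \<delta>"
    by (auto simp: z_def w_def u_def \<delta>_def y_def algebra_simps)
  have ux2: "2 * u * x \<le> x" using mult_right_mono[of "2 * u" 1 x] u x by simp
  have k0: "k a \<le> k b" if "0 \<le> a" "a \<le> b" for a b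
    unfolding k_def using that by (intro add_mono mult_left_mono power_mono) auto
  have main: "(u + x) * g z \<le> (u - x) * k w"
  proof -
    have "(u + x) * g z \<le> (u + x) * A" using Ag u x by (intro mult_left_mono) auto
    also have "\<dots> \<le> (u - x) * k w" using eq[symmetric] Bk ux by (simp add: mult_left_mono)
    finally show ?thesis .
  qed
  \<comment> \<open>The cubic \<open>g\<close> is negative at \<open>z = 1\<close> and useless near
    it, so large \<open>z\<close> are excluded by the cruder bound
    \<open>(1 - z) * z \<le> A\<close>.\<close>
  have z7: "z \<le> 7 / 10"
  proof (rule ccontr)
    assume "\<not> z \<le> 7 / 10"
    hence z7: "z > 7 / 10" by simp
    have w3: "w \<le> 3 / 10" and zx: "z \<le> 2 * x" using zw ux2 ux u z7 w by linarith+
    have "k w \<le> k (3 / 10)" using w w3 by (intro k0) auto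
    also have "\<dots> \<le> 63 / 100" by (simp add: k_def power2_eq_square power3_eq_cube)
    finally have B: "B \<le> 63 / 100" using Bk by simp
    have "z * (z * (1 - z)) \<le> (u + x) * A" 
      using z Az ux zx A0 u x by (intro mult_mono) (auto simp: mult.commute)
    also have "\<dots> = (u - x) * B" using eq by simp
    also have "\<dots> \<le> ((1 - z) / 2) * (63 / 100)" using ux zx u B B0 by (intro mult_mono) auto
    finally have "(1 - z) * (z * z) \<le> (1 - z) * (63 / 200)" by (simp add: algebra_simps)
    hence "z * z \<le> 63 / 200" by (rule mult_left_le_imp_le) (use z in simp)
    moreover have "7 / 10 * (7 / 10) \<le> z * z" using z7 by (intro mult_mono) auto
    ultimately show False by simp
  qed
  \<comment> \<open>At \<open>e = y\<close> both \<open>z\<close> and \<open>w\<close> equal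
    \<open>2 * u * x\<close>; a larger \<open>e\<close> increases \<open>z\<close> and decreases
    \<open>w\<close>. Since \<open>g\<close> is not monotone up to \<open>7 / 10\<close>, values of
    \<open>z\<close> above \<open>1 / 4\<close> are compared with \<open>g (7 / 10)\<close>
    instead.\<close>
  have ey: "e < y"
  proof (rule ccontr)
    assume "\<not> e < y"
    define a where "a = 2 * u * x"
    have a: "0 < a" "a \<le> z" "w \<le> a" "a \<le> x" using \<open>\<not> e < y\<close> zw u x ux2 by (auto simp: a_def \<delta>_def)
    have "(u - x) * k w \<le> (u - x) * k a" using a w ux by (intro mult_left_mono k0) auto
    with main have m: "(u + x) * g z \<le> (u - x) * k a" by linarith
    show False
    proof (cases "z \<le> 1 / 4")
      case True
      have "0 \<le> (z - a) * (3 / 2 - 15 / 8 * (z + a) + 5 / 16 * (z\<^sup>2 + z * a + a\<^sup>2))"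
        using a True by (intro mult_nonneg_nonneg add_nonneg_nonneg) auto
      also have "\<dots> = g z - g a" unfolding g_def by algebra
      finally have "(u + x) * g a \<le> (u + x) * g z" using u x by (intro mult_left_mono) auto
      with m have "(u + x) * g a \<le> (u - x) * k a" by linarith
      moreover have "(u + x) * g a - (u - x) * k a = a * x * (3 - 15 / 2 * u\<^sup>2 + 5 / 8 * a\<^sup>2)"
        unfolding g_def k_def a_def by algebra
      moreover have "u\<^sup>2 \<le> (1 / 2)\<^sup>2" using u by (intro power_mono) auto
      hence "u\<^sup>2 \<le> 1 / 4" by (simp add: power_divide)
      hence "0 < 3 - 15 / 2 * u\<^sup>2 + 5 / 8 * a\<^sup>2" using zero_le_power2[of a] by linarith
      hence "0 < a * x * (3 - 15 / 2 * u\<^sup>2 + 5 / 8 * a\<^sup>2)" using a x by simp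
      ultimately show False by linarith
    next
      case False
      have "z\<^sup>2 \<le> 7 / 10 * z" using z7 z by (simp add: power2_eq_square)
      hence "0 \<le> 15 / 8 * (z + 7 / 10) - 3 / 2 - 5 / 16 * (z\<^sup>2 + z * (7 / 10) + 49 / 100)"
        using False by (simp add: field_simps)
      hence "0 \<le> (7 / 10 - z) * (15 / 8 * (z + 7 / 10) - 3 / 2 - 5 / 16 * (z\<^sup>2 + z * (7 / 10) + 49 / 100))"
        using z7 by (intro mult_nonneg_nonneg) auto
      also have "\<dots> = g z - g (7 / 10)" unfolding g_def by algebra
      finally have "23 / 100 \<le> g z" by (simp add: g_def power2_eq_square power3_eq_cube)
      hence "(u + x) * (23 / 100) \<le> (u + x) * g z" using u x by (intro mult_left_mono) auto
      also have "\<dots> \<le> (u - x) * k x" using m mult_left_mono[OF k0[of a x], of "u - x"] a(1,4) ux by linarith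
      also have "\<dots> = ((u - x) * x) * (3 / 2 + 15 / 8 * x + 5 / 16 * x\<^sup>2)"
        unfolding k_def by algebra
      also have "\<dots> \<le> (u / 8) * (3 / 2 + 15 / 8 * x + 5 / 32 * x)"
      proof (intro mult_mono)
        have "0 \<le> (u / 2 - x)\<^sup>2" by simp
        hence "(u - x) * x \<le> u * u / 4" by (simp add: power2_eq_square algebra_simps)
        also have "\<dots> \<le> u / 8" using mult_left_mono[of u "1 / 2" u] u by simp
        finally show "(u - x) * x \<le> u / 8" .
        have "x * x \<le> 1 / 2 * x" using ux u x by (intro mult_right_mono) auto
        thus "3 / 2 + 15 / 8 * x + 5 / 16 * x\<^sup>2 \<le> 3 / 2 + 15 / 8 * x + 5 / 32 * x"
          by (simp add: power2_eq_square)
      qed (use u x in auto)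
      finally have "(u + x) * (23 / 100) \<le> u * (3 / 16) + (u * x) * (65 / 256)" by (simp add: algebra_simps)
      moreover have "u * x \<le> x / 2" using ux2 by simp
      ultimately show False using u x by simp
    qed
  qed
  \<comment> \<open>The common factor \<open>2 * u = d\<close> splits off, which leaves one
    polynomial inequality in \<open>d^2\<close>, \<open>y = x^2\<close> and \<open>e\<close>. With
    \<open>d^2 \<le> 1\<close> it gives the first three claims, with \<open>d^2\<close> retained the
    last one.\<close>
  have "(u - x) * k w - (u + x) * g z = 2 * u * (d\<^sup>2 * y * (15 / 8 + 5 / 16 * (3 * \<delta> - 2 * y)) - 3 / 2 * (y + e)
     + 15 / 8 * (\<delta>\<^sup>2 - 4 * y * \<delta>) + 5 / 16 * (\<delta> ^ 3 - 6 * y * \<delta>\<^sup>2))"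
    unfolding k_def g_def zw u_def y_def \<delta>_def by algebra
  hence "0 \<le> 2 * u * (d\<^sup>2 * y * (15 / 8 + 5 / 16 * (3 * \<delta> - 2 * y)) - 3 / 2 * (y + e)
     + 15 / 8 * (\<delta>\<^sup>2 - 4 * y * \<delta>) + 5 / 16 * (\<delta> ^ 3 - 6 * y * \<delta>\<^sup>2))" using main by linarith
  hence P: "0 \<le> d\<^sup>2 * y * (15 / 8 + 5 / 16 * (3 * \<delta> - 2 * y)) - 3 / 2 * (y + e)
     + 15 / 8 * (\<delta>\<^sup>2 - 4 * y * \<delta>) + 5 / 16 * (\<delta> ^ 3 - 6 * y * \<delta>\<^sup>2)"
    using u by (simp add: zero_le_mult_iff)
  have y: "0 < y" "y \<le> 1 / 4"
    using x ux u power_mono[of x "1 / 2" 2] by (auto simp: y_def power2_eq_square)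
  have \<delta>: "0 < \<delta>" "\<delta> < y" using ey e by (auto simp: \<delta>_def)
  have "0 \<le> 15 / 8 + 5 / 16 * (3 * \<delta> - 2 * y)"
  proof -
    have "15 / 8 + 5 / 16 * (3 * \<delta> - 2 * y) = (30 + 15 * \<delta> - 10 * y) / 16" by (simp add: field_simps)
    moreover have "0 \<le> 30 + 15 * \<delta> - 10 * y" using y \<delta> by linarith
    ultimately show ?thesis by (simp only: zero_le_divide_iff) simp
  qed
  hence c0: "0 \<le> y * (15 / 8 + 5 / 16 * (3 * \<delta> - 2 * y))" using y by simp
  have "d\<^sup>2 \<le> 1" using d by (simp add: power_le_one)
  hence "d\<^sup>2 * (y * (15 / 8 + 5 / 16 * (3 * \<delta> - 2 * y))) \<le> y * (15 / 8 + 5 / 16 * (3 * \<delta> - 2 * y))"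
    using c0 by (intro mult_left_le_one_le) auto
  with P have "0 \<le> y * (15 / 8 + 5 / 16 * (3 * \<delta> - 2 * y)) - 3 / 2 * (y + e)
     + 15 / 8 * (\<delta>\<^sup>2 - 4 * y * \<delta>) + 5 / 16 * (\<delta> ^ 3 - 6 * y * \<delta>\<^sup>2)" by (simp add: mult.assoc)
  also have "\<dots> = 3 / 8 * y - 3 / 2 * e - 85 / 16 * y\<^sup>2 + 45 / 16 * (y * e) + 15 / 8 * e\<^sup>2 - 5 / 16 * \<delta>\<^sup>2 * (5 * y + e)"
    unfolding \<delta>_def by algebra
  finally have "5 / 16 * \<delta>\<^sup>2 * (5 * y + e) \<le> 3 / 8 * y - 3 / 2 * e - 85 / 16 * y\<^sup>2 + 45 / 16 * (y * e) + 15 / 8 * e\<^sup>2"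
    by (simp only: diff_ge_0_iff_ge)
  moreover have "0 \<le> 5 / 16 * \<delta>\<^sup>2 * (5 * y + e)" using y e by simp
  ultimately have "0 \<le> 3 / 8 * y - 3 / 2 * e - 85 / 16 * y\<^sup>2 + 45 / 16 * (y * e) + 15 / 8 * e\<^sup>2" 
    by (rule order_trans[rotated])
  also have "\<dots> = (6 * y - 24 * e - 85 * y\<^sup>2 + 45 * (y * e) + 30 * e\<^sup>2) / 16" by (simp add: field_simps)
  finally have "0 \<le> 6 * y - 24 * e - 85 * y\<^sup>2 + 45 * (y * e) + 30 * e\<^sup>2" by (simp only: zero_le_divide_iff) simp
  moreover have "e\<^sup>2 \<le> y * e" using ey e by (simp add: power2_eq_square)
  ultimately have "0 \<le> 6 * y - 85 * y\<^sup>2 - (24 * e - 75 * (y * e))" by linarith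
  hence K: "0 \<le> 6 * y - 85 * y\<^sup>2 - e * (24 - 75 * y)" by (simp add: algebra_simps)
  have y75: "0 < 24 - 75 * y" using y by linarith
  show "e \<le> 1 / 200"
  proof (rule ccontr)
    assume "\<not> e \<le> 1 / 200"
    hence "1 / 200 * (24 - 75 * y) \<le> e * (24 - 75 * y)" using y75 by (intro mult_right_mono) auto
    hence "24 - 75 * y \<le> 200 * (e * (24 - 75 * y))" by simp
    with K have "0 \<le> 1275 * y - 17000 * y\<^sup>2 - 24" by linarith
    \<comment> \<open>Completing the square leaves the constant \<open>765 / 32\<close>, barely less
      than 24; this margin is what permits \<open>1 / 200\<close>.\<close>
    moreover have "17000 * (y - 3 / 80)\<^sup>2 = 17000 * y\<^sup>2 - 1275 * y + 765 / 32"
      by (simp add: power2_eq_square field_simps)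
    moreover have "0 \<le> 17000 * (y - 3 / 80)\<^sup>2" by simp
    ultimately show False by linarith
  qed
  have "4 * (e * (24 - 75 * y)) \<le> y * (24 - 75 * y)" 
  proof -
    have "y * (24 - 75 * y) = 24 * y - 75 * y\<^sup>2" by algebra
    thus ?thesis using K zero_le_power2[of y] by linarith
  qed
  hence "(4 * e) * (24 - 75 * y) \<le> y * (24 - 75 * y)" by (simp only: mult.assoc)
  hence "4 * e \<le> y" using y75 by (subst (asm) mult_le_cancel_right_pos)
  thus "e \<le> x\<^sup>2 / 4" by (simp add: y_def)
  have "0 \<le> e * (24 - 75 * y)" using e y75 by simp
  with K have "0 \<le> 6 * y - 85 * y\<^sup>2" by linarith
  also have "\<dots> = y * (6 - 85 * y)" by algebra
  finally have "0 \<le> y * (6 - 85 * y)" .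
  hence y2: "y \<le> 353 / 5000" using y by (simp add: zero_le_mult_iff)
  thus "x\<^sup>2 \<le> 353 / 5000" by (simp add: y_def)
  show "77 / 100 \<le> d\<^sup>2"
  proof (rule ccontr)
    assume "\<not> 77 / 100 \<le> d\<^sup>2"
    \<comment> \<open>With this factor bounded by \<open>19 / 10\<close>, the only positive term is
      at most \<open>77 / 100 * (19 / 10) * y\<close>, which is less than
      \<open>3 / 2 * y\<close>.\<close>
    have "15 / 8 + 5 / 16 * (3 * \<delta> - 2 * y) \<le> 19 / 10"
    proof -
      have "15 / 8 + 5 / 16 * (3 * \<delta> - 2 * y) = (30 + 15 * \<delta> - 10 * y) / 16" by (simp add: field_simps)
      moreover have "30 + 15 * \<delta> - 10 * y \<le> 304 / 10" using \<delta> y2 by linarith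
      hence "(30 + 15 * \<delta> - 10 * y) / 16 \<le> 19 / 10" by (subst pos_divide_le_eq) simp_all
      ultimately show ?thesis by (simp only:)
    qed
    define c where "c = y * (15 / 8 + 5 / 16 * (3 * \<delta> - 2 * y))"
    have c: "c \<le> y * (19 / 10)" unfolding c_def using \<open>_ \<le> 19 / 10\<close> y
      by (intro mult_left_mono) (simp_all only: less_imp_le)
    have c0': "0 \<le> c" using c0 unfolding c_def .
    have "d\<^sup>2 * c \<le> 77 / 100 * (y * (19 / 10))"
      using \<open>\<not> 77 / 100 \<le> d\<^sup>2\<close> c c0' y by (intro mult_mono) auto
    also have "\<dots> = 1463 / 1000 * y" by simp
    finally have "d\<^sup>2 * c < 3 / 2 * (y + e)" unfolding distrib_left using y e by linarith
    moreover have "d\<^sup>2 * y * (15 / 8 + 5 / 16 * (3 * \<delta> - 2 * y)) = d\<^sup>2 * c" by (simp only: c_def mult.assoc)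
    ultimately have 1: "d\<^sup>2 * y * (15 / 8 + 5 / 16 * (3 * \<delta> - 2 * y)) < 3 / 2 * (y + e)" by (simp only:)
    have "\<delta>\<^sup>2 \<le> 4 * y * \<delta>" using \<delta> by (simp add: power2_eq_square)
    hence 2: "15 / 8 * (\<delta>\<^sup>2 - 4 * y * \<delta>) \<le> 0" by (intro mult_nonneg_nonpos) auto
    have "\<delta>\<^sup>2 * \<delta> \<le> \<delta>\<^sup>2 * (6 * y)" using \<delta> by (intro mult_left_mono) auto
    hence "\<delta> ^ 3 \<le> 6 * y * \<delta>\<^sup>2" by (simp add: power2_eq_square power3_eq_cube mult_ac)
    hence 3: "5 / 16 * (\<delta> ^ 3 - 6 * y * \<delta>\<^sup>2) \<le> 0" by (intro mult_nonneg_nonpos) auto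
    have "\<not> 0 \<le> a - b + c + c'" if "a < b" "c \<le> 0" "c' \<le> 0" for a b c c' :: real
      using that by linarith
    from this[OF 1 2 3] P show False by contradiction
  qed
qed


lemma phi_has_derivative:
  assumes "0 < t"
  shows "(phi has_real_derivative - (3 / 2) * (phi t / t)) (at t)"
proof -
  have "((\<lambda>t. 1 / sqrt t ^ 3) has_real_derivative - (3 * sqrt t ^ 2 * (inverse (sqrt t) / 2)) / (sqrt t ^ 3)\<^sup>2) (at t)"
    using assms by (auto intro!: derivative_eq_intros simp: power2_eq_square)
  also have "- (3 * sqrt t ^ 2 * (inverse (sqrt t) / 2)) / (sqrt t ^ 3)\<^sup>2 = - (3 / 2) * (phi t / t)"
  proof -
    define s where "s = sqrt t"
    have s: "s > 0" "t = s\<^sup>2" "sqrt t = s" using assms by (auto simp: s_def)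
    show ?thesis unfolding phi_def s(3) unfolding s(2) using s(1) 
      by (simp add: field_simps power2_eq_square power3_eq_cube)
  qed
  finally show ?thesis by (simp add: phi_def[abs_def])
qed

text \<open>Rolle's theorem for the ratio between two points with equal values. Clearing the powers
  of \<open>A t\<close> and \<open>B t\<close> from the numerator of the derivative leaves only
  five-halves powers. The bound on \<open>e\<close> says that the height is positive, which keeps
  \<open>A\<close> positive everywhere.\<close>

lemma ratio_critical_point:
  fixes d e x y :: real
  assumes d: "0 < d" and e: "e < 1 - d\<^sup>2 / 4" and xy: "0 < x" "x < y"
    and zx: "0 < e + x * d - x\<^sup>2" and wx: "0 < x\<^sup>2 + x * d - e"
    and zy: "0 < e + y * d - y\<^sup>2"
    and eq: "(phi (1 - (e + x * d - x\<^sup>2)) - 1) / (1 - phi (1 + (x\<^sup>2 + x * d - e)))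
      = (phi (1 - (e + y * d - y\<^sup>2)) - 1) / (1 - phi (1 + (y\<^sup>2 + y * d - e)))"
  obtains t where "x < t" "t < y" 
    "0 < e + t * d - t\<^sup>2" "e + t * d - t\<^sup>2 < 1" "0 < t\<^sup>2 + t * d - e"
    "(d / 2 - t) * ((1 + (t\<^sup>2 + t * d - e))\<^sup>2 * sqrt (1 + (t\<^sup>2 + t * d - e)) - (1 + (t\<^sup>2 + t * d - e)))
      = (d / 2 + t) * ((1 - (e + t * d - t\<^sup>2)) - (1 - (e + t * d - t\<^sup>2))\<^sup>2 * sqrt (1 - (e + t * d - t\<^sup>2)))"
proof -
  define A B where "A = (\<lambda>t. 1 - (e + t * d - t\<^sup>2))" and "B = (\<lambda>t. 1 + (t\<^sup>2 + t * d - e))"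
  define R where "R = (\<lambda>t. (phi (A t) - 1) / (1 - phi (B t)))"
  have A: "0 < A t" for t
  proof -
    have "A t = (1 - d\<^sup>2 / 4 - e) + (t - d / 2)\<^sup>2" by (simp add: A_def power2_eq_square field_simps)
    thus ?thesis using e zero_le_power2[of "t - d / 2"] by linarith
  qed
  have B: "1 < B t" if "x \<le> t" for t
  proof -
    have "x\<^sup>2 \<le> t\<^sup>2" "x * d \<le> t * d" using that xy d by (auto intro: power_mono)
    thus ?thesis using wx by (simp add: B_def)
  qed
  have phiB: "phi (B t) < 1" if "x \<le> t" for t
    using phi_strict_antimono[of 1 "B t"] B[OF that] by simp
  have dR: "(R has_real_derivative 
      ((- (3 / 2) * (phi (A t) / A t) * (2 * t - d)) * (1 - phi (B t)) 
       - (phi (A t) - 1) * (3 / 2 * (phi (B t) / B t) * (2 * t + d))) / (1 - phi (B t))\<^sup>2) (at t)"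
    if "x \<le> t" for t
  proof -
    have "(A has_real_derivative (2 * t - d)) (at t)" "(B has_real_derivative (2 * t + d)) (at t)"
      unfolding A_def B_def by (auto intro!: derivative_eq_intros)
    moreover have "0 < B t" using B[OF that] by simp
    ultimately have 1: "((\<lambda>t. phi (A t)) has_real_derivative - (3 / 2) * (phi (A t) / A t) * (2 * t - d)) (at t)"
      "((\<lambda>t. phi (B t)) has_real_derivative - (3 / 2) * (phi (B t) / B t) * (2 * t + d)) (at t)"
      using DERIV_chain2[where f = phi and g = A, OF phi_has_derivative[OF A]]
        DERIV_chain2[where f = phi and g = B, OF phi_has_derivative[of "B t"]] by blast+
    show ?thesis unfolding R_def
      by (rule derivative_eq_intros 1 refl)+ (use phiB[OF that] in \<open>auto simp: power2_eq_square\<close>)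
  qed
  have "\<exists>t>x. t < y \<and> (R has_real_derivative 0) (at t)"
  proof (rule Rolle)
    show "x < y" by fact
    show "R x = R y" using eq by (simp add: R_def A_def B_def)
    show "continuous_on {x..y} R"
      by (intro continuous_at_imp_continuous_on ballI DERIV_isCont[OF dR]) auto
    show "R differentiable (at t)" if "x < t" "t < y" for t
      using dR[of t] that by (meson less_imp_le real_differentiable_def)
  qed
  then obtain t where t: "x < t" "t < y" "(R has_real_derivative 0) (at t)" by blast
  have "((- (3 / 2) * (phi (A t) / A t) * (2 * t - d)) * (1 - phi (B t)) 
       - (phi (A t) - 1) * (3 / 2 * (phi (B t) / B t) * (2 * t + d))) / (1 - phi (B t))\<^sup>2 = 0"
    using DERIV_unique[OF dR t(3)] t(1) by simp
  hence N: "(- (3 / 2) * (phi (A t) / A t) * (2 * t - d)) * (1 - phi (B t)) 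
       - (phi (A t) - 1) * (3 / 2 * (phi (B t) / B t) * (2 * t + d)) = 0" using phiB[of t] t(1) by simp
  have c: "(phi (A t) / A t * (d - 2 * t)) * (1 - phi (B t)) 
       = (phi (A t) - 1) * (phi (B t) / B t * (2 * t + d))"
  proof -
    define P Q where "P = phi (A t) / A t" and "Q = phi (B t) / B t"
    from N show ?thesis unfolding P_def[symmetric] Q_def[symmetric] by algebra
  qed
  define a b where "a = sqrt (A t)" and "b = sqrt (B t)"
  have ab: "0 < a" "0 < b" "A t = a\<^sup>2" "B t = b\<^sup>2" "sqrt (A t) = a" "sqrt (B t) = b" 
    using A[of t] B[of t] t by (auto simp: a_def b_def)
  have "((d - 2 * t) * (b ^ 3 - 1)) / (a ^ 5 * b ^ 3) = ((1 - a ^ 3) * (2 * t + d)) / (a ^ 3 * b ^ 5)"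
    using c ab(1,2) unfolding phi_def ab(5,6) unfolding ab(3,4) by (simp add: field_simps eval_nat_numeral)
  hence "(d - 2 * t) * (b ^ 3 - 1) * (a ^ 3 * b ^ 5) = (1 - a ^ 3) * (2 * t + d) * (a ^ 5 * b ^ 3)"
    using ab(1,2) by (simp add: frac_eq_eq)
  hence "(a ^ 3 * b ^ 3) * ((d - 2 * t) * (b ^ 5 - b\<^sup>2)) = (a ^ 3 * b ^ 3) * ((2 * t + d) * (a\<^sup>2 - a ^ 5))"
    by algebra
  hence "(d - 2 * t) * (b ^ 5 - b\<^sup>2) = (2 * t + d) * (a\<^sup>2 - a ^ 5)" using ab by simp
  hence "(d / 2 - t) * ((B t)\<^sup>2 * sqrt (B t) - B t) = (d / 2 + t) * (A t - (A t)\<^sup>2 * sqrt (A t))"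
    unfolding ab(5,6) unfolding ab(3,4) by algebra
  \<comment> \<open>This expression is concave in \<open>t\<close>, hence positive between two
    points where it is positive.\<close>
  moreover have "0 < e + t * d - t\<^sup>2"
  proof -
    define u where "u = (t - x) / (y - x)"
    have u: "0 < u" "u < 1" "t = x + u * (y - x)" using t by (auto simp: u_def)
    have "e + t * d - t\<^sup>2 = (1 - u) * (e + x * d - x\<^sup>2) + u * (e + y * d - y\<^sup>2) + u * (1 - u) * (y - x)\<^sup>2"
      unfolding u(3) by algebra
    thus ?thesis using u zx zy by (simp add: add_pos_nonneg)
  qed
  ultimately show ?thesis using that[OF t(1,2)] A[of t] B[of t] t by (simp add: A_def B_def)
qed


text \<open>If \<open>e = 1 - d\<^sup>2 / 4 - h\<^sup>2\<close>, the squared distances from \<open>(x, 0)\<close> to \<open>(d / 2, h)\<close> and \<open>(- d / 2, h)\<close> are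
  \<open>1 - (e + x * d - x\<^sup>2)\<close> and \<open>1 + (x\<^sup>2 + x * d - e)\<close>.\<close>

definition gain :: "real \<Rightarrow> real \<Rightarrow> real \<Rightarrow> real" where
  "gain d e x = phi (1 - (e + x * d - x\<^sup>2)) - 1"

definition loss :: "real \<Rightarrow> real \<Rightarrow> real \<Rightarrow> real" where
  "loss d e x = 1 - phi (1 + (x\<^sup>2 + x * d - e))"

lemma loss_pos: "0 < x\<^sup>2 + x * d - e \<Longrightarrow> 0 < loss d e x"
  using phi_strict_antimono[of 1 "1 + (x\<^sup>2 + x * d - e)"] by (simp add: loss_def)

lemma gain_le_loss_mono:
  assumes "0 \<le> d" "d \<le> D" "0 < D" "0 \<le> L" "e \<le> e'" "e' \<le> x\<^sup>2" "e' + x * D - x\<^sup>2 < 1" "0 \<le> x"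
    "gain D e' x \<le> L * loss D e' x"
  shows "gain d e x \<le> L * loss d e x"
  using ratio_le_mono[of d D L e e' x] assms by (simp add: gain_def loss_def)

lemma x_minus_square_le: "x - x\<^sup>2 \<le> (1 / 4 :: real)"
proof -
  have "0 \<le> (x - 1 / 2)\<^sup>2" by simp
  thus ?thesis by (simp add: power2_eq_square algebra_simps)
qed

section \<open>Ratio bounds for every top side of length at most 1\<close>

context
  fixes d e x :: real
  assumes d: "0 \<le> d" "d \<le> 1"
begin

lemma gain_le_const:
  assumes "e \<le> 1 / 200" "17 / 100 \<le> x" "x \<le> 77 / 200"
  shows "gain d e x \<le> 23 / 20 * loss d e x"
proof (rule gain_le_loss_mono[of d 1 _ e "1 / 200"])
  have "(17 / 100)\<^sup>2 \<le> x\<^sup>2" using assms by (intro power_mono) auto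
  thus "1 / 200 \<le> x\<^sup>2" by (simp add: power2_eq_square)
  show "gain 1 (1 / 200) x \<le> 23 / 20 * loss 1 (1 / 200) x"
    using ratio_le_const_wide[of x] assms by (simp add: gain_def loss_def algebra_simps)
qed (use d assms x_minus_square_le[of x] in auto)

lemma gain_le_linear:
  assumes "e \<le> 1 / 200" "19 / 50 \<le> x" and z: "0 < e + x * d - x\<^sup>2"
  shows "gain d e x \<le> (33 / 20 - 13 / 10 * x) * loss d e x" "x < 503 / 500"
proof -
  have "x * d \<le> x * 1" using d assms by (intro mult_left_mono) auto
  hence z1: "0 < 1 / 200 + x - x\<^sup>2" using z assms by linarith
  show x: "x < 503 / 500"
  proof (rule ccontr)
    assume "\<not> x < 503 / 500"
    hence "503 / 500 * (3 / 500) \<le> x * (x - 1)" by (intro mult_mono) auto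
    thus False using z1 by (simp add: power2_eq_square algebra_simps)
  qed
  show "gain d e x \<le> (33 / 20 - 13 / 10 * x) * loss d e x"
  proof (rule gain_le_loss_mono[of d 1 _ e "1 / 200"])
    have "(17 / 100)\<^sup>2 \<le> x\<^sup>2" using assms by (intro power_mono) auto
    thus "1 / 200 \<le> x\<^sup>2" by (simp add: power2_eq_square)
    show "gain 1 (1 / 200) x \<le> (33 / 20 - 13 / 10 * x) * loss 1 (1 / 200) x"
      using ratio_le_linear_wide[of x] assms x z1 by (simp add: gain_def loss_def algebra_simps)
  qed (use d assms x x_minus_square_le[of x] in auto)
qed

lemma gain_le_linear_narrow:
  assumes "d \<le> 193 / 200" "e \<le> 1 / 200" "7 / 25 \<le> x" "x \<le> 97 / 100"
  shows "gain d e x \<le> (731 / 500 - 11 / 10 * x) * loss d e x"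
proof (rule gain_le_loss_mono[of d "193 / 200" _ e "1 / 200"])
  have "(17 / 100)\<^sup>2 \<le> x\<^sup>2" using assms by (intro power_mono) auto
  thus "1 / 200 \<le> x\<^sup>2" by (simp add: power2_eq_square)
  show "gain (193 / 200) (1 / 200) x \<le> (731 / 500 - 11 / 10 * x) * loss (193 / 200) (1 / 200) x"
    using ratio_le_linear_narrow[of x] assms by (simp add: gain_def loss_def algebra_simps)
qed (use d assms x_minus_square_le[of x] in auto)

lemma gain_le_const_small:
  assumes "e \<le> x\<^sup>2 / 4" "0 \<le> x" "x \<le> 171 / 1000"
  shows "gain d e x \<le> 32 / 25 * loss d e x"
proof (rule gain_le_loss_mono[of d 1 _ e "x\<^sup>2 / 4"])
  have "x\<^sup>2 / 4 + x * 1 - x\<^sup>2 = x - 3 / 4 * x\<^sup>2" "x\<^sup>2 + x * 1 - x\<^sup>2 / 4 = x + 3 / 4 * x\<^sup>2" by simp_all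
  thus "gain 1 (x\<^sup>2 / 4) x \<le> 32 / 25 * loss 1 (x\<^sup>2 / 4) x"
    using ratio_le_const_small[of x] assms by (simp only: gain_def loss_def)
  show "x\<^sup>2 / 4 + x * 1 - x\<^sup>2 < 1" using x_minus_square_le[of x] zero_le_power2[of x] assms by linarith
qed (use d assms in auto)

text \<open>The opposite direction: it shows that a positive defect forces
  \<open>k > 39 / 50\<close>. A defect only raises the gain and lowers the loss, so \<open>z\<close>
  and \<open>w\<close> are taken at \<open>e = 0\<close> and truncated Taylor series
  suffice.\<close>

lemma gain_ge:
  assumes "0 < x" "x\<^sup>2 \<le> 353 / 5000" "77 / 100 \<le> d\<^sup>2" "0 \<le> e"
    and z: "e + x * d - x\<^sup>2 < 1" and w: "0 < x\<^sup>2 + x * d - e"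
  shows "39 / 50 * loss d e x < gain d e x"
proof -
  define z w where "z = x * (d - x)" and "w = x * (d + x)"
  have x: "x \<le> 133 / 500" using assms by (intro power2_le_imp_le[of x "133 / 500"]) (auto simp: power2_eq_square)
  have d': "877 / 1000 \<le> d" using assms d by (intro power2_le_imp_le[of "877 / 1000" d]) (auto simp: power2_eq_square)
  have z: "0 \<le> z" "z \<le> 1 / 4" and w: "0 \<le> w" "w \<le> 2 / 5"
  proof -
    show "0 \<le> z" "0 \<le> w" using x d' assms by (auto simp: z_def w_def)
    have "z \<le> x * (1 - x)" unfolding z_def using d assms by (intro mult_left_mono) auto
    thus "z \<le> 1 / 4" using x_minus_square_le[of x] by (simp add: algebra_simps power2_eq_square)
    have "w \<le> 133 / 500 * (1 + 133 / 500)" unfolding w_def using x d d' assms by (intro mult_mono) auto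
    thus "w \<le> 2 / 5" by simp
  qed
  have "1 + 3 / 2 * z + 15 / 8 * z\<^sup>2 \<le> phi (1 - z)"
  proof (rule phi_ge)
    have "1 - (1 + 3 / 2 * z + 15 / 8 * z\<^sup>2)\<^sup>2 * (1 - z) ^ 3
      = z ^ 3 * ((35 / 8 - 105 / 64 * z - 21 / 64 * z\<^sup>2 - 315 / 64 * z ^ 3) + 225 / 64 * z ^ 4)" by algebra
    moreover have "z\<^sup>2 \<le> z" "z ^ 3 \<le> z" 
      using z power_decreasing[of 1 2 z] power_decreasing[of 1 3 z] by auto
    hence "0 \<le> z ^ 3 * ((35 / 8 - 105 / 64 * z - 21 / 64 * z\<^sup>2 - 315 / 64 * z ^ 3) + 225 / 64 * z ^ 4)"
      using z by (intro mult_nonneg_nonneg add_nonneg_nonneg) auto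
    ultimately show "(1 + 3 / 2 * z + 15 / 8 * z\<^sup>2)\<^sup>2 * (1 - z) ^ 3 \<le> 1" by linarith
  qed (use z in auto)
  also have "phi (1 - z) \<le> phi (1 - (e + x * d - x\<^sup>2))"
    using assms by (intro phi_antimono) (auto simp: z_def algebra_simps power2_eq_square)
  finally have g: "3 / 2 * z + 15 / 8 * z\<^sup>2 \<le> gain d e x" by (simp add: gain_def)
  have "1 - 3 / 2 * w + 15 / 8 * w\<^sup>2 - 35 / 16 * w ^ 3 \<le> phi (1 + w)"
  proof (rule phi_ge)
    have "1 - (1 - 3 / 2 * w + 15 / 8 * w\<^sup>2 - 35 / 16 * w ^ 3)\<^sup>2 * (1 + w) ^ 3
      = w ^ 4 * ((315 / 64 - 105 / 256 * w\<^sup>2 - 1575 / 256 * w ^ 4 - 1225 / 256 * w ^ 5) + (63 / 32 * w + 45 / 256 * w ^ 3))" by algebra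
    moreover have "w\<^sup>2 \<le> w" "w ^ 4 \<le> w" "w ^ 5 \<le> w"
      using w power_decreasing[of 1 2 w] power_decreasing[of 1 4 w] power_decreasing[of 1 5 w] by auto
    hence "0 \<le> w ^ 4 * ((315 / 64 - 105 / 256 * w\<^sup>2 - 1575 / 256 * w ^ 4 - 1225 / 256 * w ^ 5) + (63 / 32 * w + 45 / 256 * w ^ 3))"
      using w by (intro mult_nonneg_nonneg add_nonneg_nonneg) auto
    ultimately show "(1 - 3 / 2 * w + 15 / 8 * w\<^sup>2 - 35 / 16 * w ^ 3)\<^sup>2 * (1 + w) ^ 3 \<le> 1" by linarith
  qed (use w in auto)
  also have "phi (1 + w) \<le> phi (1 + (x\<^sup>2 + x * d - e))"
    using assms w by (intro phi_antimono) (auto simp: w_def algebra_simps power2_eq_square)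
  finally have l: "loss d e x \<le> 3 / 2 * w - 15 / 8 * w\<^sup>2 + 35 / 16 * w ^ 3" by (simp add: loss_def)
  have "w\<^sup>2 * w \<le> w\<^sup>2 * (2 / 5)" using w by (intro mult_left_mono) auto
  hence "w ^ 3 \<le> 2 / 5 * w\<^sup>2" by (simp add: power2_eq_square power3_eq_cube)
  hence l2: "39 / 50 * loss d e x \<le> 39 / 50 * (3 / 2 * w - w\<^sup>2)" using l by simp
  have "0 < x * (33 / 100 * d - 267 / 100 * x + x * (169 / 100))"
    using assms x d' by (intro mult_pos_pos) auto
  \<comment> \<open>As a quadratic in \<open>x\<close> the bracket is least at
    \<open>x = 73 / 177 * d\<close>; there \<open>d^2 \<ge> 77 / 100\<close> gives
    \<open>169 / 100\<close>.\<close>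
  also have "\<dots> \<le> x * (33 / 100 * d - 267 / 100 * x + x * (15 / 8 * (d - x)\<^sup>2 + 39 / 50 * (d + x)\<^sup>2))"
  proof -
    have "15 / 8 * (d - x)\<^sup>2 + 39 / 50 * (d + x)\<^sup>2 = 531 / 200 * d\<^sup>2 + 531 / 200 * x\<^sup>2 - 219 / 100 * (d * x)"
      by algebra
    moreover have "531 / 200 * (x - 73 / 177 * d)\<^sup>2 = 531 / 200 * x\<^sup>2 - 219 / 100 * (d * x) + 5329 / 11800 * d\<^sup>2"
      by algebra
    moreover have "0 \<le> 531 / 200 * (x - 73 / 177 * d)\<^sup>2" by simp
    ultimately have "169 / 100 \<le> 15 / 8 * (d - x)\<^sup>2 + 39 / 50 * (d + x)\<^sup>2" using assms(3) by linarith
    thus ?thesis using assms by (intro mult_left_mono add_left_mono) auto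
  qed
  also have "\<dots> = (3 / 2 * z + 15 / 8 * z\<^sup>2) - 39 / 50 * (3 / 2 * w - w\<^sup>2)"
    unfolding z_def w_def by algebra
  finally show ?thesis using g l2 by linarith
qed

end


text \<open>The points at \<open>q\<close> and \<open>x\<close> lie on the same side of the axis of the trapezoid, the point at \<open>- p\<close>
  on the other side, which inverts the ratio.\<close>

locale balanced_ratios =
  fixes d e p q x k :: real
  assumes d: "0 < d" "d < 1" and e: "e < 1 - d\<^sup>2 / 4"
    and pos: "0 < p" "0 < q" "0 < k"
    and zp: "0 < e + p * d - p\<^sup>2" and wp: "0 < p\<^sup>2 + p * d - e"
    and zq: "0 < e + q * d - q\<^sup>2" and wq: "0 < q\<^sup>2 + q * d - e"
    and Rq: "gain d e q = k * loss d e q" and Rp: "k * gain d e p = loss d e p"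
    and middle: "e = 0 \<or> 0 < x \<and> x < q \<and> 0 < e + x * d - x\<^sup>2 \<and> 0 < x\<^sup>2 + x * d - e
      \<and> gain d e x = k * loss d e x"
begin

lemma k_le: "gain d e q \<le> c * loss d e q \<Longrightarrow> k \<le> c"
  using Rq loss_pos[OF wq] by simp

lemma inverse_k_le: "gain d e p \<le> c * loss d e p \<Longrightarrow> 1 \<le> c * k"
proof -
  assume "gain d e p \<le> c * loss d e p"
  hence "k * gain d e p \<le> k * (c * loss d e p)" using pos by (intro mult_left_mono) auto
  hence "1 * loss d e p \<le> (c * k) * loss d e p" using Rp by (simp add: mult_ac)
  thus "1 \<le> c * k" using loss_pos[OF wp] by (subst (asm) mult_le_cancel_right_pos)
qed

text \<open>The ratio agrees at \<open>x\<close> and \<open>q\<close>, so it has a critical point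
  \<open>t\<close> in between. From \<open>t < q\<close> comes \<open>e \<le> q^2 / 4\<close>; from
  \<open>x < t\<close> it follows that \<open>x\<close> is small enough for
  \<open>gain_ge\<close>.\<close>

lemma defect_pos_bounds:
  assumes "0 < e"
  shows "e \<le> 1 / 200" "e \<le> q\<^sup>2 / 4" "39 / 50 < k"
proof -
  have m: "0 < x" "x < q" "0 < e + x * d - x\<^sup>2" "0 < x\<^sup>2 + x * d - e" "gain d e x = k * loss d e x"
    using middle assms by auto
  have "gain d e x / loss d e x = gain d e q / loss d e q"
    using m(5) Rq loss_pos[OF m(4)] loss_pos[OF wq] by simp
  then obtain t where t: "x < t" "t < q" 
    "0 < e + t * d - t\<^sup>2" "e + t * d - t\<^sup>2 < 1" "0 < t\<^sup>2 + t * d - e"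
    "(d / 2 - t) * ((1 + (t\<^sup>2 + t * d - e))\<^sup>2 * sqrt (1 + (t\<^sup>2 + t * d - e)) - (1 + (t\<^sup>2 + t * d - e)))
      = (d / 2 + t) * ((1 - (e + t * d - t\<^sup>2)) - (1 - (e + t * d - t\<^sup>2))\<^sup>2 * sqrt (1 - (e + t * d - t\<^sup>2)))"
    using ratio_critical_point[OF d(1) e m(1,2,3,4) zq] unfolding gain_def loss_def by blast
  note b = critical_point_bounds[OF _ d(1) _ assms refl refl t(3-6)]
  have t0: "0 < t" using m t by simp
  show "e \<le> 1 / 200" using b t0 d by simp
  have "e \<le> t\<^sup>2 / 4" using b t0 d by simp
  moreover have "t\<^sup>2 \<le> q\<^sup>2" using t t0 by (intro power_mono) auto
  ultimately show "e \<le> q\<^sup>2 / 4" by simp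
  have "x\<^sup>2 \<le> t\<^sup>2" using t m by (intro power_mono) auto
  hence "x\<^sup>2 \<le> 353 / 5000" "77 / 100 \<le> d\<^sup>2" using b t0 d by auto
  moreover have "e + x * d - x\<^sup>2 < 1"
  proof -
    have "1 - (e + x * d - x\<^sup>2) = (1 - d\<^sup>2 / 4 - e) + (x - d / 2)\<^sup>2" by (simp add: power2_eq_square field_simps)
    thus ?thesis using e zero_le_power2[of "x - d / 2"] by linarith
  qed
  ultimately have "39 / 50 * loss d e x < k * loss d e x" using gain_ge[of d x e] d m assms by simp
  thus "39 / 50 < k" using loss_pos[OF m(4)] by (simp only: mult_less_cancel_right_pos)
qed

lemma defect_le: "e \<le> 1 / 200" "e \<le> q\<^sup>2 / 4"
proof -
  have "e \<le> 1 / 200 \<and> e \<le> q\<^sup>2 / 4" using defect_pos_bounds zero_le_power2[of q]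
    by (cases "0 < e") (simp, linarith)
  thus "e \<le> 1 / 200" "e \<le> q\<^sup>2 / 4" by auto
qed

lemma k_le_linear: "19 / 50 \<le> q \<Longrightarrow> k \<le> 33 / 20 - 13 / 10 * q"
  using k_le gain_le_linear[of d e q] d defect_le zq by auto

lemma inverse_k_le_linear: "19 / 50 \<le> p \<Longrightarrow> 1 \<le> (33 / 20 - 13 / 10 * p) * k"
  using inverse_k_le gain_le_linear[of d e p] d defect_le zp by auto

context
  assumes wide: "21 / 25 \<le> p + q"
begin

text \<open>If \<open>p\<close> is short, \<open>q\<close> is long and the linear bound gives
  \<open>k \<le> 779 / 1000\<close>. This is below \<open>39 / 50\<close>, so there is no positive
  defect and the bound \<open>32 / 25\<close> applies at \<open>p\<close>, a contradiction. The
  detour is needed because the critical point lies on the side of \<open>q\<close> and yields no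
  comparison of \<open>e\<close> with \<open>p^2\<close>.\<close>

lemma p_ge: "17 / 100 \<le> p"
proof (rule ccontr)
  assume p: "\<not> 17 / 100 \<le> p"
  hence q: "67 / 100 \<le> q" using wide by simp
  hence k: "k \<le> 779 / 1000" using k_le_linear by simp
  hence "e \<le> 0" using defect_pos_bounds(3) by force
  hence "e \<le> p\<^sup>2 / 4" using zero_le_power2[of p] by linarith
  hence "1 \<le> 32 / 25 * k" using p pos d by (intro inverse_k_le gain_le_const_small) auto
  thus False using k by simp
qed

lemma q_ge: "17 / 100 \<le> q"
proof (rule ccontr)
  assume q: "\<not> 17 / 100 \<le> q"
  hence p: "67 / 100 \<le> p" using wide by simp
  hence "1 \<le> (33 / 20 - 13 / 10 * p) * k" by (intro inverse_k_le_linear) auto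
  also have "\<dots> \<le> 779 / 1000 * k" using p pos by (intro mult_right_mono) auto
  finally have "1 \<le> 779 / 1000 * k" .
  moreover have "k \<le> 32 / 25" using q pos d defect_le by (intro k_le gain_le_const_small) auto
  ultimately show False by simp
qed

lemma k_le_const: "k \<le> 23 / 20"
proof (cases "q \<le> 77 / 200")
  case True
  thus ?thesis using q_ge d defect_le by (intro k_le gain_le_const) auto
next
  case False
  thus ?thesis using k_le_linear by simp
qed

lemma inverse_k_le_const: "1 \<le> 23 / 20 * k"
proof (cases "p \<le> 77 / 200")
  case True
  thus ?thesis using p_ge d defect_le by (intro inverse_k_le gain_le_const) auto
next
  case False
  hence "1 \<le> (33 / 20 - 13 / 10 * p) * k" by (intro inverse_k_le_linear) auto
  also have "\<dots> \<le> 23 / 20 * k" using False pos by (intro mult_right_mono) auto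
  finally show ?thesis .
qed

lemma k_le_linear': "k \<le> 33 / 20 - 13 / 10 * q"
  using k_le_linear k_le_const by (cases "19 / 50 \<le> q") auto

lemma inverse_k_le_linear': "1 \<le> (33 / 20 - 13 / 10 * p) * k"
proof (cases "19 / 50 \<le> p")
  case False
  note inverse_k_le_const
  also have "23 / 20 * k \<le> (33 / 20 - 13 / 10 * p) * k" using False pos by (intro mult_right_mono) auto
  finally show ?thesis .
qed (use inverse_k_le_linear in auto)

text \<open>The inequality of arithmetic and geometric means for \<open>a * b \<ge> 1\<close>;
  applied to bounds linear in \<open>p\<close> and \<open>q\<close>, it bounds
  \<open>p + q\<close>.\<close>

lemma linear_bounds_sum_ge:
  assumes "k \<le> b" "1 \<le> a * k" shows "2 \<le> a + b"
proof -
  have a: "0 < a" using assms(2) pos by (meson less_le_trans zero_less_mult_pos2 zero_less_one)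
  hence "1 \<le> a * b" using assms by (meson dual_order.trans mult_left_mono less_imp_le)
  moreover have b: "0 < b" using assms pos by simp
  moreover have "4 * (a * b) \<le> (a + b)\<^sup>2" using zero_le_power2[of "a - b"] 
    by (simp add: power2_eq_square algebra_simps)
  ultimately have "2\<^sup>2 \<le> (a + b)\<^sup>2" by simp
  thus ?thesis using a b by (intro power2_le_imp_le[of 2]) auto
qed

lemma width_le': "p + q \<le> 1"
  using linear_bounds_sum_ge[OF k_le_linear' inverse_k_le_linear'] by simp

lemma p_q_le: "p \<le> 601 / 1000" "q \<le> 601 / 1000" 
proof -
  have "20 / 23 \<le> k" using inverse_k_le_const by simp
  thus "q \<le> 601 / 1000" using k_le_linear' by simp
  have a: "0 < 33 / 20 - 13 / 10 * p" using inverse_k_le_linear' pos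
    by (meson less_le_trans zero_less_mult_pos2 zero_less_one)
  note inverse_k_le_linear'
  also have "(33 / 20 - 13 / 10 * p) * k \<le> (33 / 20 - 13 / 10 * p) * (23 / 20)"
    using a k_le_const by (intro mult_left_mono) auto
  finally show "p \<le> 601 / 1000" by simp
qed

text \<open>For smaller \<open>d\<close> the steeper bound with the value 1 at
  \<open>21 / 50\<close> holds, and the same mean inequality gives
  \<open>p + q \<le> 21 / 25\<close>.\<close>

lemma d_ge:
  assumes "21 / 25 < p + q" shows "193 / 200 \<le> d"
proof (rule ccontr)
  assume "\<not> 193 / 200 \<le> d"
  hence d': "d \<le> 193 / 200" by simp
  have "k \<le> 731 / 500 - 11 / 10 * q"
  proof (cases "7 / 25 \<le> q")
    case True
    thus ?thesis using d d' p_q_le defect_le by (intro k_le gain_le_linear_narrow) auto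
  qed (use k_le_const in simp)
  moreover have "1 \<le> (731 / 500 - 11 / 10 * p) * k"
  proof (cases "7 / 25 \<le> p")
    case True
    thus ?thesis using d d' p_q_le defect_le by (intro inverse_k_le gain_le_linear_narrow) auto
  next
    case False
    note inverse_k_le_const
    also have "23 / 20 * k \<le> (731 / 500 - 11 / 10 * p) * k" using False pos by (intro mult_right_mono) auto
    finally show ?thesis .
  qed
  ultimately show False using linear_bounds_sum_ge assms by fastforce
qed

end

lemma width_le: "p + q \<le> 1"
  using width_le' by (cases "21 / 25 \<le> p + q") auto

end


section \<open>Normalised trapezoids: bounds on the width and the masses\<close>

definition excess :: "real \<Rightarrow> real" where
  "excess t = phi t - 1"

lemma excess_less_iff: "0 < s \<Longrightarrow> 0 < t \<Longrightarrow> excess t < excess s \<longleftrightarrow> s < t"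
  by (simp add: excess_def phi_less_iff)

lemma excess_one [simp]: "excess 1 = 0"
  by (simp add: excess_def)

lemma excess_pos_iff: "0 < t \<Longrightarrow> 0 < excess t \<longleftrightarrow> t < 1"
  and excess_neg_iff: "0 < t \<Longrightarrow> excess t < 0 \<longleftrightarrow> 1 < t"
  and excess_eq_0_iff: "0 < t \<Longrightarrow> excess t = 0 \<longleftrightarrow> t = 1"
  using excess_less_iff[of t 1] excess_less_iff[of 1 t] by force+

lemma phi_power2: "0 < r \<Longrightarrow> phi (r\<^sup>2) = 1 / r ^ 3"
  by (simp add: phi_def)

text \<open>Squared distances from the point \<open>x\<close> of the base line to the two top vertices \<open>(d / 2, h)\<close> and
  \<open>(- d / 2, h)\<close>.\<close>

definition right_sq :: "real \<Rightarrow> real \<Rightarrow> real \<Rightarrow> real" where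
  "right_sq d h x = h\<^sup>2 + (x - d / 2)\<^sup>2"

definition left_sq :: "real \<Rightarrow> real \<Rightarrow> real \<Rightarrow> real" where
  "left_sq d h x = h\<^sup>2 + (x + d / 2)\<^sup>2"

text \<open>The bodies \<open>1, 2, 3\<close> are at the points \<open>x1, x2, x3\<close> of the base line, the bodies \<open>4\<close> and \<open>5\<close> at the
  top vertices.  The equations are the components, along the two axes, of the equations of a central
  configuration scaled so that the unit of length is the distance at which two bodies exert no net force
  on each other in the frame of the homothetic motion; the vertical components have been used to
  simplify the horizontal ones.\<close>

locale trapezoid_cc =
  fixes m1 m2 m3 m4 m5 x1 x2 x3 d h :: real
  assumes mass: "0 < m1" "0 < m2" "0 < m3" "0 < m4" "0 < m5"
    and order: "x1 < x2" "x2 < x3" and d: "0 < d" and h: "0 < h"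
    and V1: "m4 * excess (right_sq d h x1) + m5 * excess (left_sq d h x1) = 0"
    and V2: "m4 * excess (right_sq d h x2) + m5 * excess (left_sq d h x2) = 0"
    and V3: "m4 * excess (right_sq d h x3) + m5 * excess (left_sq d h x3) = 0"
    and V4: "m1 * excess (right_sq d h x1) + m2 * excess (right_sq d h x2) + m3 * excess (right_sq d h x3) = 0"
    and V5: "m1 * excess (left_sq d h x1) + m2 * excess (left_sq d h x2) + m3 * excess (left_sq d h x3) = 0"
    and H1: "m2 * excess ((x2 - x1)\<^sup>2) * (x2 - x1) + m3 * excess ((x3 - x1)\<^sup>2) * (x3 - x1)
      = - m4 * excess (right_sq d h x1) * d"
    and H2: "- m1 * excess ((x2 - x1)\<^sup>2) * (x2 - x1) + m3 * excess ((x3 - x2)\<^sup>2) * (x3 - x2)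
      = - m4 * excess (right_sq d h x2) * d"
    and H3: "m1 * excess ((x3 - x1)\<^sup>2) * (x3 - x1) + m2 * excess ((x3 - x2)\<^sup>2) * (x3 - x2)
      = m4 * excess (right_sq d h x3) * d"
    and H4: "m1 * excess (right_sq d h x1) * x1 + m2 * excess (right_sq d h x2) * x2
      + m3 * excess (right_sq d h x3) * x3 = m5 * excess (d\<^sup>2) * d"
    and H5: "m1 * excess (left_sq d h x1) * x1 + m2 * excess (left_sq d h x2) * x2
      + m3 * excess (left_sq d h x3) * x3 = - m4 * excess (d\<^sup>2) * d"
begin

lemma mirror: "trapezoid_cc m3 m2 m1 m5 m4 (- x3) (- x2) (- x1) d h"
proof -
  have 1: "right_sq d h (- x) = left_sq d h x" "left_sq d h (- x) = right_sq d h x" for x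
    by (simp_all add: right_sq_def left_sq_def power2_eq_square algebra_simps)
  show ?thesis
  proof (unfold_locales, unfold 1)
    show "m5 * excess (left_sq d h x3) + m4 * excess (right_sq d h x3) = 0"
      "m5 * excess (left_sq d h x2) + m4 * excess (right_sq d h x2) = 0"
      "m5 * excess (left_sq d h x1) + m4 * excess (right_sq d h x1) = 0"
      using V1 V2 V3 by simp_all
    have e: "- m5 * excess (left_sq d h x) * d = m4 * excess (right_sq d h x) * d"
      if "m4 * excess (right_sq d h x) + m5 * excess (left_sq d h x) = 0" for x
      using that by algebra
    show "m2 * excess ((- x2 - - x3)\<^sup>2) * (- x2 - - x3) + m1 * excess ((- x1 - - x3)\<^sup>2) * (- x1 - - x3)
      = - m5 * excess (left_sq d h x3) * d"
      using H3 unfolding e[OF V3] by (simp add: algebra_simps)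
    show "- m3 * excess ((- x2 - - x3)\<^sup>2) * (- x2 - - x3) + m1 * excess ((- x1 - - x2)\<^sup>2) * (- x1 - - x2)
      = - m5 * excess (left_sq d h x2) * d"
      using H2 unfolding e[OF V2] by (simp add: algebra_simps)
    show "m3 * excess ((- x1 - - x3)\<^sup>2) * (- x1 - - x3) + m2 * excess ((- x1 - - x2)\<^sup>2) * (- x1 - - x2)
      = m5 * excess (left_sq d h x1) * d"
      using H1 e[OF V1] by (simp add: algebra_simps)
  qed (use mass order d h V4 V5 H4 H5 in \<open>simp_all add: algebra_simps\<close>)
qed

lemma sq_pos: "0 < right_sq d h x" "0 < left_sq d h x"
  using h by (auto simp: right_sq_def left_sq_def intro: add_pos_nonneg)

lemma left_minus_right: "left_sq d h x - right_sq d h x = 2 * d * x"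
  by (simp add: right_sq_def left_sq_def power2_eq_square field_simps)

text \<open>Off the axis one top vertex is strictly closer, so the two excesses differ; with a
  vanishing positive combination they must have opposite signs.\<close>

lemma excess_signs:
  assumes "m4 * excess (right_sq d h x) + m5 * excess (left_sq d h x) = 0"
  shows "0 < x \<Longrightarrow> 0 < excess (right_sq d h x) \<and> excess (left_sq d h x) < 0"
    "x < 0 \<Longrightarrow> excess (right_sq d h x) < 0 \<and> 0 < excess (left_sq d h x)"
    "x = 0 \<Longrightarrow> right_sq d h x = 1"
proof -
  have *: "0 < u \<and> v < 0" if "v < u" "m * u + n * v = 0" "0 < m" "0 < n" for m n u v :: real
  proof -
    have u: "0 < u"
    proof (rule ccontr)
      assume "\<not> 0 < u"
      hence "m * u \<le> 0" "n * v < 0" using that by (auto intro: mult_nonneg_nonpos mult_pos_neg)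
      thus False using that by simp
    qed
    hence "0 < m * u" using that by simp
    hence "n * v < 0" using that by linarith
    thus ?thesis using u that by (simp add: mult_less_0_iff)
  qed
  show "0 < excess (right_sq d h x) \<and> excess (left_sq d h x) < 0" if "0 < x"
  proof (rule *[OF _ assms])
    have "right_sq d h x < left_sq d h x" using left_minus_right[of x] d that
      by (metis diff_gt_0_iff_gt mult_pos_pos zero_less_numeral)
    thus "excess (left_sq d h x) < excess (right_sq d h x)" by (simp add: excess_less_iff sq_pos)
  qed (use mass in auto)
  show "excess (right_sq d h x) < 0 \<and> 0 < excess (left_sq d h x)" if "x < 0"
  proof -
    have "left_sq d h x < right_sq d h x" using left_minus_right[of x] d that
      by (metis diff_less_0_iff_less mult_pos_neg mult_pos_pos zero_less_numeral)
    hence "excess (right_sq d h x) < excess (left_sq d h x)" by (simp add: excess_less_iff sq_pos)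
    thus ?thesis using *[of "excess (right_sq d h x)" "excess (left_sq d h x)" m5 m4] assms mass by simp
  qed
  show "right_sq d h x = 1" if "x = 0"
  proof -
    have "left_sq d h x = right_sq d h x" using left_minus_right[of x] that by simp
    hence "(m4 + m5) * excess (right_sq d h x) = 0" using assms by (simp add: algebra_simps)
    thus ?thesis using mass sq_pos[of x] by (simp add: excess_eq_0_iff)
  qed
qed

lemma excess_times_nonneg:
  assumes "m4 * excess (right_sq d h x) + m5 * excess (left_sq d h x) = 0"
  shows "0 \<le> excess (right_sq d h x) * x" "x \<noteq> 0 \<Longrightarrow> 0 < excess (right_sq d h x) * x"
proof -
  show *: "0 < excess (right_sq d h x) * x" if "x \<noteq> 0"
  proof (cases "0 < x")
    case True
    thus ?thesis using excess_signs(1)[OF assms] by simp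
  next
    case False
    thus ?thesis using excess_signs(2)[OF assms] that by (simp add: mult_neg_neg)
  qed
  thus "0 \<le> excess (right_sq d h x) * x" by (cases "x = 0") auto
qed

text \<open>Otherwise all terms of \<open>V4\<close> are nonpositive and two of them are
  negative.\<close>

lemma x3_pos: "0 < x3"
proof (rule ccontr)
  assume "\<not> 0 < x3"
  have "excess (right_sq d h x3) \<le> 0"
    using excess_signs(2,3)[OF V3] \<open>\<not> 0 < x3\<close> by (cases "x3 = 0") (simp, linarith)
  moreover have "excess (right_sq d h x2) < 0" "excess (right_sq d h x1) < 0"
    using excess_signs(2)[OF V1] excess_signs(2)[OF V2] order \<open>\<not> 0 < x3\<close> by auto
  ultimately have "m3 * excess (right_sq d h x3) \<le> 0" "m2 * excess (right_sq d h x2) < 0"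
    "m1 * excess (right_sq d h x1) < 0"
    using mass by (auto intro: mult_nonneg_nonpos mult_pos_neg)
  thus False using V4 by simp
qed

end

lemma (in trapezoid_cc) x1_neg: "x1 < 0"
  using trapezoid_cc.x3_pos[OF mirror] by simp

text \<open>The excess towards the right vertex has the sign of the coordinate, so the left side of
  \<open>H4\<close> is positive.\<close>

lemma (in trapezoid_cc) d_less_1: "d < 1"
proof -
  have "0 < m1 * (excess (right_sq d h x1) * x1) + m2 * (excess (right_sq d h x2) * x2)
      + m3 * (excess (right_sq d h x3) * x3)"
    using mass x1_neg x3_pos excess_times_nonneg[OF V1] excess_times_nonneg[OF V2] excess_times_nonneg[OF V3]
    by (intro add_pos_pos add_pos_nonneg) auto
  hence "0 < m5 * excess (d\<^sup>2) * d" using H4 by (simp add: mult_ac)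
  hence "0 < excess (d\<^sup>2)" using mass d by (simp add: zero_less_mult_iff)
  hence "d\<^sup>2 < 1" using d by (simp add: excess_pos_iff)
  thus ?thesis using d by (simp add: power_less_one_iff abs_square_less_1)
qed

locale right_trapezoid_cc = trapezoid_cc + assumes x2: "0 \<le> x2"
begin

text \<open>\<open>1 - defect\<close> is the squared distance from the origin to either top vertex,
  so a middle body on the axis makes it vanish.\<close>

definition defect :: real where "defect = 1 - d\<^sup>2 / 4 - h\<^sup>2"

lemma right_sq_eq: "right_sq d h x = 1 - (defect + x * d - x\<^sup>2)"
  and left_sq_eq: "left_sq d h x = 1 + (x\<^sup>2 + x * d - defect)"
  by (simp_all add: right_sq_def left_sq_def defect_def power2_eq_square field_simps)

lemma gain_eq: "gain d defect x = excess (right_sq d h x)" 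
  and loss_eq: "loss d defect x = - excess (left_sq d h x)"
  by (simp_all add: gain_def loss_def excess_def right_sq_eq left_sq_eq)

lemma swap_sq: "right_sq d h (- x) = left_sq d h x" "left_sq d h (- x) = right_sq d h x"
  by (simp_all add: right_sq_def left_sq_def power2_eq_square algebra_simps)

lemma balanced_ratios: "balanced_ratios d defect (- x1) x3 x2 (m5 / m4)"
proof
  have s3: "0 < excess (right_sq d h x3)" "excess (left_sq d h x3) < 0" using excess_signs(1)[OF V3] x3_pos by auto
  have s1: "excess (right_sq d h x1) < 0" "0 < excess (left_sq d h x1)" using excess_signs(2)[OF V1] x1_neg by auto
  show "defect < 1 - d\<^sup>2 / 4" using h by (simp add: defect_def)
  show "0 < defect + x3 * d - x3\<^sup>2" "0 < x3\<^sup>2 + x3 * d - defect" 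
    using s3 sq_pos[of x3] by (auto simp: excess_pos_iff excess_neg_iff right_sq_eq left_sq_eq)
  have "right_sq d h (- x1) < 1" "1 < left_sq d h (- x1)"
    using s1 sq_pos[of x1] by (auto simp: excess_pos_iff excess_neg_iff swap_sq)
  thus "0 < defect + - x1 * d - (- x1)\<^sup>2" "0 < (- x1)\<^sup>2 + - x1 * d - defect" 
    unfolding right_sq_eq left_sq_eq by simp_all
  show "gain d defect x3 = m5 / m4 * loss d defect x3" "m5 / m4 * gain d defect (- x1) = loss d defect (- x1)"
    unfolding gain_eq loss_eq swap_sq using V1 V3 mass by (simp_all add: field_simps)
  show "defect = 0 \<or> 0 < x2 \<and> x2 < x3 \<and> 0 < defect + x2 * d - x2\<^sup>2 \<and> 0 < x2\<^sup>2 + x2 * d - defect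
    \<and> gain d defect x2 = m5 / m4 * loss d defect x2"
  proof (cases "x2 = 0")
    case True
    hence "right_sq d h 0 = 1" using excess_signs(3)[OF V2] by simp
    thus ?thesis by (simp add: right_sq_eq)
  next
    case False
    hence "0 < x2" using x2 by simp
    hence s2: "0 < excess (right_sq d h x2)" "excess (left_sq d h x2) < 0" using excess_signs(1)[OF V2] by auto
    hence "0 < defect + x2 * d - x2\<^sup>2" "0 < x2\<^sup>2 + x2 * d - defect" 
      using sq_pos[of x2] by (auto simp: excess_pos_iff excess_neg_iff right_sq_eq left_sq_eq)
    moreover have "gain d defect x2 = m5 / m4 * loss d defect x2"
      unfolding gain_eq loss_eq using V2 mass by (simp add: field_simps)
    ultimately show ?thesis using \<open>0 < x2\<close> order by simp
  qed
qed (use d d_less_1 x1_neg x3_pos mass in auto)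

sublocale ratios: balanced_ratios d defect "- x1" x3 x2 "m5 / m4"
  by (rule balanced_ratios)

end


section \<open>Width of the base and comparison of the masses\<close>

context right_trapezoid_cc
begin

lemma width_le_1: "x3 - x1 \<le> 1"
  using ratios.width_le by simp

lemma base_force: "0 < r \<Longrightarrow> excess (r\<^sup>2) * r = 1 / r\<^sup>2 - r"
  unfolding excess_def by (subst phi_power2) (simp_all add: field_simps eval_nat_numeral)

lemma base_force_antimono:
  assumes "0 < r" "r \<le> s" shows "excess (s\<^sup>2) * s \<le> excess (r\<^sup>2) * r"
proof -
  have "r\<^sup>2 \<le> s\<^sup>2" using assms by (intro power_mono) auto
  hence "1 / s\<^sup>2 \<le> 1 / r\<^sup>2" using assms by (intro divide_left_mono) auto
  thus ?thesis using assms by (simp add: base_force)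
qed

lemma base_force_nonneg: "0 < r \<Longrightarrow> r \<le> 1 \<Longrightarrow> 0 \<le> excess (r\<^sup>2) * r"
  using base_force_antimono[of r 1] by simp

lemma excess_le:
  assumes "149 / 200 \<le> t" shows "excess t \<le> 139 / 250"
proof -
  have "phi t \<le> phi (149 / 200)" using assms by (intro phi_antimono) auto
  also have "\<dots> \<le> 389 / 250" by (intro phi_le) (simp_all add: power2_eq_square power3_eq_cube)
  finally show ?thesis by (simp add: excess_def)
qed

text \<open>\<open>149 / 200 = 1 - 1 / 4 - 1 / 200\<close> bounds the squared height from below. The
  excess at this distance is at most \<open>139 / 250\<close>, which caps the horizontal pull of a
  top body in the mass estimates.\<close>

lemma sq_ge: "149 / 200 \<le> right_sq d h x" "149 / 200 \<le> left_sq d h x"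
proof -
  have "d\<^sup>2 \<le> 1" using d d_less_1 by (simp add: power_le_one)
  hence "149 / 200 \<le> h\<^sup>2" using ratios.defect_le(1) by (simp add: defect_def)
  thus "149 / 200 \<le> right_sq d h x" "149 / 200 \<le> left_sq d h x"
    by (simp_all add: right_sq_def left_sq_def add_increasing2)
qed

lemma H1': "m2 * (excess ((x2 - x1)\<^sup>2) * (x2 - x1)) + m3 * (excess ((x3 - x1)\<^sup>2) * (x3 - x1))
  = m5 * (excess (left_sq d h x1) * d)"
  using H1 V1 by algebra

lemma H3': "m1 * (excess ((x3 - x1)\<^sup>2) * (x3 - x1)) + m2 * (excess ((x3 - x2)\<^sup>2) * (x3 - x2))
  = m4 * (excess (right_sq d h x3) * d)"
  using H3 by (simp only: mult.assoc)

lemma end_excess: "0 \<le> excess (right_sq d h x3)" "0 \<le> excess (left_sq d h x1)" "0 \<le> excess (right_sq d h x2)"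
  using excess_signs(1)[OF V3 x3_pos] excess_signs(2)[OF V1 x1_neg] excess_signs(1,3)[OF V2] x2
  by (simp_all, cases "x2 = 0") simp_all

lemma end_moment:
  "excess (right_sq d h x3) * d \<le> 139 / 250" "excess (left_sq d h x1) * d \<le> 139 / 250"
  using mult_mono[of "excess (right_sq d h x3)" "139 / 250" d 1] mult_mono[of "excess (left_sq d h x1)" "139 / 250" d 1]
    excess_le sq_ge d d_less_1 end_excess by auto

lemma base_forces_nonneg: 
  "0 \<le> excess ((x2 - x1)\<^sup>2) * (x2 - x1)" "0 \<le> excess ((x3 - x2)\<^sup>2) * (x3 - x2)"
  "0 \<le> excess ((x3 - x1)\<^sup>2) * (x3 - x1)"
  using order width_le_1 by (auto intro!: base_force_nonneg)

lemma mass_bounds_narrow: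
  assumes "x3 - x1 \<le> 21 / 25"
  shows "m1 < m4" "m3 < m5" "m2 < m4"
proof -
  have r: "excess ((21 / 25)\<^sup>2) * (21 / 25) > 139 / (250::real)"
    by (subst base_force) (simp_all add: power2_eq_square)
  have F13: "139 / 250 < excess ((x3 - x1)\<^sup>2) * (x3 - x1)"
    using base_force_antimono[of "x3 - x1" "21 / 25"] r assms order by linarith
  have F23: "139 / 250 < excess ((x3 - x2)\<^sup>2) * (x3 - x2)"
    using base_force_antimono[of "x3 - x2" "21 / 25"] r assms order by linarith
  have less: "m < n" if "m * F \<le> n * K" "139 / 250 < F" "K \<le> 139 / 250" "0 < m" "0 < n" for m n F K :: real
  proof -
    have "m * (139 / 250) < m * F" using that by simp
    also have "\<dots> \<le> n * (139 / 250)" using that by (meson mult_left_mono less_imp_le order_trans)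
    finally show ?thesis by simp
  qed
  show "m3 < m5" 
    by (rule less[OF _ F13 end_moment(2)]) (use H1' mult_nonneg_nonneg[of m2, OF _ base_forces_nonneg(1)] mass in auto)
  show "m1 < m4" 
    by (rule less[OF _ F13 end_moment(1)]) (use H3' mult_nonneg_nonneg[of m2, OF _ base_forces_nonneg(2)] mass in auto)
  show "m2 < m4" 
    by (rule less[OF _ F23 end_moment(1)]) (use H3' mult_nonneg_nonneg[of m1, OF _ base_forces_nonneg(3)] mass in auto)
qed

text \<open>The base forces between the ends are now too weak, but \<open>d\<close> is close to 1,
  so the force between the top bodies is tiny. The end masses are therefore compared through the
  equations of the top bodies.\<close>

lemma mass_bounds_wide:
  assumes "21 / 25 < x3 - x1"
  shows "m1 < m4" "m3 < m5" "m2 < m4"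
proof -
  have wide: "21 / 25 \<le> - x1 + x3" "21 / 25 < - x1 + x3" using assms by auto
  note pq = ratios.p_q_le[OF wide(1)] and d_ge = ratios.d_ge[OF wide]
    and k = ratios.k_le_const[OF wide(1)] ratios.inverse_k_le_const[OF wide(1)]
  have top: "excess (d\<^sup>2) * d \<le> 109 / 1000"
  proof -
    have "excess (d\<^sup>2) * d \<le> excess ((193 / 200)\<^sup>2) * (193 / 200)"
      using d_ge by (intro base_force_antimono) auto
    also have "\<dots> \<le> 109 / 1000" by (subst base_force) (simp_all add: power2_eq_square)
    finally show ?thesis .
  qed
  \<comment> \<open>\<open>239 / 1000 = 21 / 25 - 601 / 1000\<close> is the least possible distance
    of either end from the axis.\<close>
  have loss: "311 / 1000 \<le> loss d defect y" if "239 / 1000 \<le> y" for y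
  proof -
    have "239 / 1000 * (193 / 200) \<le> y * d" using that d_ge by (intro mult_mono) auto
    moreover have "(239 / 1000)\<^sup>2 \<le> y\<^sup>2" using that by (intro power_mono) auto
    ultimately have "12827 / 10000 \<le> 1 + (y\<^sup>2 + y * d - defect)" using ratios.defect_le(1)
      by (simp add: power2_eq_square)
    hence "phi (1 + (y\<^sup>2 + y * d - defect)) \<le> phi (12827 / 10000)" by (intro phi_antimono) auto
    also have "\<dots> \<le> 689 / 1000" by (intro phi_le) (simp_all add: power2_eq_square power3_eq_cube)
    finally show ?thesis by (simp add: loss_def)
  qed
  have S3: "270 / 1000 \<le> excess (right_sq d h x3)"
  proof -
    have "20 / 23 \<le> m5 / m4" using k(2) by linarith
    hence "20 / 23 * (311 / 1000) \<le> m5 / m4 * loss d defect x3"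
      using loss[of x3] pq wide mass by (intro mult_mono) auto
    thus ?thesis using ratios.Rq by (simp add: gain_eq)
  qed
  have S1: "270 / 1000 \<le> excess (left_sq d h x1)"
  proof -
    have "loss d defect (- x1) \<le> 23 / 20 * gain d defect (- x1)"
      using ratios.Rp k(1) mult_right_mono[OF k(1), of "gain d defect (- x1)"] end_excess(2)
      by (simp add: gain_eq swap_sq)
    thus ?thesis using loss[of "- x1"] pq wide by (simp add: gain_eq swap_sq)
  qed
  have less: "m < n" if "m * F \<le> n * K" "K < F" "0 \<le> K" "0 < m" "0 < n" for m n F K :: real
  proof (rule ccontr)
    assume "\<not> m < n"
    hence "n * K \<le> m * K" using that by (intro mult_right_mono) auto
    also have "\<dots> < m * F" using that by simp
    finally show False using that by simp
  qed
  show "m3 < m5"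
  proof (rule less)
    have "m3 * (270 / 1000 * (21 / 25)) \<le> m3 * (excess (right_sq d h x3) * (x3 - x1))"
      using S3 assms mass by (intro mult_left_mono mult_mono) auto
    \<comment> \<open>Moments about \<open>x1\<close> eliminate \<open>m1\<close>, and the remaining
      term of the middle body has a favourable sign.\<close>
    also have "\<dots> = m5 * (excess (d\<^sup>2) * d) - m2 * excess (right_sq d h x2) * (x2 - x1)"
      using H4 V4 by algebra
    also have "\<dots> \<le> m5 * (excess (d\<^sup>2) * d)"
      using mass end_excess(3) order by simp
    also have "\<dots> \<le> m5 * (109 / 1000)" using top mass by (intro mult_left_mono) auto
    finally show "m3 * (270 / 1000 * (21 / 25)) \<le> m5 * (109 / 1000)" .
  qed (use mass in auto)
  have F23: "2 \<le> excess ((x3 - x2)\<^sup>2) * (x3 - x2)"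
  proof -
    have "excess ((601 / 1000)\<^sup>2) * (601 / 1000) \<le> excess ((x3 - x2)\<^sup>2) * (x3 - x2)"
      using pq x2 order by (intro base_force_antimono) auto
    moreover have "2 \<le> excess ((601 / 1000)\<^sup>2) * (601 / 1000 :: real)" 
      by (subst base_force) (simp_all add: power2_eq_square)
    ultimately show ?thesis by linarith
  qed
  have m2F: "m2 * (excess ((x3 - x2)\<^sup>2) * (x3 - x2)) \<le> m4 * (139 / 250)"
    using H3' mult_nonneg_nonneg[of m1, OF _ base_forces_nonneg(3)] mass 
      mult_left_mono[OF end_moment(1), of m4] by linarith
  show "m2 < m4"
  proof (rule less)
    show "m2 * 2 \<le> m4 * (139 / 250)" using mult_left_mono[OF F23, of m2] m2F mass by linarith
  qed (use mass in auto)
  have S23: "36 / 10 \<le> excess ((x3 - x2)\<^sup>2)"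
  proof -
    have "(x3 - x2) ^ 3 \<le> (601 / 1000) ^ 3" using pq x2 order by (intro power_mono) auto
    also have "\<dots> \<le> 10 / 46" by (simp add: power3_eq_cube)
    finally have "46 / 10 \<le> 1 / (x3 - x2) ^ 3" using order by (simp add: field_simps)
    thus ?thesis using order by (simp add: excess_def phi_power2)
  qed
  have "m2 * (x3 - x2) * (36 / 10) \<le> m2 * (x3 - x2) * excess ((x3 - x2)\<^sup>2)"
    using S23 mass order by (intro mult_left_mono) auto
  also have "\<dots> \<le> m4 * (139 / 250)" using m2F by (simp add: mult_ac)
  finally have r23: "m2 * (x3 - x2) \<le> m4 * (139 / 900)" by simp
  have B2: "- excess (left_sq d h x2) \<le> 23 / 20 * (139 / 250)"
  proof -
    have "m5 * - excess (left_sq d h x2) = m4 * excess (right_sq d h x2)" using V2 by simp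
    also have "\<dots> \<le> m4 * (139 / 250)" using excess_le[OF sq_ge(1)] mass by (intro mult_left_mono) auto
    also have "\<dots> \<le> (23 / 20 * m5) * (139 / 250)" using k(2) mass by (intro mult_right_mono) (auto simp: field_simps)
    finally have "m5 * - excess (left_sq d h x2) \<le> m5 * (23 / 20 * (139 / 250))" by (simp only: mult_ac)
    thus ?thesis using mass by (simp only: mult_le_cancel_left_pos)
  qed
  show "m1 < m4"
  proof (rule less)
    have "m1 * (270 / 1000 * (21 / 25)) \<le> m1 * (excess (left_sq d h x1) * (x3 - x1))"
      using S1 assms mass by (intro mult_left_mono mult_mono) auto
    \<comment> \<open>Moments about \<open>x3\<close> eliminate \<open>m3\<close>; here the middle
      body enters with the unfavourable sign and is controlled by \<open>r23\<close> and
      \<open>B2\<close>.\<close>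
    also have "\<dots> = m4 * (excess (d\<^sup>2) * d) + m2 * (x3 - x2) * - excess (left_sq d h x2)"
      using H5 V5 by algebra
    also have "\<dots> \<le> m4 * (109 / 1000) + m4 * (139 / 900) * (23 / 20 * (139 / 250))"
    proof (intro add_mono mult_left_mono)
      have "m2 * (x3 - x2) * - excess (left_sq d h x2) \<le> m2 * (x3 - x2) * (23 / 20 * (139 / 250))"
        using B2 mass order by (intro mult_left_mono) auto
      also have "\<dots> \<le> m4 * (139 / 900) * (23 / 20 * (139 / 250))" using r23 by (intro mult_right_mono) auto
      finally show "m2 * (x3 - x2) * - excess (left_sq d h x2) \<le> m4 * (139 / 900) * (23 / 20 * (139 / 250))" .
    qed (use top mass in auto)
    also have "\<dots> \<le> m4 * (21 / 100)" using mass by simp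
    finally show "m1 * (270 / 1000 * (21 / 25)) \<le> m4 * (21 / 100)" .
  qed (use mass in auto)
qed

lemma mass_bounds: "m1 < m4" "m3 < m5" "m2 < m4"
  using mass_bounds_narrow mass_bounds_wide by (cases "x3 - x1 \<le> 21 / 25"; simp)+

end

context trapezoid_cc
begin

theorem width_and_mass_bounds:
  "x3 - x1 \<le> 1" "m1 < m4" "m3 < m5" "m2 < m4 \<or> m2 < m5"
proof -
  have "x3 - x1 \<le> 1 \<and> m1 < m4 \<and> m3 < m5 \<and> (m2 < m4 \<or> m2 < m5)"
  proof (cases "0 \<le> x2")
    case True
    then interpret right_trapezoid_cc by unfold_locales
    show ?thesis using width_le_1 mass_bounds by simp
  next
    case False
    interpret mirror: trapezoid_cc m3 m2 m1 m5 m4 "- x3" "- x2" "- x1" d h by (rule mirror)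
    interpret mirror: right_trapezoid_cc m3 m2 m1 m5 m4 "- x3" "- x2" "- x1" d h 
      using False by unfold_locales simp
    show ?thesis using mirror.width_le_1 mirror.mass_bounds by simp
  qed
  thus "x3 - x1 \<le> 1" "m1 < m4" "m3 < m5" "m2 < m4 \<or> m2 < m5" by auto
qed

end


section \<open>Uniqueness for given places of the bodies\<close>

text \<open>Its derivative is \<open>- excess\<close>, so normalised central configurations are
  critical points of the mass-weighted sum.\<close>

definition pair_energy :: "real \<Rightarrow> real" where
  "pair_energy t = t + 2 / sqrt t"

lemma pair_energy_tangent:
  assumes "0 < s" "0 < t"
  shows "- excess t * (s - t) \<le> pair_energy s - pair_energy t"
    "s \<noteq> t \<Longrightarrow> - excess t * (s - t) < pair_energy s - pair_energy t"
proof -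
  define a b where "a = sqrt t" and "b = sqrt s"
  have ab: "0 < a" "0 < b" "t = a\<^sup>2" "s = b\<^sup>2" "sqrt t = a" "sqrt s = b" using assms by (auto simp: a_def b_def)
  have eq: "pair_energy s - pair_energy t - (- excess t * (s - t)) = (b - a)\<^sup>2 * (b + 2 * a) / (a ^ 3 * b)"
    unfolding pair_energy_def excess_def phi_def ab(5,6) unfolding ab(3,4) using ab(1,2)
    by (simp add: field_simps eval_nat_numeral)
  have "0 \<le> (b - a)\<^sup>2 * (b + 2 * a) / (a ^ 3 * b)" using ab by simp
  thus "- excess t * (s - t) \<le> pair_energy s - pair_energy t" using eq by linarith
  assume "s \<noteq> t"
  hence "0 < (b - a)\<^sup>2 * (b + 2 * a) / (a ^ 3 * b)" using ab by auto
  thus "- excess t * (s - t) < pair_energy s - pair_energy t" using eq by linarith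
qed

text \<open>Convexity of the pair energy as a function of the logarithm of the distance.\<close>

lemma pair_energy_log_tangent:
  assumes "0 < r" "0 < v"
  shows "- 2 * r\<^sup>2 * excess (r\<^sup>2) * ln v \<le> pair_energy ((v * r)\<^sup>2) - pair_energy (r\<^sup>2)"
    "v \<noteq> 1 \<Longrightarrow> - 2 * r\<^sup>2 * excess (r\<^sup>2) * ln v < pair_energy ((v * r)\<^sup>2) - pair_energy (r\<^sup>2)"
proof -
  have eq: "pair_energy ((v * r)\<^sup>2) - pair_energy (r\<^sup>2) - (- 2 * r\<^sup>2 * excess (r\<^sup>2) * ln v)
    = r\<^sup>2 * (v\<^sup>2 - 1 - 2 * ln v) + 2 / r * (inverse v - 1 + ln v)"
  proof -
    have "sqrt ((v * r)\<^sup>2) = v * r" "sqrt (r\<^sup>2) = r" using assms by simp_all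
    thus ?thesis unfolding pair_energy_def excess_def phi_power2[OF assms(1)] using assms
      by (simp add: field_simps eval_nat_numeral)
  qed
  have l: "ln (v\<^sup>2) = 2 * ln v" "ln (inverse v) = - ln v" using assms by (simp_all add: ln_realpow ln_inverse)
  have 1: "0 \<le> v\<^sup>2 - 1 - 2 * ln v" using ln_le_minus_one[of "v\<^sup>2"] assms l by simp
  have 2: "0 \<le> inverse v - 1 + ln v" using ln_le_minus_one[of "inverse v"] assms l by simp
  have "0 \<le> r\<^sup>2 * (v\<^sup>2 - 1 - 2 * ln v) + 2 / r * (inverse v - 1 + ln v)"
    using assms by (intro add_nonneg_nonneg[OF mult_nonneg_nonneg[OF _ 1] mult_nonneg_nonneg[OF _ 2]]) auto
  thus "- 2 * r\<^sup>2 * excess (r\<^sup>2) * ln v \<le> pair_energy ((v * r)\<^sup>2) - pair_energy (r\<^sup>2)" using eq by linarith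
  assume "v \<noteq> 1"
  hence "inverse v - 1 + ln v \<noteq> 0" using ln_eq_minus_one[of "inverse v"] assms l by auto
  hence 3: "0 < inverse v - 1 + ln v" using 2 by simp
  hence "0 < r\<^sup>2 * (v\<^sup>2 - 1 - 2 * ln v) + 2 / r * (inverse v - 1 + ln v)"
    using assms by (intro add_nonneg_pos[OF mult_nonneg_nonneg[OF _ 1] mult_pos_pos[OF _ 3]]) auto
  thus "- 2 * r\<^sup>2 * excess (r\<^sup>2) * ln v < pair_energy ((v * r)\<^sup>2) - pair_energy (r\<^sup>2)" using eq by linarith
qed

definition total_energy :: "real \<Rightarrow> real \<Rightarrow> real \<Rightarrow> real \<Rightarrow> real \<Rightarrow> real \<Rightarrow> real \<Rightarrow> real \<Rightarrow> real \<Rightarrow> real \<Rightarrow> real" where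
  "total_energy m1 m2 m3 m4 m5 x1 x2 x3 d h =
     m1 * m2 * pair_energy ((x2 - x1)\<^sup>2) + m1 * m3 * pair_energy ((x3 - x1)\<^sup>2)
   + m2 * m3 * pair_energy ((x3 - x2)\<^sup>2) + m4 * m5 * pair_energy (d\<^sup>2)
   + (m1 * m4 * pair_energy (right_sq d h x1) + m1 * m5 * pair_energy (left_sq d h x1))
   + (m2 * m4 * pair_energy (right_sq d h x2) + m2 * m5 * pair_energy (left_sq d h x2))
   + (m3 * m4 * pair_energy (right_sq d h x3) + m3 * m5 * pair_energy (left_sq d h x3))"

context trapezoid_cc
begin

text \<open>Every pair energy is bounded below by a tangent: in the squared distance for the pairs of a base and a
  top body, in the logarithm of the distance for the other pairs.  By the equations of a central
  configuration, the tangents at a central configuration add up to zero.\<close>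

lemma total_energy_less:
  fixes y1 y2 y3 d' h' :: real
  assumes "y1 < y2" "y2 < y3" "0 < d'" "0 < h'" 
    and ne: "(y1, y2, y3, d', h') \<noteq> (x1, x2, x3, d, h)"
  shows "total_energy m1 m2 m3 m4 m5 x1 x2 x3 d h < total_energy m1 m2 m3 m4 m5 y1 y2 y3 d' h'"
proof -
  define D where "D = ln (d' / d)"
  define E where "E = (\<lambda>s t. pair_energy s - pair_energy t)"
  have sq_pos': "0 < right_sq d' h' x" "0 < left_sq d' h' x" for x
    using assms by (auto simp: right_sq_def left_sq_def intro: add_pos_nonneg)
  \<comment> \<open>Splitting off \<open>D\<close> and linearising the rest yields the product
    \<open>r' * d'\<close>, the type of term that \<open>side\<close> produces. The linearisation is
    valid only for a nonnegative excess, hence the hypothesis \<open>r \<le> 1\<close>.\<close>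
  have base: "- 2 * excess (r\<^sup>2) * (r * r' * d' / d - r\<^sup>2 * (1 + D)) \<le> E (r'\<^sup>2) (r\<^sup>2)"
    if "0 < r" "r \<le> 1" "0 < r'" for r r'
  proof -
    have "ln (r' / r) = ln (r' * d' / (r * d)) - D" 
      unfolding D_def using that assms d by (simp add: ln_mult ln_div)
    also have "\<dots> \<le> r' * d' / (r * d) - 1 - D" 
      using ln_le_minus_one[of "r' * d' / (r * d)"] that assms d by simp
    finally have l: "ln (r' / r) \<le> r' * d' / (r * d) - 1 - D" .
    have "r\<^sup>2 \<le> 1" using that by (simp add: power_le_one)
    hence "0 \<le> excess (r\<^sup>2)" using that excess_neg_iff[of "r\<^sup>2"] by force
    hence "2 * r\<^sup>2 * excess (r\<^sup>2) * ln (r' / r) \<le> 2 * r\<^sup>2 * excess (r\<^sup>2) * (r' * d' / (r * d) - 1 - D)"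
      using l that by (intro mult_left_mono) auto
    moreover have "- 2 * r\<^sup>2 * excess (r\<^sup>2) * ln (r' / r) \<le> E (r'\<^sup>2) (r\<^sup>2)"
      using pair_energy_log_tangent(1)[of r "r' / r"] that by (simp add: E_def)
    moreover have "2 * r\<^sup>2 * excess (r\<^sup>2) * (r' * d' / (r * d) - 1 - D)
      = 2 * excess (r\<^sup>2) * (r * r' * d' / d - r\<^sup>2 * (1 + D))"
      using that d by (simp add: field_simps power2_eq_square)
    ultimately show ?thesis by simp
  qed
  have top: "- 2 * d\<^sup>2 * excess (d\<^sup>2) * D \<le> E (d'\<^sup>2) (d\<^sup>2)"
    "d' \<noteq> d \<Longrightarrow> - 2 * d\<^sup>2 * excess (d\<^sup>2) * D < E (d'\<^sup>2) (d\<^sup>2)"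
    using pair_energy_log_tangent[of d "d' / d"] d assms by (auto simp: E_def D_def)
  \<comment> \<open>The excesses cancel in weighted form and \<open>L - R = 2 * d * x\<close>, so
    the sum of the two tangents does not contain the heights.\<close>
  have side: "m * (2 * m4 * excess (right_sq d h x) * (y * d' - x * d))
    \<le> m * m4 * E (right_sq d' h' y) (right_sq d h x) + m * m5 * E (left_sq d' h' y) (left_sq d h x)"
    "right_sq d' h' y \<noteq> right_sq d h x \<or> left_sq d' h' y \<noteq> left_sq d h x \<Longrightarrow>
    m * (2 * m4 * excess (right_sq d h x) * (y * d' - x * d))
    < m * m4 * E (right_sq d' h' y) (right_sq d h x) + m * m5 * E (left_sq d' h' y) (left_sq d h x)"
    if m: "0 < m" and V: "m4 * excess (right_sq d h x) + m5 * excess (left_sq d h x) = 0" for m x y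
  proof -
    define R L R' L' where "R = right_sq d h x" and "L = left_sq d h x" 
      and "R' = right_sq d' h' y" and "L' = left_sq d' h' y"
    have LR: "L = R + 2 * d * x" "L' = R' + 2 * d' * y" 
      by (simp_all add: R_def L_def R'_def L'_def right_sq_def left_sq_def power2_eq_square field_simps)
    have V': "m4 * excess R + m5 * excess L = 0" using V by (simp add: R_def L_def)
    have pos: "0 < R" "0 < L" "0 < R'" "0 < L'" using sq_pos sq_pos' by (auto simp: R_def L_def R'_def L'_def)
    have sum: "m * (2 * m4 * excess R * (y * d' - x * d))
      = m * m4 * (- excess R * (R' - R)) + m * m5 * (- excess L * (L' - L))"
      using LR V' by algebra
    have t: "- excess R * (R' - R) \<le> E R' R" "- excess L * (L' - L) \<le> E L' L"
      "R' \<noteq> R \<Longrightarrow> - excess R * (R' - R) < E R' R" "L' \<noteq> L \<Longrightarrow> - excess L * (L' - L) < E L' L"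
      using pair_energy_tangent[of R' R] pair_energy_tangent[of L' L] pos by (auto simp: E_def)
    show "m * (2 * m4 * excess R * (y * d' - x * d)) \<le> m * m4 * E R' R + m * m5 * E L' L"
      unfolding sum using t m mass by (intro add_mono mult_left_mono) auto
    show "m * (2 * m4 * excess R * (y * d' - x * d)) < m * m4 * E R' R + m * m5 * E L' L"
      if "R' \<noteq> R \<or> L' \<noteq> L"
    proof (cases "R' = R")
      case False
      thus ?thesis unfolding sum using t m mass by (intro add_less_le_mono mult_left_mono mult_strict_left_mono) auto
    next
      case True
      hence "L' \<noteq> L" using that by simp
      thus ?thesis unfolding sum using t m mass by (intro add_le_less_mono mult_left_mono mult_strict_left_mono) auto
    qed
  qed
  define b12 b13 b23 where "b12 = m1 * m2 * E ((y2 - y1)\<^sup>2) ((x2 - x1)\<^sup>2)"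
    and "b13 = m1 * m3 * E ((y3 - y1)\<^sup>2) ((x3 - x1)\<^sup>2)" and "b23 = m2 * m3 * E ((y3 - y2)\<^sup>2) ((x3 - x2)\<^sup>2)"
  define T where "T = m4 * m5 * E (d'\<^sup>2) (d\<^sup>2)"
  define s where "s = (\<lambda>m x y. m * m4 * E (right_sq d' h' y) (right_sq d h x) + m * m5 * E (left_sq d' h' y) (left_sq d h x))"
  define l where "l = (\<lambda>m x y. m * (2 * m4 * excess (right_sq d h x) * (y * d' - x * d)))"
  define c where "c = (\<lambda>r r'. - 2 * excess (r\<^sup>2) * (r * r' * d' / d - r\<^sup>2 * (1 + D)))"
  have c: "c r r' \<le> E (r'\<^sup>2) (r\<^sup>2)" if "0 < r" "r \<le> 1" "0 < r'" for r r'
    unfolding c_def using base[OF that] .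
  have l: "l m1 x1 y1 \<le> s m1 x1 y1" "l m2 x2 y2 \<le> s m2 x2 y2" "l m3 x3 y3 \<le> s m3 x3 y3"
    unfolding l_def s_def using side(1)[OF mass(1) V1] side(1)[OF mass(2) V2] side(1)[OF mass(3) V3] by auto
  have b: "m1 * m2 * c (x2 - x1) (y2 - y1) \<le> b12" "m1 * m3 * c (x3 - x1) (y3 - y1) \<le> b13" 
    "m2 * m3 * c (x3 - x2) (y3 - y2) \<le> b23"
    unfolding b12_def b13_def b23_def using mass order assms(1,2) width_and_mass_bounds(1)
    by (auto intro!: mult_left_mono c)
  have T: "m4 * m5 * (- 2 * d\<^sup>2 * excess (d\<^sup>2) * D) \<le> T" 
    "d' \<noteq> d \<Longrightarrow> m4 * m5 * (- 2 * d\<^sup>2 * excess (d\<^sup>2) * D) < T"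
    unfolding T_def using mass top mult_left_mono[OF top(1), of "m4 * m5"]
      mult_strict_left_mono[OF top(2), of "m4 * m5"] by simp_all
  have sum: "m1 * m2 * c (x2 - x1) (y2 - y1) + m1 * m3 * c (x3 - x1) (y3 - y1)
    + m2 * m3 * c (x3 - x2) (y3 - y2) + m4 * m5 * (- 2 * d\<^sup>2 * excess (d\<^sup>2) * D)
    + l m1 x1 y1 + l m2 x2 y2 + l m3 x3 y3 = 0"
  proof -
    define w where "w = d' / d"
    have w: "d' = w * d" using d by (simp add: w_def)
    have c: "c r r' = - 2 * excess (r\<^sup>2) * (r * r' * w - r\<^sup>2 * (1 + D))" for r r'
      using d by (simp add: c_def w)
    define s12 s13 s23 a1 a2 a3 s where "s12 = excess ((x2 - x1)\<^sup>2)" and "s13 = excess ((x3 - x1)\<^sup>2)"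
      and "s23 = excess ((x3 - x2)\<^sup>2)" and "a1 = excess (right_sq d h x1)" and "a2 = excess (right_sq d h x2)"
      and "a3 = excess (right_sq d h x3)" and "s = excess (d\<^sup>2)"
    \<comment> \<open>The horizontal equations tested against an arbitrary displacement. The choice
      of the competitor's coordinates removes all terms with \<open>w\<close>; the choice of the
      original ones, with \<open>H4\<close>, removes those with \<open>D\<close>.\<close>
    have virial: "m1 * m2 * (s12 * (x2 - x1) * (z2 - z1)) + m1 * m3 * (s13 * (x3 - x1) * (z3 - z1))
      + m2 * m3 * (s23 * (x3 - x2) * (z3 - z2)) = m4 * d * (m1 * a1 * z1 + m2 * a2 * z2 + m3 * a3 * z3)" 
      (is "?lhs = _") for z1 z2 z3
    proof -
      have "?lhs = - (z1 * m1) * (m2 * s12 * (x2 - x1) + m3 * s13 * (x3 - x1))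
        - (z2 * m2) * (- m1 * s12 * (x2 - x1) + m3 * s23 * (x3 - x2))
        + (z3 * m3) * (m1 * s13 * (x3 - x1) + m2 * s23 * (x3 - x2))" by algebra
      also have "\<dots> = - (z1 * m1) * (- m4 * a1 * d) - (z2 * m2) * (- m4 * a2 * d) + (z3 * m3) * (m4 * a3 * d)"
        using H1 H2 H3 by (simp only: s12_def s13_def s23_def a1_def a2_def a3_def)
      also have "\<dots> = m4 * d * (m1 * a1 * z1 + m2 * a2 * z2 + m3 * a3 * z3)" by algebra
      finally show ?thesis .
    qed
    have "m1 * m2 * c (x2 - x1) (y2 - y1) + m1 * m3 * c (x3 - x1) (y3 - y1)
        + m2 * m3 * c (x3 - x2) (y3 - y2) + m4 * m5 * (- 2 * d\<^sup>2 * s * D)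
        + l m1 x1 y1 + l m2 x2 y2 + l m3 x3 y3
      = - 2 * w * (m1 * m2 * (s12 * (x2 - x1) * (y2 - y1)) + m1 * m3 * (s13 * (x3 - x1) * (y3 - y1))
          + m2 * m3 * (s23 * (x3 - x2) * (y3 - y2)))
        + 2 * (1 + D) * (m1 * m2 * (s12 * (x2 - x1) * (x2 - x1)) + m1 * m3 * (s13 * (x3 - x1) * (x3 - x1))
          + m2 * m3 * (s23 * (x3 - x2) * (x3 - x2)))
        - 2 * m4 * m5 * d\<^sup>2 * s * D
        + 2 * m4 * w * d * (m1 * a1 * y1 + m2 * a2 * y2 + m3 * a3 * y3)
        - 2 * m4 * d * (m1 * a1 * x1 + m2 * a2 * x2 + m3 * a3 * x3)"
      unfolding c l_def w s12_def[symmetric] s13_def[symmetric] s23_def[symmetric]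
        a1_def[symmetric] a2_def[symmetric] a3_def[symmetric] by algebra
    also have "\<dots> = 2 * D * m4 * d * (m1 * a1 * x1 + m2 * a2 * x2 + m3 * a3 * x3) - 2 * m4 * m5 * d\<^sup>2 * s * D"
      unfolding virial by algebra
    also have "m1 * a1 * x1 + m2 * a2 * x2 + m3 * a3 * x3 = m5 * s * d"
      using H4 by (simp only: a1_def a2_def a3_def s_def)
    also have "2 * D * m4 * d * (m5 * s * d) - 2 * m4 * m5 * d\<^sup>2 * s * D = 0" by algebra
    finally show ?thesis by (simp only: s_def)
  qed
  have total: "total_energy m1 m2 m3 m4 m5 y1 y2 y3 d' h' - total_energy m1 m2 m3 m4 m5 x1 x2 x3 d h
    = b12 + b13 + b23 + T + s m1 x1 y1 + s m2 x2 y2 + s m3 x3 y3"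
    unfolding total_energy_def b12_def b13_def b23_def T_def s_def E_def by (simp add: algebra_simps)
  have "0 < b12 + b13 + b23 + T + s m1 x1 y1 + s m2 x2 y2 + s m3 x3 y3"
  proof (cases "d' = d")
    case False
    thus ?thesis using l b T(2) sum by linarith
  next
    case True
    \<comment> \<open>For equal top sides, the distances of one base body to both top vertices
      determine its position and the height; a different competitor thus makes some
      \<open>side\<close> inequality strict.\<close>
    have same: "y = x \<and> h' = h" if "right_sq d' h' y = right_sq d h x" "left_sq d' h' y = left_sq d h x" for x y
    proof -
      have "left_sq d' h' y - right_sq d' h' y = 2 * d' * y"
        by (simp add: left_sq_def right_sq_def power2_eq_square field_simps)
      hence "2 * d * y = 2 * d * x" using that left_minus_right[of x] True by metis
      hence "y = x" using d by simp
      moreover have "h'\<^sup>2 = h\<^sup>2" using that True \<open>y = x\<close> by (simp add: right_sq_def)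
      ultimately show ?thesis using h assms by (simp add: power2_eq_iff_nonneg)
    qed
    have "l m1 x1 y1 < s m1 x1 y1 \<or> l m2 x2 y2 < s m2 x2 y2 \<or> l m3 x3 y3 < s m3 x3 y3"
      unfolding l_def s_def
      using side(2)[OF mass(1) V1, of y1] side(2)[OF mass(2) V2, of y2] side(2)[OF mass(3) V3, of y3] 
        same[of y1 x1] same[of y2 x2] same[of y3 x3] ne True by blast
    thus ?thesis using l b T(1) sum by linarith
  qed
  thus ?thesis using total by linarith
qed

end

text \<open>Of two different solutions each would have strictly less energy than the other.\<close>

theorem trapezoid_cc_unique:
  assumes "trapezoid_cc m1 m2 m3 m4 m5 x1 x2 x3 d h" "trapezoid_cc m1 m2 m3 m4 m5 y1 y2 y3 d' h'"
  shows "(y1, y2, y3, d', h') = (x1, x2, x3, d, h)"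
proof -
  interpret x: trapezoid_cc m1 m2 m3 m4 m5 x1 x2 x3 d h by fact
  interpret y: trapezoid_cc m1 m2 m3 m4 m5 y1 y2 y3 d' h' by fact
  show ?thesis
    using x.total_energy_less[OF y.order y.d y.h] y.total_energy_less[OF x.order x.d x.h] by force
qed


section \<open>Central configurations in a frame\<close>

text \<open>The complex map \<open>c + (a + i b) * (u + i v)\<close>: an orientation-preserving
  similarity whose rotation and scale are both carried by \<open>a\<close> and
  \<open>b\<close>.\<close>

definition place :: "real ^ 2 \<Rightarrow> real \<Rightarrow> real \<Rightarrow> real \<Rightarrow> real \<Rightarrow> real ^ 2" where
  "place c a b u v = c + vector [a * u - b * v, b * u + a * v]"

lemma place_nth [simp]: "place c a b u v $ 1 = c $ 1 + (a * u - b * v)" "place c a b u v $ 2 = c $ 2 + (b * u + a * v)"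
  by (simp_all add: place_def)

lemma place_rescale: "\<rho> \<noteq> 0 \<Longrightarrow> place c (a / \<rho>) (b / \<rho>) (\<rho> * u) (\<rho> * v) = place c a b u v"
  by (simp add: place_def)

lemma place_half_turn: "place c (- a) (- b) u v = place c a b (- u) (- v)"
  by (simp add: place_def)

lemma place_dist: "(dist (place c a b u v) (place c a b u' v'))\<^sup>2 = (a\<^sup>2 + b\<^sup>2) * ((u - u')\<^sup>2 + (v - v')\<^sup>2)"
proof -
  have "(dist (place c a b u v) (place c a b u' v'))\<^sup>2 
    = (a * u - b * v - (a * u' - b * v'))\<^sup>2 + (b * u + a * v - (b * u' + a * v'))\<^sup>2"
    unfolding dist_norm power2_norm_eq_inner by (simp add: inner_vec_def sum_2 power2_eq_square)
  also have "\<dots> = (a\<^sup>2 + b\<^sup>2) * ((u - u')\<^sup>2 + (v - v')\<^sup>2)" by algebra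
  finally show ?thesis .
qed

lemma phi_dist: "1 / dist x y ^ 3 = phi ((dist x y)\<^sup>2)"
  by (simp add: phi_def)

lemma phi_mult: "phi (s * t) = phi s * phi t"
  by (simp add: phi_def real_sqrt_mult power_mult_distrib)

text \<open>The centre of mass is eliminated; \<open>\<kappa>\<close> is \<open>\<lambda>\<close> divided by the total mass.\<close>

definition balanced :: "(5 \<Rightarrow> real) \<Rightarrow> config \<Rightarrow> real \<Rightarrow> bool" where
  "balanced m x \<kappa> \<longleftrightarrow> (\<forall>j. (\<Sum>i\<in>UNIV - {j}. (m i * (1 / dist (x i) (x j) ^ 3 - \<kappa>)) *\<^sub>R (x i - x j)) = 0)"

lemma central_configuration_balanced:
  assumes m: "\<And>i. 0 < m i" and cc: "central_configuration m x"
  obtains \<kappa> where "balanced m x \<kappa>"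
proof -
  define M where "M = (\<Sum>i\<in>UNIV. m i)"
  have M: "0 < M" unfolding M_def using m by (intro sum_pos) auto
  obtain l where l: "\<And>j. (- l * m j) *\<^sub>R (x j - mass_center m x) =
        (\<Sum>i\<in>UNIV - {j}. (m i * m j / dist (x i) (x j) ^ 3) *\<^sub>R (x i - x j))"
    using cc unfolding central_configuration_def by blast
  have "(\<Sum>i\<in>UNIV - {j}. (m i * (1 / dist (x i) (x j) ^ 3 - l / M)) *\<^sub>R (x i - x j)) = 0" for j
  proof -
    have "M *\<^sub>R (mass_center m x - x j) = (\<Sum>i\<in>UNIV. m i *\<^sub>R x i) - M *\<^sub>R x j"
      using M by (simp add: mass_center_def M_def scaleR_diff_right)
    also have "\<dots> = (\<Sum>i\<in>UNIV. m i *\<^sub>R (x i - x j))"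
      by (simp add: M_def scaleR_diff_right sum_subtractf scaleR_left.sum)
    also have "\<dots> = (\<Sum>i\<in>UNIV - {j}. m i *\<^sub>R (x i - x j))"
      by (rule sum.mono_neutral_right) auto
    finally have "(1 / M) *\<^sub>R (M *\<^sub>R (mass_center m x - x j)) = (1 / M) *\<^sub>R (\<Sum>i\<in>UNIV - {j}. m i *\<^sub>R (x i - x j))"
      by (simp only:)
    hence c: "mass_center m x - x j = (1 / M) *\<^sub>R (\<Sum>i\<in>UNIV - {j}. m i *\<^sub>R (x i - x j))"
      using M by simp
    have "m j *\<^sub>R (\<Sum>i\<in>UNIV - {j}. (m i * (1 / dist (x i) (x j) ^ 3 - l / M)) *\<^sub>R (x i - x j))
      = (\<Sum>i\<in>UNIV - {j}. (m i * m j / dist (x i) (x j) ^ 3) *\<^sub>R (x i - x j)) - 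
        (l * m j / M) *\<^sub>R (\<Sum>i\<in>UNIV - {j}. m i *\<^sub>R (x i - x j))"
      unfolding scaleR_sum_right sum_subtractf[symmetric]
    proof (rule sum.cong)
      fix i
      have "m j * (m i * (1 / dist (x i) (x j) ^ 3 - l / M)) = m i * m j / dist (x i) (x j) ^ 3 - l * m j / M * m i"
        by (simp add: algebra_simps)
      thus "m j *\<^sub>R (m i * (1 / dist (x i) (x j) ^ 3 - l / M)) *\<^sub>R (x i - x j)
        = (m i * m j / dist (x i) (x j) ^ 3) *\<^sub>R (x i - x j) - (l * m j / M) *\<^sub>R m i *\<^sub>R (x i - x j)"
        by (simp only: scaleR_scaleR scaleR_diff_left[symmetric])
    qed simp
    also have "\<dots> = (- l * m j) *\<^sub>R (x j - mass_center m x) - (l * m j) *\<^sub>R (mass_center m x - x j)"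
      unfolding l[symmetric] c by simp
    also have "\<dots> = 0" by (simp add: algebra_simps)
    finally show ?thesis using m[of j] by simp
  qed
  thus ?thesis using that unfolding balanced_def by blast
qed

text \<open>Multiplication by the conjugate \<open>a - i b\<close> turns coordinates into frame
  components, up to the nonzero factor \<open>a^2 + b^2\<close>.\<close>

lemma balanced_components:
  assumes "balanced m x \<kappa>" and x: "\<And>i. x i = place c a b (u i) (v i)" and g: "0 < a\<^sup>2 + b\<^sup>2"
  shows "(\<Sum>i\<in>UNIV - {j}. m i * (phi (a\<^sup>2 + b\<^sup>2) * phi ((u i - u j)\<^sup>2 + (v i - v j)\<^sup>2) - \<kappa>) * (u i - u j)) = 0"
    "(\<Sum>i\<in>UNIV - {j}. m i * (phi (a\<^sup>2 + b\<^sup>2) * phi ((u i - u j)\<^sup>2 + (v i - v j)\<^sup>2) - \<kappa>) * (v i - v j)) = 0"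
proof -
  define k where "k = (\<lambda>i. m i * (phi (a\<^sup>2 + b\<^sup>2) * phi ((u i - u j)\<^sup>2 + (v i - v j)\<^sup>2) - \<kappa>))"
  have cancel: "S = 0" if "(a\<^sup>2 + b\<^sup>2) * S = 0" for S
  proof -
    have "a\<^sup>2 + b\<^sup>2 \<noteq> 0" using g by linarith
    thus ?thesis using that by (metis mult_eq_0_iff)
  qed
  have "(\<Sum>i\<in>UNIV - {j}. k i *\<^sub>R (x i - x j)) = 0"
    using assms(1) unfolding balanced_def phi_dist k_def x place_dist phi_mult by blast
  hence "(\<Sum>i\<in>UNIV - {j}. k i *\<^sub>R (x i - x j)) $ n = 0" for n by simp
  hence s: "(\<Sum>i\<in>UNIV - {j}. k i * (x i $ n - x j $ n)) = 0" for n by simp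
  have "(a\<^sup>2 + b\<^sup>2) * (\<Sum>i\<in>UNIV - {j}. k i * (u i - u j))
    = a * (\<Sum>i\<in>UNIV - {j}. k i * (x i $ 1 - x j $ 1)) + b * (\<Sum>i\<in>UNIV - {j}. k i * (x i $ 2 - x j $ 2))"
    unfolding x place_nth sum_distrib_left sum.distrib[symmetric]
    by (rule sum.cong) (auto simp: algebra_simps power2_eq_square)
  hence "(a\<^sup>2 + b\<^sup>2) * (\<Sum>i\<in>UNIV - {j}. k i * (u i - u j)) = 0" by (simp only: s mult_zero_right add_0_right diff_0_right)
  thus "(\<Sum>i\<in>UNIV - {j}. k i * (u i - u j)) = 0" by (rule cancel)
  have "(a\<^sup>2 + b\<^sup>2) * (\<Sum>i\<in>UNIV - {j}. k i * (v i - v j))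
    = a * (\<Sum>i\<in>UNIV - {j}. k i * (x i $ 2 - x j $ 2)) - b * (\<Sum>i\<in>UNIV - {j}. k i * (x i $ 1 - x j $ 1))"
    unfolding x place_nth sum_distrib_left sum_subtractf[symmetric]
    by (rule sum.cong) (auto simp: algebra_simps power2_eq_square)
  hence "(a\<^sup>2 + b\<^sup>2) * (\<Sum>i\<in>UNIV - {j}. k i * (v i - v j)) = 0" by (simp only: s mult_zero_right add_0_right diff_0_right)
  thus "(\<Sum>i\<in>UNIV - {j}. k i * (v i - v j)) = 0" by (rule cancel)
qed

text \<open>The origin lies below the midpoint of the top side, and \<open>0 < h\<close> makes
  \<open>p f q r s\<close> the anti-clockwise order. Leaving the scale in \<open>a\<close>,
  \<open>b\<close> allows the unit of length to be chosen later.\<close>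

definition in_frame :: "config \<Rightarrow> 5 \<Rightarrow> 5 \<Rightarrow> 5 \<Rightarrow> 5 \<Rightarrow> 5 \<Rightarrow> real ^ 2 \<Rightarrow> real \<Rightarrow> real \<Rightarrow> real \<Rightarrow> real \<Rightarrow> real \<Rightarrow> real \<Rightarrow> real \<Rightarrow> bool" where
  "in_frame x p f q r s c a b x1 x2 x3 d h \<longleftrightarrow>
     distinct [p, f, q, r, s] \<and> 0 < a\<^sup>2 + b\<^sup>2 \<and> x1 < x2 \<and> x2 < x3 \<and> 0 < d \<and> 0 < h \<and>
     x p = place c a b x1 0 \<and> x f = place c a b x2 0 \<and> x q = place c a b x3 0 \<and>
     x r = place c a b (d / 2) h \<and> x s = place c a b (- d / 2) h"

lemma UNIV_5: "distinct [p, f, q, r, s] \<Longrightarrow> UNIV = {p, f, q, r, s :: 5}"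
proof -
  assume "distinct [p, f, q, r, s]"
  hence "card {p, f, q, r, s} = 5" by simp
  moreover have "card (UNIV :: 5 set) = 5" by simp
  ultimately have "card {p, f, q, r, s} = card (UNIV :: 5 set)" by (simp only:)
  thus ?thesis using card_subset_eq[of UNIV "{p, f, q, r, s}"] by auto
qed

lemma in_frame_rescale:
  assumes "in_frame x p f q r s c a b x1 x2 x3 d h" "0 < \<rho>"
  shows "in_frame x p f q r s c (a / \<rho>) (b / \<rho>) (\<rho> * x1) (\<rho> * x2) (\<rho> * x3) (\<rho> * d) (\<rho> * h)"
proof -
  have "0 < (a\<^sup>2 + b\<^sup>2) / \<rho>\<^sup>2" using assms by (simp add: in_frame_def)
  moreover have "(a\<^sup>2 + b\<^sup>2) / \<rho>\<^sup>2 = (a / \<rho>)\<^sup>2 + (b / \<rho>)\<^sup>2" by (simp add: power_divide add_divide_distrib)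
  ultimately have "0 < (a / \<rho>)\<^sup>2 + (b / \<rho>)\<^sup>2" by simp
  thus ?thesis
    using assms place_rescale[of \<rho> c a b] place_rescale[of \<rho> c a b _ 0] 
      place_rescale[of \<rho> c a b "d / 2" h] place_rescale[of \<rho> c a b "- d / 2" h]
    unfolding in_frame_def by simp
qed

text \<open>Stated for an arbitrary scale because it is used twice: before normalisation for the
  sign of \<open>\<kappa>\<close>, and afterwards for the equations of
  \<open>trapezoid_cc\<close>.\<close>

lemma in_frame_balanced:
  assumes F: "in_frame x p f q r s c a b x1 x2 x3 d h" and m: "\<And>i. 0 < m i" and B: "balanced m x \<kappa>"
  defines "k \<equiv> \<lambda>t. phi (a\<^sup>2 + b\<^sup>2) * phi t - \<kappa>"
  shows
    "m r * k (right_sq d h x1) + m s * k (left_sq d h x1) = 0"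
    "m r * k (right_sq d h x2) + m s * k (left_sq d h x2) = 0"
    "m r * k (right_sq d h x3) + m s * k (left_sq d h x3) = 0"
    "m p * k (right_sq d h x1) + m f * k (right_sq d h x2) + m q * k (right_sq d h x3) = 0"
    "m p * k (left_sq d h x1) + m f * k (left_sq d h x2) + m q * k (left_sq d h x3) = 0"
    "m f * k ((x2 - x1)\<^sup>2) * (x2 - x1) + m q * k ((x3 - x1)\<^sup>2) * (x3 - x1) = - m r * k (right_sq d h x1) * d"
    "- m p * k ((x2 - x1)\<^sup>2) * (x2 - x1) + m q * k ((x3 - x2)\<^sup>2) * (x3 - x2) = - m r * k (right_sq d h x2) * d"
    "m p * k ((x3 - x1)\<^sup>2) * (x3 - x1) + m f * k ((x3 - x2)\<^sup>2) * (x3 - x2) = m r * k (right_sq d h x3) * d"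
    "m p * k (right_sq d h x1) * x1 + m f * k (right_sq d h x2) * x2 + m q * k (right_sq d h x3) * x3 
      = m s * k (d\<^sup>2) * d"
    "m p * k (left_sq d h x1) * x1 + m f * k (left_sq d h x2) * x2 + m q * k (left_sq d h x3) * x3 
      = - m r * k (d\<^sup>2) * d"
proof -
  have dist: "distinct [p, f, q, r, s]" and g: "0 < a\<^sup>2 + b\<^sup>2" and h: "0 < h"
    and xs: "x p = place c a b x1 0" "x f = place c a b x2 0" "x q = place c a b x3 0"
      "x r = place c a b (d / 2) h" "x s = place c a b (- d / 2) h"
    using F unfolding in_frame_def by auto
  define u where "u = (\<lambda>i. if i = p then x1 else if i = f then x2 else if i = q then x3 else if i = r then d / 2 else - d / 2)"
  define v where "v = (\<lambda>i. if i = r \<or> i = s then h else 0)"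
  have u: "u p = x1" "u f = x2" "u q = x3" "u r = d / 2" "u s = - d / 2" 
    and v: "v p = 0" "v f = 0" "v q = 0" "v r = h" "v s = h" using dist by (auto simp: u_def v_def)
  have x: "x i = place c a b (u i) (v i)" for i
  proof -
    have "i \<in> {p, f, q, r, s}" using UNIV_5[OF dist] by blast
    thus ?thesis by (auto simp: xs u v)
  qed
  define w where "w = (\<lambda>i j. (u i - u j)\<^sup>2 + (v i - v j)\<^sup>2)"
  have eu: "(\<Sum>i\<in>UNIV - {j}. m i * k (w i j) * (u i - u j)) = 0"
    and ev: "(\<Sum>i\<in>UNIV - {j}. m i * k (w i j) * (v i - v j)) = 0" for j
    using balanced_components[OF B x g] unfolding k_def w_def by auto
  have rest: "UNIV - {p} = {f, q, r, s}" "UNIV - {f} = {p, q, r, s}" "UNIV - {q} = {p, f, r, s}" 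
    "UNIV - {r} = {p, f, q, s}" "UNIV - {s} = {p, f, q, r}"
    unfolding UNIV_5[OF dist] using dist by auto
  have sq: "w r p = right_sq d h x1" "w r f = right_sq d h x2" "w r q = right_sq d h x3" 
    "w s p = left_sq d h x1" "w s f = left_sq d h x2" "w s q = left_sq d h x3" 
    "w p r = right_sq d h x1" "w f r = right_sq d h x2" "w q r = right_sq d h x3" 
    "w p s = left_sq d h x1" "w f s = left_sq d h x2" "w q s = left_sq d h x3" 
    "w r s = d\<^sup>2" "w s r = d\<^sup>2" "w p f = (x2 - x1)\<^sup>2" "w f p = (x2 - x1)\<^sup>2"
    "w p q = (x3 - x1)\<^sup>2" "w q p = (x3 - x1)\<^sup>2" "w f q = (x3 - x2)\<^sup>2" "w q f = (x3 - x2)\<^sup>2"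
    unfolding w_def u v right_sq_def left_sq_def by (simp_all add: power2_eq_square field_simps)
  have sum_4: "(\<Sum>i\<in>{i1, i2, i3, i4}. G i) = G i1 + (G i2 + (G i3 + G i4))" 
    if "distinct [i1, i2, i3, i4]" for i1 i2 i3 i4 :: 5 and G :: "5 \<Rightarrow> real" using that by simp
  have sums: "(\<Sum>i\<in>UNIV - {p}. G i) = G f + (G q + (G r + G s))" 
    "(\<Sum>i\<in>UNIV - {f}. G i) = G p + (G q + (G r + G s))" 
    "(\<Sum>i\<in>UNIV - {q}. G i) = G p + (G f + (G r + G s))"
    "(\<Sum>i\<in>UNIV - {r}. G i) = G p + (G f + (G q + G s))" 
    "(\<Sum>i\<in>UNIV - {s}. G i) = G p + (G f + (G q + G r))" for G :: "5 \<Rightarrow> real"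
    unfolding rest using dist by (simp_all add: sum_4)
  note V0 = ev[of p, unfolded sums sq v] ev[of f, unfolded sums sq v] ev[of q, unfolded sums sq v]
    ev[of r, unfolded sums sq v] ev[of s, unfolded sums sq v]
  have V: "m r * k (right_sq d h x1) * h + m s * k (left_sq d h x1) * h = 0"
    "m r * k (right_sq d h x2) * h + m s * k (left_sq d h x2) * h = 0"
    "m r * k (right_sq d h x3) * h + m s * k (left_sq d h x3) * h = 0"
    "m p * k (right_sq d h x1) * - h + m f * k (right_sq d h x2) * - h + m q * k (right_sq d h x3) * - h = 0"
    "m p * k (left_sq d h x1) * - h + m f * k (left_sq d h x2) * - h + m q * k (left_sq d h x3) * - h = 0"
    using V0 by simp_all
  show V': "m r * k (right_sq d h x1) + m s * k (left_sq d h x1) = 0"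
    "m r * k (right_sq d h x2) + m s * k (left_sq d h x2) = 0"
    "m r * k (right_sq d h x3) + m s * k (left_sq d h x3) = 0"
    "m p * k (right_sq d h x1) + m f * k (right_sq d h x2) + m q * k (right_sq d h x3) = 0"
    "m p * k (left_sq d h x1) + m f * k (left_sq d h x2) + m q * k (left_sq d h x3) = 0"
    using V h unfolding distrib_right[symmetric] by simp_all
  have U: "m f * k ((x2 - x1)\<^sup>2) * (x2 - x1) + (m q * k ((x3 - x1)\<^sup>2) * (x3 - x1) 
      + (m r * k (right_sq d h x1) * (d / 2 - x1) + m s * k (left_sq d h x1) * (- d / 2 - x1))) = 0"
    "m p * k ((x2 - x1)\<^sup>2) * (x1 - x2) + (m q * k ((x3 - x2)\<^sup>2) * (x3 - x2) 
      + (m r * k (right_sq d h x2) * (d / 2 - x2) + m s * k (left_sq d h x2) * (- d / 2 - x2))) = 0"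
    "m p * k ((x3 - x1)\<^sup>2) * (x1 - x3) + (m f * k ((x3 - x2)\<^sup>2) * (x2 - x3) 
      + (m r * k (right_sq d h x3) * (d / 2 - x3) + m s * k (left_sq d h x3) * (- d / 2 - x3))) = 0"
    "m p * k (right_sq d h x1) * (x1 - d / 2) + (m f * k (right_sq d h x2) * (x2 - d / 2)
      + (m q * k (right_sq d h x3) * (x3 - d / 2) + m s * k (d\<^sup>2) * (- d / 2 - d / 2))) = 0"
    "m p * k (left_sq d h x1) * (x1 - - d / 2) + (m f * k (left_sq d h x2) * (x2 - - d / 2)
      + (m q * k (left_sq d h x3) * (x3 - - d / 2) + m r * k (d\<^sup>2) * (d / 2 - - d / 2))) = 0"
    by (fact eu[of p, unfolded sums sq u] eu[of f, unfolded sums sq u] eu[of q, unfolded sums sq u]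
      eu[of r, unfolded sums sq u] eu[of s, unfolded sums sq u])+
  have row: "P + Q = - R * d" if "P + (Q + (R * (d / 2 - x) + T * (- d / 2 - x))) = 0" "R + T = 0" for P Q R T x
  proof -
    have "T = - R" using that by simp
    thus ?thesis using that(1) by (simp add: algebra_simps)
  qed
  have column: "P * x1 + Q * x2 + R * x3 = T * (2 * D)" 
    if "P * (x1 - D) + (Q * (x2 - D) + (R * (x3 - D) + T * (- D - D))) = 0" "P + Q + R = 0" for P Q R T D
  proof -
    have "P * x1 + Q * x2 + R * x3 - T * (2 * D) 
      = P * (x1 - D) + (Q * (x2 - D) + (R * (x3 - D) + T * (- D - D))) + D * (P + Q + R)" by algebra
    thus ?thesis using that by simp
  qed
  show "m f * k ((x2 - x1)\<^sup>2) * (x2 - x1) + m q * k ((x3 - x1)\<^sup>2) * (x3 - x1) = - m r * k (right_sq d h x1) * d"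
    using row[OF U(1) V'(1)] by simp
  show "- m p * k ((x2 - x1)\<^sup>2) * (x2 - x1) + m q * k ((x3 - x2)\<^sup>2) * (x3 - x2) = - m r * k (right_sq d h x2) * d"
    using row[OF U(2) V'(2)] by (simp add: algebra_simps)
  show "m p * k ((x3 - x1)\<^sup>2) * (x3 - x1) + m f * k ((x3 - x2)\<^sup>2) * (x3 - x2) = m r * k (right_sq d h x3) * d"
    using row[OF U(3) V'(3)] by (simp add: algebra_simps)
  show "m p * k (right_sq d h x1) * x1 + m f * k (right_sq d h x2) * x2 + m q * k (right_sq d h x3) * x3 
      = m s * k (d\<^sup>2) * d"
    using column[of _ "d / 2" _ _ "m s * k (d\<^sup>2)", OF _ V'(4)] U(4) by simp
  show "m p * k (left_sq d h x1) * x1 + m f * k (left_sq d h x2) * x2 + m q * k (left_sq d h x3) * x3 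
      = - m r * k (d\<^sup>2) * d"
    using column[of _ "- d / 2" _ _ "m r * k (d\<^sup>2)", OF _ V'(5)] U(5) by simp
qed

lemma in_frame_trapezoid_cc:
  assumes F: "in_frame x p f q r s c a b x1 x2 x3 d h" and m: "\<And>i. 0 < m i" and B: "balanced m x \<kappa>"
  obtains a' b' z1 z2 z3 d' h' where "in_frame x p f q r s c a' b' z1 z2 z3 d' h'"
    "trapezoid_cc (m p) (m f) (m q) (m r) (m s) z1 z2 z3 d' h'"
proof -
  have g: "0 < a\<^sup>2 + b\<^sup>2" and h: "0 < h" using F by (auto simp: in_frame_def)
  have pos: "0 < phi (a\<^sup>2 + b\<^sup>2) * phi (right_sq d h x1)" "0 < phi (a\<^sup>2 + b\<^sup>2) * phi (left_sq d h x1)"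
    using g h by (auto intro!: mult_pos_pos phi_pos simp: right_sq_def left_sq_def add_pos_nonneg)
  \<comment> \<open>The vertical balance of \<open>p\<close> makes \<open>\<kappa>\<close> a
    weighted mean of two attractions, hence positive.\<close>
  have "(m r + m s) * \<kappa> = m r * (phi (a\<^sup>2 + b\<^sup>2) * phi (right_sq d h x1)) + m s * (phi (a\<^sup>2 + b\<^sup>2) * phi (left_sq d h x1))"
    using in_frame_balanced(1)[OF F m B] by (simp add: algebra_simps)
  also have "0 < \<dots>" using pos m by (simp add: add_pos_pos)
  finally have \<kappa>: "0 < \<kappa>" using m[of r] m[of s] by (simp add: zero_less_mult_iff)
  \<comment> \<open>With this factor the attraction at unit distance in the frame is exactly
    \<open>\<kappa>\<close>.\<close>
  define \<rho> where "\<rho> = root 3 (\<kappa> / phi (a\<^sup>2 + b\<^sup>2))"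
  have \<rho>: "0 < \<rho>" "\<rho> ^ 3 = \<kappa> / phi (a\<^sup>2 + b\<^sup>2)" using \<kappa> phi_pos[OF g] by (auto simp: \<rho>_def)
  define a' b' z1 z2 z3 d' h' where "a' = a / \<rho>" and "b' = b / \<rho>" and "z1 = \<rho> * x1" and "z2 = \<rho> * x2"
    and "z3 = \<rho> * x3" and "d' = \<rho> * d" and "h' = \<rho> * h"
  have F': "in_frame x p f q r s c a' b' z1 z2 z3 d' h'"
    unfolding a'_def b'_def z1_def z2_def z3_def d'_def h'_def using in_frame_rescale[OF F \<rho>(1)] .
  have "a'\<^sup>2 + b'\<^sup>2 = (a\<^sup>2 + b\<^sup>2) * (1 / \<rho>)\<^sup>2" by (simp add: a'_def b'_def power_divide add_divide_distrib)
  hence "phi (a'\<^sup>2 + b'\<^sup>2) = phi (a\<^sup>2 + b\<^sup>2) * phi ((1 / \<rho>)\<^sup>2)" by (simp only: phi_mult)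
  also have "phi ((1 / \<rho>)\<^sup>2) = \<rho> ^ 3" using \<rho>(1) by (subst phi_power2) (simp_all add: power_divide)
  also have "phi (a\<^sup>2 + b\<^sup>2) * \<rho> ^ 3 = \<kappa>" using \<rho>(2) phi_pos[OF g] by simp
  finally have k: "phi (a'\<^sup>2 + b'\<^sup>2) * phi t - \<kappa> = \<kappa> * excess t" for t
    by (simp add: excess_def algebra_simps)
  note E = in_frame_balanced[OF F' m B, unfolded k]
  have cancel: "X = Y" if "\<kappa> * X = \<kappa> * Y" for X Y using that \<kappa> by simp
  have "trapezoid_cc (m p) (m f) (m q) (m r) (m s) z1 z2 z3 d' h'"
    by (unfold_locales; (rule cancel)?)
      (use F' E m in \<open>simp_all add: in_frame_def algebra_simps\<close>)
  thus ?thesis using F' that by blast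
qed


section \<open>Frames adapted to a trapezoid\<close>

lemma place_shift: "place (place c a b w 0) a b u v = place c a b (w + u) v"
  by (simp add: vec_eq_iff forall_2 algebra_simps)

lemma place_surj:
  assumes "0 < a\<^sup>2 + b\<^sup>2" obtains u v where "z = place c a b u v"
proof
  define g where "g = a\<^sup>2 + b\<^sup>2"
  have g: "g \<noteq> 0" using assms unfolding g_def by linarith
  define z1 z2 where "z1 = z $ 1 - c $ 1" and "z2 = z $ 2 - c $ 2"
  have "a * ((a * z1 + b * z2) / g) - b * ((a * z2 - b * z1) / g) = (g * z1) / g"
    unfolding times_divide_eq_right diff_divide_distrib[symmetric] g_def by (simp add: algebra_simps power2_eq_square)
  moreover have "b * ((a * z1 + b * z2) / g) + a * ((a * z2 - b * z1) / g) = (g * z2) / g"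
    unfolding times_divide_eq_right add_divide_distrib[symmetric] g_def by (simp add: algebra_simps power2_eq_square)
  ultimately show "z = place c a b ((a * z1 + b * z2) / g) ((a * z2 - b * z1) / g)"
    using g by (simp add: vec_eq_iff forall_2 z1_def z2_def)
qed

lemma trapezoidal_in_frame:
  assumes "trapezoidal x"
  obtains p f q r s c a b x1 x2 x3 d h where "in_frame x p f q r s c a b x1 x2 x3 d h"
proof -
  obtain p q r s f where dist: "distinct [p, q, r, s, f]" and trap: "trapezoid (x p) (x q) (x r) (x s)"
    and f: "x f \<in> open_segment (x p) (x q)" using assms unfolding trapezoidal_def by blast
  obtain t where col: "\<not> collinear {x p, x q, x r}" and t: "0 < t" "x r - x s = t *\<^sub>R (x q - x p)"
    using trap unfolding trapezoid_def by blast
  obtain u where u: "0 < u" "u < 1" "x f = (1 - u) *\<^sub>R x p + u *\<^sub>R x q"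
    using f by (auto simp: in_segment)
  define a b where "a = x q $ 1 - x p $ 1" and "b = x q $ 2 - x p $ 2"
  have "x p \<noteq> x q" using col by auto
  hence "a \<noteq> 0 \<or> b \<noteq> 0" by (auto simp: a_def b_def vec_eq_iff forall_2)
  hence g: "0 < a\<^sup>2 + b\<^sup>2" by (simp add: sum_power2_gt_zero_iff)
  obtain w h where s: "x s = place (x p) a b w h" using place_surj[OF g] by blast
  have q: "x q = place (x p) a b 1 0" by (simp add: vec_eq_iff forall_2 a_def b_def)
  have f: "x f = place (x p) a b u 0" unfolding u(3) by (simp add: vec_eq_iff forall_2 a_def b_def algebra_simps)
  have "x r = x s + t *\<^sub>R (x q - x p)" using t by (metis add.commute diff_add_cancel)
  hence r: "x r = place (x p) a b (w + t) h" 
    unfolding s by (simp add: vec_eq_iff forall_2 a_def b_def algebra_simps)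
  have "h \<noteq> 0"
  proof
    assume "h = 0"
    hence "x r - x p = (w + t) *\<^sub>R (x q - x p)" unfolding r by (simp add: vec_eq_iff forall_2 a_def b_def algebra_simps)
    hence "collinear {0, x q - x p, x r - x p}" unfolding collinear_lemma by blast
    hence "collinear {x q, x p, x r}" using collinear_3[of "x q" "x p" "x r"] by simp
    thus False using col by (simp add: insert_commute)
  qed
  \<comment> \<open>The frame coordinate of the midpoint of the top side, which becomes the
    origin.\<close>
  define e where "e = w + t / 2"
  define c where "c = place (x p) a b e 0"
  have P: "x p = place c a b (- e) 0" "x f = place c a b (u - e) 0" "x q = place c a b (1 - e) 0"
    "x r = place c a b (t / 2) h" "x s = place c a b (- t / 2) h"
    unfolding f q r s c_def place_shift by (simp_all add: e_def vec_eq_iff forall_2)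
  show ?thesis
  proof (cases "0 < h")
    case True
    have "in_frame x p f q r s c a b (- e) (u - e) (1 - e) t h"
      unfolding in_frame_def using P g t u dist True by auto
    thus ?thesis by (rule that)
  next
    case False
    \<comment> \<open>If the top lies below the base, a half turn lifts it and exchanges left and
      right.\<close>
    have "in_frame x q f p s r c (- a) (- b) (e - 1) (e - u) e t (- h)"
      unfolding in_frame_def place_half_turn using P g t u dist False \<open>h \<noteq> 0\<close> by auto
    thus ?thesis by (rule that)
  qed
qed

section \<open>The cyclic order determines the places up to rotation\<close>

definition cross :: "real ^ 2 \<Rightarrow> real ^ 2 \<Rightarrow> real" where
  "cross y z = y $ 1 * z $ 2 - y $ 2 * z $ 1"

text \<open>The cross product is affine in the base point, so \<open>X\<close> and its hull lie in a
  closed half-plane, and interior points in the open one.\<close>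

lemma cross_pos_interior:
  fixes P Q z :: "real ^ 2"
  assumes "P \<noteq> Q" "\<And>y. y \<in> X \<Longrightarrow> 0 \<le> cross (P - y) (Q - y)" "z \<in> interior (convex hull X)"
  shows "0 < cross (P - z) (Q - z)"
proof -
  define n :: "real ^ 2" where "n = vector [P $ 2 - Q $ 2, Q $ 1 - P $ 1]"
  have c: "cross (P - y) (Q - y) = cross P Q + n \<bullet> y" for y
    by (simp add: cross_def n_def inner_vec_def sum_2 algebra_simps)
  have n: "n \<noteq> 0" using assms(1) by (auto simp: n_def vec_eq_iff forall_2)
  have "X \<subseteq> {y. n \<bullet> y \<ge> - cross P Q}" using assms(2) unfolding c by force
  hence "convex hull X \<subseteq> {y. n \<bullet> y \<ge> - cross P Q}" by (intro hull_minimal convex_halfspace_ge)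
  hence "interior (convex hull X) \<subseteq> {y. n \<bullet> y > - cross P Q}"
    using interior_mono interior_halfspace_ge[OF n] by metis
  thus ?thesis using assms(3) unfolding c by auto
qed

lemma cross_place:
  "cross (place c a b u v - place c a b u'' v'') (place c a b u' v' - place c a b u'' v'')
    = (a\<^sup>2 + b\<^sup>2) * ((u - u'') * (v' - v'') - (v - v'') * (u' - u''))"
  by (simp add: cross_def place_def algebra_simps power2_eq_square)

lemma in_frame_cross_pos:
  assumes F: "in_frame x p f q r s c a b x1 x2 x3 d h" and z: "z \<in> interior (convex hull range x)"
  shows "0 < cross (x p - z) (x f - z)" "0 < cross (x f - z) (x q - z)" "0 < cross (x q - z) (x r - z)"
    "0 < cross (x r - z) (x s - z)" "0 < cross (x s - z) (x p - z)" "0 < cross (x p - z) (x q - z)"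
proof -
  have g: "0 < a\<^sup>2 + b\<^sup>2" and dist: "distinct [p, f, q, r, s]" 
    and o: "x1 < x2" "x2 < x3" "0 < d" "0 < h" and P: "x p = place c a b x1 0" "x f = place c a b x2 0" 
    "x q = place c a b x3 0" "x r = place c a b (d / 2) h" "x s = place c a b (- d / 2) h"
    using F unfolding in_frame_def by auto
  have X: "range x = {x p, x f, x q, x r, x s}" unfolding UNIV_5[OF dist] by auto
  have ne: "place c a b u v \<noteq> place c a b u' v'" if "u \<noteq> u' \<or> v \<noteq> v'" for u v u' v'
  proof
    assume "place c a b u v = place c a b u' v'"
    hence "(a\<^sup>2 + b\<^sup>2) * ((u - u')\<^sup>2 + (v - v')\<^sup>2) = 0" using place_dist[of c a b u v u' v'] by simp
    hence "(u - u')\<^sup>2 + (v - v')\<^sup>2 = 0" using g by (metis less_irrefl mult_eq_0_iff)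
    thus False using that by (simp add: sum_power2_eq_zero_iff)
  qed
  have pos: "0 < cross (place c a b u v - z) (place c a b u' v' - z)"
    if "u \<noteq> u' \<or> v \<noteq> v'" 
      "\<And>u'' v''. (u'', v'') \<in> {(x1, 0), (x2, 0), (x3, 0), (d / 2, h), (- d / 2, h)} \<Longrightarrow> 
        0 \<le> (u - u'') * (v' - v'') - (v - v'') * (u' - u'')" for u v u' v'
  proof (rule cross_pos_interior[OF ne[OF that(1)] _ z])
    fix y assume "y \<in> range x"
    then obtain u'' v'' where uv: "(u'', v'') \<in> {(x1, 0), (x2, 0), (x3, 0), (d / 2, h), (- d / 2, h)}" 
      "y = place c a b u'' v''" unfolding X P by blast
    show "0 \<le> cross (place c a b u v - y) (place c a b u' v' - y)"
      unfolding uv(2) cross_place using that(2)[OF uv(1)] g by simp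
  qed
  show "0 < cross (x p - z) (x f - z)" "0 < cross (x f - z) (x q - z)" "0 < cross (x p - z) (x q - z)"
    "0 < cross (x q - z) (x r - z)" "0 < cross (x r - z) (x s - z)" "0 < cross (x s - z) (x p - z)"
    unfolding P by (rule pos; use o in \<open>auto simp: algebra_simps\<close>)+
qed

lemma sin_pos_cases:
  assumes "0 < sin t" "- (2 * pi) < t" "t < 2 * pi"
  shows "0 < t \<and> t < pi \<or> t < - pi"
proof (rule ccontr)
  assume "\<not> ?thesis"
  hence "pi \<le> t \<or> (- pi \<le> t \<and> t \<le> 0)" by auto
  thus False
  proof
    assume "pi \<le> t"
    hence "0 \<le> sin (t - pi)" using assms by (intro sin_ge_zero) auto
    thus False using assms by simp
  next
    assume "- pi \<le> t \<and> t \<le> 0"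
    hence "0 \<le> sin (- t)" by (intro sin_ge_zero) auto
    thus False using assms by simp
  qed
qed

text \<open>The hypothesis on the step from \<open>P\<close> to \<open>Q\<close> excludes a closed polygon winding twice around the centre.\<close>

lemma single_descent:
  fixes P F Q R S w :: real
  assumes "0 < w"
    and "0 < F - P \<and> F - P < w \<or> F - P < - w" "0 < Q - F \<and> Q - F < w \<or> Q - F < - w"
    and "0 < R - Q \<and> R - Q < w \<or> R - Q < - w" "0 < S - R \<and> S - R < w \<or> S - R < - w"
    and "0 < P - S \<and> P - S < w \<or> P - S < - w" "0 < Q - P \<and> Q - P < w \<or> Q - P < - w"
    and "P < Q + 2 * w" "F < R + 2 * w" "Q < S + 2 * w" "R < P + 2 * w" "S < F + 2 * w"
      "Q < P + 2 * w" "R < F + 2 * w" "S < Q + 2 * w" "P < R + 2 * w" "F < S + 2 * w"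
  shows "P < F \<and> F < Q \<and> Q < R \<and> R < S \<or> F < Q \<and> Q < R \<and> R < S \<and> S < P \<or>
    Q < R \<and> R < S \<and> S < P \<and> P < F \<or> R < S \<and> S < P \<and> P < F \<and> F < Q \<or> S < P \<and> P < F \<and> F < Q \<and> Q < R"
  using assms by argo


text \<open>Five strictly increasing residues exhaust the type; their integer representatives make
  this linear arithmetic.\<close>

lemma increasing_5:
  fixes i1 i2 i3 i4 i5 :: 5
  assumes "i1 < i2" "i2 < i3" "i3 < i4" "i4 < i5"
  shows "i1 = 0" "i2 = 1" "i3 = 2" "i4 = 3" "i5 = 4"
proof -
  have R: "0 \<le> Rep_bit1 i" "Rep_bit1 i < 5" for i :: 5
    using Rep_bit1[of i] by auto
  have "Rep_bit1 i1 = 0 \<and> Rep_bit1 i2 = 1 \<and> Rep_bit1 i3 = 2 \<and> Rep_bit1 i4 = 3 \<and> Rep_bit1 i5 = 4"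
    using assms R[of i1] R[of i5] unfolding less_bit1_def by linarith
  thus "i1 = 0" "i2 = 1" "i3 = 2" "i4 = 3" "i5 = 4"
    by (simp_all add: bit1.Rep_inject_sym bit1.Rep_0 bit1.Rep_1 bit1.Rep_numeral)
qed

text \<open>Seen from the interior point, each consecutive pair turns anti-clockwise by less than a
  half turn. As all angles lie within one full turn, the cycle of places descends in angle just
  once, and the position of the descent is the rotation.\<close>

lemma cyclic_roles:
  assumes F: "in_frame x p f q r s c a b x1 x2 x3 d h" and hull: "anticlockwise_on_hull \<sigma> x" and \<sigma>: "bij \<sigma>"
  shows "(p, f, q, r, s) \<in> {(\<sigma> 0, \<sigma> 1, \<sigma> 2, \<sigma> 3, \<sigma> 4), (\<sigma> 4, \<sigma> 0, \<sigma> 1, \<sigma> 2, \<sigma> 3),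
    (\<sigma> 3, \<sigma> 4, \<sigma> 0, \<sigma> 1, \<sigma> 2), (\<sigma> 2, \<sigma> 3, \<sigma> 4, \<sigma> 0, \<sigma> 1), (\<sigma> 1, \<sigma> 2, \<sigma> 3, \<sigma> 4, \<sigma> 0)}"
proof -
  obtain z \<rho> \<theta> where z: "z \<in> interior (convex hull range x)"
    and \<rho>: "\<And>k. 0 < \<rho> k" and x: "\<And>k. x (\<sigma> k) = z + \<rho> k *\<^sub>R vector [cos (\<theta> k), sin (\<theta> k)]"
    and \<theta>: "strict_mono \<theta>" "\<And>i j. \<theta> j < \<theta> i + 2 * pi"
    using hull unfolding anticlockwise_on_hull_def by blast
  define \<tau> where "\<tau> = inv \<sigma>"
  define T where "T = \<theta> \<circ> \<tau>"
  have \<sigma>\<tau>: "\<sigma> (\<tau> i) = i" for i using \<sigma> by (simp add: \<tau>_def bij_is_surj surj_f_inv_f)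
  have step: "0 < T j - T i \<and> T j - T i < pi \<or> T j - T i < - pi" if "0 < cross (x i - z) (x j - z)" for i j
  proof -
    have "cross (x i - z) (x j - z) = (\<rho> (\<tau> i) * \<rho> (\<tau> j)) * sin (T j - T i)"
      using x[of "\<tau> i"] x[of "\<tau> j"] unfolding \<sigma>\<tau> by (simp add: cross_def T_def sin_diff algebra_simps)
    moreover have "0 < \<rho> (\<tau> i) * \<rho> (\<tau> j)" using \<rho> by simp
    ultimately have "0 < sin (T j - T i)" using that by (metis zero_less_mult_pos)
    moreover have "- (2 * pi) < T j - T i" "T j - T i < 2 * pi"
      using \<theta>(2)[of "\<tau> i" "\<tau> j"] \<theta>(2)[of "\<tau> j" "\<tau> i"] by (auto simp: T_def)
    ultimately show ?thesis by (rule sin_pos_cases)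
  qed
  have T: "T i < T j + 2 * pi" for i j using \<theta>(2) by (simp add: T_def)
  note steps = in_frame_cross_pos[OF F z, THEN step]
  have sorted: "i1 = \<sigma> 0 \<and> i2 = \<sigma> 1 \<and> i3 = \<sigma> 2 \<and> i4 = \<sigma> 3 \<and> i5 = \<sigma> 4"
    if "T i1 < T i2 \<and> T i2 < T i3 \<and> T i3 < T i4 \<and> T i4 < T i5" for i1 i2 i3 i4 i5
  proof -
    have "\<tau> i1 < \<tau> i2" "\<tau> i2 < \<tau> i3" "\<tau> i3 < \<tau> i4" "\<tau> i4 < \<tau> i5"
      using that strict_mono_less[OF \<theta>(1)] by (auto simp: T_def)
    from increasing_5[OF this] show ?thesis using \<sigma>\<tau> by metis
  qed
  have "T p < T f \<and> T f < T q \<and> T q < T r \<and> T r < T s \<or> T f < T q \<and> T q < T r \<and> T r < T s \<and> T s < T p \<or>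
    T q < T r \<and> T r < T s \<and> T s < T p \<and> T p < T f \<or> T r < T s \<and> T s < T p \<and> T p < T f \<and> T f < T q \<or>
    T s < T p \<and> T p < T f \<and> T f < T q \<and> T q < T r"
    by (rule single_descent[OF pi_gt_zero steps]) (rule T)+
  thus ?thesis by (elim disjE) (drule sorted, simp)+
qed

section \<open>Similarity of configurations with equal frame coordinates\<close>

lemma equivalent_places:
  assumes x: "\<And>i. x i = place c a b (u i) (v i)" and y: "\<And>i. y i = place c' a' b' (u i) (v i)"
    and g: "0 < a\<^sup>2 + b\<^sup>2" "0 < a'\<^sup>2 + b'\<^sup>2"
  shows "equivalent_configs x y"
proof -
  define G s where "G = a\<^sup>2 + b\<^sup>2" and "s = sqrt ((a'\<^sup>2 + b'\<^sup>2) / (a\<^sup>2 + b\<^sup>2))"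
  have G: "G \<noteq> 0" using g unfolding G_def by linarith
  have G0: "0 < G" "0 < (a'\<^sup>2 + b'\<^sup>2) / G" using g by (simp_all only: G_def divide_pos_pos)
  have s0: "0 < s" "s\<^sup>2 = (a'\<^sup>2 + b'\<^sup>2) / G"
    using G0 by (simp_all only: s_def G_def real_sqrt_gt_0_iff real_sqrt_pow2 less_imp_le)
  have s: "0 < s" "s\<^sup>2 * G = a'\<^sup>2 + b'\<^sup>2" using s0 G by simp_all
  \<comment> \<open>Cosine and sine of the argument of \<open>(a' + i b') / (a + i b)\<close>, whose
    modulus is \<open>s\<close>.\<close>
  define C S where "C = (a * a' + b * b') / (G * s)" and "S = (a * b' - b * a') / (G * s)"
  have CS: "C\<^sup>2 + S\<^sup>2 = 1"
  proof -
    have "(a * a' + b * b')\<^sup>2 + (a * b' - b * a')\<^sup>2 = (a'\<^sup>2 + b'\<^sup>2) * G" unfolding G_def by algebra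
    also have "\<dots> = (G * s)\<^sup>2" unfolding s(2)[symmetric] by algebra
    finally show ?thesis using G s(1) unfolding C_def S_def power_divide add_divide_distrib[symmetric] by simp
  qed
  define Q :: "real ^ 2 ^ 2" where "Q = vector [vector [C, - S], vector [S, C]]"
  have Q: "Q $ 1 $ 1 = C" "Q $ 1 $ 2 = - S" "Q $ 2 $ 1 = S" "Q $ 2 $ 2 = C" by (simp_all add: Q_def)
  have "transpose Q ** Q = mat 1"
    using CS by (simp add: vec_eq_iff forall_2 matrix_matrix_mult_def transpose_def mat_def sum_2 Q power2_eq_square algebra_simps)
  moreover have "Q ** transpose Q = mat 1"
    using CS by (simp add: vec_eq_iff forall_2 matrix_matrix_mult_def transpose_def mat_def sum_2 Q power2_eq_square algebra_simps)
  moreover have "det Q = 1" using CS by (simp add: det_2 Q power2_eq_square)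
  ultimately have rot: "rotation_matrix Q" by (simp add: rotation_matrix_def orthogonal_matrix_def)
  have sC: "s * C = (a * a' + b * b') / G" "s * S = (a * b' - b * a') / G" using s(1) by (simp_all add: C_def S_def)
  have a': "a' = s * C * a - s * S * b" "b' = s * S * a + s * C * b"
  proof -
    have "s * C * a - s * S * b = (a' * G) / G"
      unfolding sC times_divide_eq_left diff_divide_distrib[symmetric] G_def by (simp add: algebra_simps power2_eq_square)
    thus "a' = s * C * a - s * S * b" using G by simp
    have "s * S * a + s * C * b = (b' * G) / G"
      unfolding sC times_divide_eq_left add_divide_distrib[symmetric] G_def by (simp add: algebra_simps power2_eq_square)
    thus "b' = s * S * a + s * C * b" using G by simp
  qed
  have "y i = s *\<^sub>R (Q *v x i) + (c' - s *\<^sub>R (Q *v c))" for i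
    unfolding x y by (simp add: vec_eq_iff forall_2 matrix_vector_mult_def sum_2 Q a' algebra_simps)
  thus ?thesis unfolding equivalent_configs_def using s(1) rot by blast
qed

lemma in_frame_equivalent:
  assumes "in_frame x p f q r s c a b x1 x2 x3 d h" "in_frame y p f q r s c' a' b' x1 x2 x3 d h"
  shows "equivalent_configs x y"
proof (rule equivalent_places)
  define u where "u = (\<lambda>i. if i = p then x1 else if i = f then x2 else if i = q then x3 else if i = r then d / 2 else - d / 2)"
  define v where "v = (\<lambda>i. if i = r \<or> i = s then h else 0)"
  have dist: "distinct [p, f, q, r, s]" using assms(1) by (simp add: in_frame_def)
  have i: "i \<in> {p, f, q, r, s}" for i using UNIV_5[OF dist] by blast
  show "x i = place c a b (u i) (v i)" "y i = place c' a' b' (u i) (v i)" for i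
    using i[of i] assms dist unfolding in_frame_def u_def v_def by auto
qed (use assms in \<open>simp_all only: in_frame_def\<close>)

theorem theorem1:
  fixes m :: "5 \<Rightarrow> real" and \<sigma> :: "5 \<Rightarrow> 5" and x y :: config
  assumes "\<And>i. m i > 0"
    and "bij \<sigma>"
    and "anticlockwise_on_hull \<sigma> x" and "trapezoidal x" and "central_configuration m x"
    and "anticlockwise_on_hull \<sigma> y" and "trapezoidal y" and "central_configuration m y"
  shows "equivalent_configs x y"
proof -
  have frame: "\<exists>p f q r s c a b x1 x2 x3 d h. in_frame x p f q r s c a b x1 x2 x3 d h
      \<and> trapezoid_cc (m p) (m f) (m q) (m r) (m s) x1 x2 x3 d h"
    if trapezoidal: "trapezoidal x" and central: "central_configuration m x" for x
  proof -
    obtain p f q r s c a b x1 x2 x3 d h where F: "in_frame x p f q r s c a b x1 x2 x3 d h"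
      using trapezoidal_in_frame[OF trapezoidal] by blast
    obtain \<kappa> where B: "balanced m x \<kappa>" using central_configuration_balanced[OF assms(1) central] by blast
    show ?thesis by (rule in_frame_trapezoid_cc[OF F assms(1) B]) blast
  qed
  obtain p f q r s c a b x1 x2 x3 d h where X: "in_frame x p f q r s c a b x1 x2 x3 d h"
    "trapezoid_cc (m p) (m f) (m q) (m r) (m s) x1 x2 x3 d h" using frame[OF assms(4,5)] by blast
  obtain p' f' q' r' s' c' a' b' y1 y2 y3 d' h' where Y: "in_frame y p' f' q' r' s' c' a' b' y1 y2 y3 d' h'"
    "trapezoid_cc (m p') (m f') (m q') (m r') (m s') y1 y2 y3 d' h'" using frame[OF assms(7,8)] by blast
  \<comment> \<open>Relative to each other the assignments are rotated. By one place, the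
    inequalities of one assignment contradict those of the other at an end of the base. By two
    places, the inequality for the middle body is needed: for
    \<open>(p', f', q', r', s') = (q, r, s, p, f)\<close>, \<open>m s < m f\<close> gives
    \<open>m f < m r\<close>, while \<open>m r < max (m p) (m f)\<close> and
    \<open>m p < m r\<close>.\<close>
  have "(p', f', q', r', s') = (p, f, q, r, s)"
    using cyclic_roles[OF X(1) assms(3,2)] cyclic_roles[OF Y(1) assms(6,2)]
      trapezoid_cc.width_and_mass_bounds(2-4)[OF X(2)] trapezoid_cc.width_and_mass_bounds(2-4)[OF Y(2)]
    by (elim insertE emptyE) auto
  hence roles: "p' = p" "f' = f" "q' = q" "r' = r" "s' = s" by auto
  have "(y1, y2, y3, d', h') = (x1, x2, x3, d, h)"
    using trapezoid_cc_unique[OF X(2) Y(2)[unfolded roles]] .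
  thus ?thesis using in_frame_equivalent[OF X(1)] Y(1) unfolding roles by simp
qed

end
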